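(* Let $q\ge 2$ be an integer, $d\ge 1$, $A_0,\dots,A_{q-1}\in\mathbb{C}^{d\times d}$, and let $(v(n))_{n\ge 0}$ be a sequence in $\mathbb{C}^d$ with $v(qn+r)=A_r v(n)$ for all $0\le r<q$ and $n\ge 0$. Let $x(n)$ be the first component of $v(n)$ and $X(N)=\sum_{0\le n<N}x(n)$. Let $C=\sum_{r=0}^{q-1}A_r$, and let $R>0$ be such that $\|A_{r_1}\cdots A_{r_\ell}\|=O(R^\ell)$ holds for all $\ell\ge 0$ and $0\le r_1,\dots,r_\ell<q$. Then the following hold. (1) We have, for integers $N\to\infty$, $$X(N)=\sum_{\substack{\lambda\in\sigma(C)\\ |\lambda|>R}}N^{\log_q\lambda}\sum_{0\le k<m(\lambda)}(\log_q N)^k\,\Phi_{\lambda k}(\{\log_q N\})+O\bigl(N^{\log_q R}(\log N)^{\max\{m(\lambda)\,:\,|\lambda|=R\}}\bigr)$$ for suitable $1$-periodic continuous functions $\Phi_{\lambda k}$. If there are no eigenvalues $\lambda\in\sigma(C)$ with $|\lambda|\le R$, the $O$-term can be omitted. (2) For $\lambda\in\sigma(C)$ with $|\lambda|>R$ and $0\le k<m(\lambda)$, the function $\Phi_{\lambda k}$ is Hölder continuous with any exponent smaller than $\log_q(|\lambda|/R)$. (3) The Dirichlet series $\mathcal{V}(s)=\sum_{n\ge 1}n^{-s}v(n)$ converges absolutely and uniformly on compact subsets of the half plane $\Re s>\log_q R+1$ and can be continued to a meromorphic function on the half plane $\Re s>\log_q R$. It satisfies the functional equation $$(I-q^{-s}C)\mathcal{V}(s)=\sum_{n=1}^{q-1}n^{-s}v(n)+q^{-s}\sum_{r=0}^{q-1}A_r\sum_{k\ge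 1}\binom{-s}{k}\Bigl(\frac{r}{q}\Bigr)^k\mathcal{V}(s+k)$$ for $\Re s>\log_q R$. The right side converges absolutely and uniformly on compact subsets of $\Re s>\log_q R$. In particular, $\mathcal{V}(s)$ can only have poles where $q^s\in\sigma(C)$. (4) For $\lambda\in\sigma(C)$ with $|\lambda|>R$ and $0\le k<m(\lambda)$, the Fourier series $$\Phi_{\lambda k}(u)=\sum_{\ell\in\mathbb{Z}}\varphi_{\lambda k\ell}\exp(2\ell\pi i u)$$ converges pointwise for $u\in\mathbb{R}$, where $$\varphi_{\lambda k\ell}=\frac{(\log q)^k}{k!}\operatorname{Res}\Bigl(\frac{\bigl(x(0)+\mathcal{X}(s)\bigr)\bigl(s-\log_q\lambda-\frac{2\ell\pi i}{\log q}\bigr)^k}{s},\ s=\log_q\lambda+\frac{2\ell\pi i}{\log q}\Bigr)$$ for $\ell\in\mathbb{Z}$, with $\mathcal{X}(s)=\sum_{n\ge 1}n^{-s}x(n)$ (the first component of $\mathcal{V}(s)$, meromorphically continued).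
   Context: $\|\cdot\|$ is any vector norm on $\mathbb{C}^d$ together with its induced matrix norm. $\sigma(C)$ is the set of eigenvalues of $C$. For $\lambda\in\mathbb{C}$, $m(\lambda)$ denotes the size of the largest Jordan block of $C$ associated with $\lambda$; in particular $m(\lambda)=0$ if $\lambda\notin\sigma(C)$. The maximum in the error term is over all $\lambda\in\mathbb{C}$ with $|\lambda|=R$. $\log$ is the principal value of the complex logarithm and $\log_q z=\log z/\log q$. $\{z\}=z-\lfloor z\rfloor$ is the fractional part of a real number $z$. $\operatorname{Res}(f(s),s=s_0)$ is the residue of $f$ at $s_0$. (A sequence $x(n)$ arising in this way is called $q$-regular.) *)

theory Defs
  imports
    "HOL-Complex_Analysis.Complex_Analysis"
    "HOL-Library.Landau_Symbols"
    "Jordan_Normal_Form.Spectral_Radius"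
begin

(* HOL-Analysis and Jordan_Normal_Form both use $ for vector components; here it is the latter's. *)
unbundle no vec_syntax

definition is_vector_norm :: "nat \<Rightarrow> (complex Matrix.vec \<Rightarrow> real) \<Rightarrow> bool" where
  "is_vector_norm d nrm \<longleftrightarrow>
     (\<forall>x\<in>carrier_vec d. nrm x \<ge> 0 \<and> (nrm x = 0 \<longleftrightarrow> x = 0\<^sub>v d)) \<and>
     (\<forall>c. \<forall>x\<in>carrier_vec d. nrm (c \<cdot>\<^sub>v x) = cmod c * nrm x) \<and>
     (\<forall>x\<in>carrier_vec d. \<forall>y\<in>carrier_vec d. nrm (x + y) \<le> nrm x + nrm y)"

(* The supremum is over a nonempty set only for d > 0. *)
definition induced_norm :: "nat \<Rightarrow> (complex Matrix.vec \<Rightarrow> real) \<Rightarrow> complex Matrix.mat \<Rightarrow> real" where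
  "induced_norm d nrm M = (SUP x \<in> {x \<in> carrier_vec d. nrm x = 1}. nrm (M *\<^sub>v x))"

definition mat_product :: "nat \<Rightarrow> (nat \<Rightarrow> complex Matrix.mat) \<Rightarrow> nat list \<Rightarrow> complex Matrix.mat" where
  "mat_product d A rs = foldr (\<lambda>r M. A r * M) rs (1\<^sub>m d)"

definition mat_sum :: "nat \<Rightarrow> (nat \<Rightarrow> complex Matrix.mat) \<Rightarrow> nat \<Rightarrow> complex Matrix.mat" where
  "mat_sum d A q = Matrix.mat d d (\<lambda>(i, j). \<Sum>r<q. A r $$ (i, j))"

(* Jordan normal forms are unique up to the order of the blocks, so the set ranges over the sizes
   of the blocks for l in any one of them; it is {0} if l is not an eigenvalue. *)
definition max_jordan_block :: "complex Matrix.mat \<Rightarrow> complex \<Rightarrow> nat" where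
  "max_jordan_block C l = Max (insert 0 {n. \<exists>n_as. jordan_nf C n_as \<and> (n, l) \<in> set n_as})"

definition clog :: "nat \<Rightarrow> complex \<Rightarrow> complex" where
  "clog q z = Ln z / of_real (ln (real q))"

definition hoelder_continuous :: "real \<Rightarrow> (real \<Rightarrow> complex) \<Rightarrow> bool" where
  "hoelder_continuous a f \<longleftrightarrow> (\<exists>K. \<forall>x y. dist (f x) (f y) \<le> K * dist x y powr a)"

definition vec_suminf :: "nat \<Rightarrow> (nat \<Rightarrow> complex Matrix.vec) \<Rightarrow> complex Matrix.vec" where
  "vec_suminf d f = Matrix.vec d (\<lambda>i. \<Sum>n. f n $ i)"

(* Convergence in C^d is componentwise. *)
definition converges_abs_unif_compacts ::
    "nat \<Rightarrow> (nat \<Rightarrow> complex \<Rightarrow> complex Matrix.vec) \<Rightarrow> complex set \<Rightarrow> bool" where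
  "converges_abs_unif_compacts d f H \<longleftrightarrow>
     (\<forall>i<d. (\<forall>s\<in>H. summable (\<lambda>n. cmod (f n s $ i))) \<and>
            (\<forall>K. compact K \<and> K \<subseteq> H \<longrightarrow>
               uniformly_convergent_on K (\<lambda>M s. \<Sum>n<M. f n s $ i)))"

(* The series below start at 1 in the usual notation; their terms are shifted to start at 0. *)
definition dirichlet_term :: "(nat \<Rightarrow> complex Matrix.vec) \<Rightarrow> nat \<Rightarrow> complex \<Rightarrow> complex Matrix.vec" where
  "dirichlet_term v n s = (of_nat (Suc n) powr (- s)) \<cdot>\<^sub>v v (Suc n)"

definition shift_term ::
    "nat \<Rightarrow> (complex \<Rightarrow> complex Matrix.vec) \<Rightarrow> nat \<Rightarrow> nat \<Rightarrow> complex \<Rightarrow> complex Matrix.vec" where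
  "shift_term q V r k s =
     (((- s) gchoose Suc k) * (of_nat r / of_nat q) ^ Suc k) \<cdot>\<^sub>v V (s + of_nat (Suc k))"

definition fourier_coeff ::
    "nat \<Rightarrow> complex \<Rightarrow> (complex \<Rightarrow> complex) \<Rightarrow> complex \<Rightarrow> nat \<Rightarrow> int \<Rightarrow> complex" where
  "fourier_coeff q x0 X l k j =
     (let s0 = clog q l + 2 * of_int j * of_real pi * \<i> / of_real (ln (real q))
      in of_real (ln (real q)) ^ k / fact k * residue (\<lambda>s. (x0 + X s) * (s - s0) ^ k / s) s0)"

end

theory Submission
  imports Defs
begin

text \<open>
  Put \<rho> = log_q R, so that R = q^\<rho>, and let V(N) be the sum of the v(n) with n < N.
  Splitting n by its last digit gives V(qN) = C V(N).  Write the first unit row vector as a sum of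
  generalised left eigenvectors w_l of C.  Then X(N) is the sum of the sequences Y_l(N) = w_l V(N),
  the increments of Y_l are O(N^\<rho>), and the scaling operator (T y)(N) = y(qN) - l y(N)
  satisfies T^m(l) Y_l = 0 (\<open>spectral_decomposition\<close>).  Everything else is about such sequences.

  If |l| \<le> R, the relation T y = z together with the size of the increments bounds Y_l by the error
  term; the critical case |l| = R costs one logarithm per application of T
  (\<open>small_bound\<close>, \<open>critical_bound\<close>).  If |l| > R, division by l outweighs the growth R of the increments,
  so Y_l extends to a function f on the half line that satisfies T^m(l) f = 0 as well,
  agrees with Y_l at the integers and stays within O(u^\<rho>) of Y_l at the integer part of u
  (\<open>lift_exists\<close>).  For g(t) = l^(-t) f(q^t) the equation T^m f = 0 turns into the vanishing of the
  m-th difference with step 1, so g is a polynomial in t whose coefficients are 1-periodic functions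
  (\<open>periodic_decomposition\<close>): these are the \<Phi>.  At u = N this is exact, which is why the error term
  disappears if there are no eigenvalues with |l| \<le> R.  The same equation relates the differences of f
  at distance x to those at distance qx, up to a division by l; iterating until the distance is about 1
  gives the Hoelder exponent (\<open>slow_fun_hoelder\<close>).

  For the Dirichlet series, the same splitting of n and the binomial expansion of (qN + r)^(-s) give
  the functional equation (\<open>dirichlet_functional_equation\<close>).  Its right-hand side involves only
  shifts by k \<ge> 1 and hence is holomorphic on Re s > \<rho>; Cramer's rule for I - q^(-s) C gives the
  continuation.

  For the Fourier coefficients, partial summation shows that (x(0) + X(s)) / s is
  the Mellin transform over u \<ge> 1 of the step function X(floor u + 1).  Replacing the step function by
  the sum of the functions f changes it by a function that is holomorphic on Re s > \<rho>, because the two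
  differ by O(u^(\<rho> + \<epsilon>)).  With u = q^t what remains is a sum of Laplace transforms of t^k \<Phi>(t);
  these are derivatives of 1 / (1 - exp (-z)) times the integral of \<Phi>(t) exp (-z t) over one period,
  and their principal parts at 2 \<pi> i j are Fourier coefficients (\<open>fourier_coeff_eq_integral\<close>).
  Since the \<Phi> are Hoelder continuous, their Fourier series converge (\<open>fourier_series_converges\<close>).

  If R < 1, then v(0) = A_0^L v(0) for all L forces v(0) = 0 and so v = 0 (\<open>vanishing\<close>).  Hence
  \<rho> \<ge> 0 may be assumed wherever sizes are compared.
\<close>

unbundle no fps_syntax

section \<open>Scaling equations\<close>

text \<open>
Sequences (arguments in nat) and functions on the half line (arguments in real) are treated by the same
operator.  Under scaling by q, the elements of the kernel of its n-th power behave like a vector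
in a Jordan block of size n with eigenvalue l.
\<close>
definition qdiff :: "nat \<Rightarrow> complex \<Rightarrow> ('a::semiring_1 \<Rightarrow> complex) \<Rightarrow> 'a \<Rightarrow> complex" where
  "qdiff q l f u = f (of_nat q * u) - l * f u"

lemma funpow_qdiff_cong:
  fixes f g :: "real \<Rightarrow> complex"
  assumes "\<And>u. u \<ge> 0 \<Longrightarrow> f u = g u" "u \<ge> 0"
  shows "(qdiff q l ^^ n) f u = (qdiff q l ^^ n) g u"
  using assms(2) by (induction n arbitrary: u) (auto simp: qdiff_def assms(1))

locale q_scale =
  fixes q :: nat and \<rho> :: real
  assumes q2: "q \<ge> 2" and rho: "\<rho> \<ge> 0"
begin

text \<open>
Summatory functions of sequences of size n^\<rho> are of this kind.  Here and below, the weight is a power of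
1 + N instead of N, so that the estimates include the argument 0.
\<close>
definition slow_seq :: "(nat \<Rightarrow> complex) \<Rightarrow> bool" where
  "slow_seq y \<longleftrightarrow> (\<exists>K. \<forall>N. cmod (y (Suc N) - y N) \<le> K * (1 + real N) powr \<rho>)"

definition slow_fun :: "(real \<Rightarrow> complex) \<Rightarrow> bool" where
  "slow_fun f \<longleftrightarrow> (\<exists>K. \<forall>u w. 0 \<le> u \<and> u \<le> w \<and> w \<le> u + 1 \<longrightarrow> cmod (f w - f u) \<le> K * (1 + u) powr \<rho>)"

abbreviation R :: real where "R \<equiv> real q powr \<rho>"

lemma R_ge_1: "R \<ge> 1"
  using q2 rho by (simp add: ge_one_powr_ge_zero)

lemma powr_scale: "u \<ge> 0 \<Longrightarrow> (1 + real q * u) powr \<rho> \<le> R * (1 + u) powr \<rho>"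
proof -
  assume "u \<ge> 0"
  hence "(1 + real q * u) powr \<rho> \<le> (real q * (1 + u)) powr \<rho>"
    using q2 rho by (intro powr_mono2) (auto simp: algebra_simps)
  thus ?thesis using \<open>u \<ge> 0\<close> by (simp add: powr_mult)
qed

lemma powr_scale_iter: "u \<ge> 0 \<Longrightarrow> (1 + real q ^ L * u) powr \<rho> \<le> R ^ L * (1 + u) powr \<rho>"
proof (induction L)
  case (Suc L)
  have "(1 + real q * (real q ^ L * u)) powr \<rho> \<le> R * (1 + real q ^ L * u) powr \<rho>"
    using Suc.prems by (intro powr_scale) auto
  also have "\<dots> \<le> R * (R ^ L * (1 + u) powr \<rho>)"
    using Suc by (intro mult_left_mono) auto
  finally show ?case by (simp add: mult_ac)
qed auto

lemma slow_seqD: "slow_seq y \<Longrightarrow> \<exists>K. \<forall>N. cmod (y (Suc N) - y N) \<le> K * (1 + real N) powr \<rho>"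
  by (simp add: slow_seq_def)

text \<open>
A block between qN and qN + q consists of at most q increments.
\<close>
lemma slow_seq_block:
  assumes "slow_seq y"
  shows "\<exists>K\<ge>0. \<forall>N. \<forall>r\<le>q. cmod (y (q * N + r) - y (q * N)) \<le> K * (1 + real N) powr \<rho>"
proof -
  obtain K0 where K0: "\<And>N. cmod (y (Suc N) - y N) \<le> K0 * (1 + real N) powr \<rho>"
    using slow_seqD[OF assms] by blast
  define K where "K = max K0 0"
  have K: "cmod (y (Suc N) - y N) \<le> K * (1 + real N) powr \<rho>" for N
    by (rule order.trans[OF K0]) (auto simp: K_def intro!: mult_right_mono)
  have *: "cmod (y (a + r) - y a) \<le> real r * K * (1 + real (a + r)) powr \<rho>" for a r
  proof (induction r)
    case (Suc r)
    have "cmod (y (a + Suc r) - y a) \<le> cmod (y (Suc (a + r)) - y (a + r)) + cmod (y (a + r) - y a)"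
      by (rule order.trans[OF _ norm_triangle_ineq]) simp
    also have "\<dots> \<le> K * (1 + real (a + r)) powr \<rho> + real r * K * (1 + real (a + r)) powr \<rho>"
      by (intro add_mono K Suc.IH)
    also have "\<dots> = real (Suc r) * K * (1 + real (a + r)) powr \<rho>"
      by (simp add: algebra_simps)
    also have "\<dots> \<le> real (Suc r) * K * (1 + real (a + Suc r)) powr \<rho>"
      using rho by (intro mult_left_mono powr_mono2) (auto simp: K_def)
    finally show ?case .
  qed auto
  show ?thesis
  proof (intro exI[of _ "real q * K * (2 powr \<rho> * R)"] conjI allI impI)
    fix N r assume r: "r \<le> q"
    have "cmod (y (q * N + r) - y (q * N)) \<le> real r * K * (1 + real (q * N + r)) powr \<rho>"
      by (rule *)
    also have "\<dots> \<le> real q * K * (2 * (real q * (1 + real N))) powr \<rho>"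
    proof (intro mult_mono powr_mono2)
      have aux: "1 + (a + b) \<le> 2 * c + 2 * a" if "1 + b \<le> 2 * c" "0 \<le> a" for a b c :: real
        using that by linarith
      have 1: "1 + real r \<le> 2 * real q" using r q2 by linarith
      have 2: "0 \<le> real N * real q" by simp
      have 3: "real (q * N + r) = real N * real q + real r" by simp
      have 4: "2 * (real q * (1 + real N)) = 2 * real q + 2 * (real N * real q)" by (simp add: algebra_simps)
      show "1 + real (q * N + r) \<le> 2 * (real q * (1 + real N))" 
        unfolding 3 4 using aux[OF 1 2] .
    qed (use r rho in \<open>auto simp: K_def\<close>)
    also have "(2 * (real q * (1 + real N))) powr \<rho> = 2 powr \<rho> * R * (1 + real N) powr \<rho>"
      by (simp add: powr_mult)
    finally show "cmod (y (q * N + r) - y (q * N)) \<le> real q * K * (2 powr \<rho> * R) * (1 + real N) powr \<rho>"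
      by (simp add: mult_ac)
  qed (auto simp: K_def)
qed

lemma slow_seq_qdiff:
  assumes "slow_seq y"
  shows "slow_seq (qdiff q l y)"
proof -
  obtain K0 where K0: "\<And>N. cmod (y (Suc N) - y N) \<le> K0 * (1 + real N) powr \<rho>"
    using slow_seqD[OF assms] by blast
  obtain K where
    K: "K \<ge> 0" "\<And>r N. r \<le> q \<Longrightarrow> cmod (y (q * N + r) - y (q * N)) \<le> K * (1 + real N) powr \<rho>"
    using slow_seq_block[OF assms] by blast
  show ?thesis unfolding slow_seq_def
  proof (intro exI allI)
    fix N
    have "qdiff q l y (Suc N) - qdiff q l y N = (y (q * N + q) - y (q * N)) - l * (y (Suc N) - y N)"
      by (simp add: qdiff_def algebra_simps)
    also have "cmod \<dots> \<le> K * (1 + real N) powr \<rho> + cmod l * (K0 * (1 + real N) powr \<rho>)"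
      using K(2)[of q N] mult_left_mono[OF K0[of N], of "cmod l"]
      by (intro order.trans[OF norm_triangle_ineq4 add_mono]) (auto simp: norm_mult)
    finally show "cmod (qdiff q l y (Suc N) - qdiff q l y N) \<le> (K + cmod l * K0) * (1 + real N) powr \<rho>"
      by (simp add: algebra_simps)
  qed
qed

lemma slow_fun_interval:
  assumes "slow_fun f"
  shows "\<exists>K\<ge>0. \<forall>u w r. 0 \<le> u \<longrightarrow> u \<le> w \<longrightarrow> w \<le> u + real r \<longrightarrow>
    cmod (f w - f u) \<le> real r * K * (1 + u + real r) powr \<rho>"
proof -
  from assms obtain K0 where K0: "\<And>u w. 0 \<le> u \<Longrightarrow> u \<le> w \<Longrightarrow> w \<le> u + 1 \<Longrightarrow> cmod (f w - f u) \<le> K0 * (1 + u) powr \<rho>"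
    unfolding slow_fun_def by blast
  define K where "K = max K0 0"
  have K: "cmod (f w - f u) \<le> K * (1 + u) powr \<rho>" if "0 \<le> u" "u \<le> w" "w \<le> u + 1" for u w
    by (rule order.trans[OF K0[OF that]]) (auto simp: K_def intro!: mult_right_mono)
  have *: "cmod (f w - f u) \<le> real r * K * (1 + u + real r) powr \<rho>"
    if "0 \<le> u" "u \<le> w" "w \<le> u + real r" for u w r
    using that
  proof (induction r arbitrary: u w)
    case (Suc r)
    show ?case
    proof (cases "w \<le> u + 1")
      case True
      have "cmod (f w - f u) \<le> 1 * K * (1 + u) powr \<rho>"
        using K[of u w] Suc.prems True by simp
      also have "\<dots> \<le> real (Suc r) * K * (1 + u + real (Suc r)) powr \<rho>"
        using Suc.prems rho by (intro mult_mono powr_mono2) (auto simp: K_def)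
      finally show ?thesis .
    next
      case False
      have "cmod (f w - f u) \<le> cmod (f w - f (u + 1)) + cmod (f (u + 1) - f u)"
        by (rule order.trans[OF _ norm_triangle_ineq]) simp
      also have "\<dots> \<le> real r * K * (1 + (u + 1) + real r) powr \<rho> + K * (1 + u) powr \<rho>"
        using Suc.prems False by (intro add_mono K Suc.IH) auto
      also have "K * (1 + u) powr \<rho> \<le> K * (1 + u + real (Suc r)) powr \<rho>"
        using Suc.prems rho by (intro mult_left_mono powr_mono2) (auto simp: K_def)
      finally show ?thesis by (simp add: algebra_simps)
    qed
  qed auto
  have "K \<ge> 0" by (simp add: K_def)
  with * show ?thesis by blast
qed

lemma slow_fun_qdiff:
  assumes "slow_fun f"
  shows "slow_fun (qdiff q l f)"
proof -
  obtain K where K: "K \<ge> 0" "\<And>u w r. 0 \<le> u \<Longrightarrow> u \<le> w \<Longrightarrow> w \<le> u + real r \<Longrightarrow>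
    cmod (f w - f u) \<le> real r * K * (1 + u + real r) powr \<rho>"
    using slow_fun_interval[OF assms] by blast
  show ?thesis unfolding slow_fun_def
  proof (intro exI allI impI; elim conjE)
    fix u w :: real assume uw: "0 \<le> u" "u \<le> w" "w \<le> u + 1"
    have q0: "real q > 0" using q2 by simp
    have "cmod (f (q * w) - f (q * u)) \<le> real q * K * (1 + q * u + real q) powr \<rho>"
    proof (rule K(2))
      show "q * u \<le> q * w" "0 \<le> q * u" using uw by (auto intro: mult_left_mono)
      show "q * w \<le> q * u + real q" using mult_left_mono[OF uw(3), of "real q"] by (simp add: algebra_simps)
    qed
    also have "\<dots> \<le> real q * K * (2 * (real q * (1 + u))) powr \<rho>"
    proof (intro mult_left_mono powr_mono2)
      have "1 \<le> real q" "0 \<le> real q * u" using q2 uw by auto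
      thus "1 + real q * u + real q \<le> 2 * (real q * (1 + u))" by (simp add: algebra_simps)
    qed (use uw K rho in auto)
    also have "\<dots> = real q * K * 2 powr \<rho> * R * (1 + u) powr \<rho>"
      using uw by (simp add: powr_mult)
    finally have 1: "cmod (f (q * w) - f (q * u)) \<le> real q * K * 2 powr \<rho> * R * (1 + u) powr \<rho>" .
    have "cmod (f w - f u) \<le> K * (2 + u) powr \<rho>" using K(2)[of u w 1] uw by (simp add: add_ac)
    also have "\<dots> \<le> K * (2 * (1 + u)) powr \<rho>"
      using uw K rho by (intro mult_left_mono powr_mono2) auto
    also have "\<dots> = K * 2 powr \<rho> * (1 + u) powr \<rho>" using uw by (subst powr_mult) auto
    finally have 2: "cmod (f w - f u) \<le> K * 2 powr \<rho> * (1 + u) powr \<rho>" .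
    have "qdiff q l f w - qdiff q l f u = (f (q * w) - f (q * u)) - l * (f w - f u)"
      by (simp add: qdiff_def algebra_simps)
    also have "cmod \<dots> \<le> real q * K * 2 powr \<rho> * R * (1 + u) powr \<rho> + cmod l * (K * 2 powr \<rho> * (1 + u) powr \<rho>)"
      by (intro order.trans[OF norm_triangle_ineq4] add_mono 1)
         (auto simp: norm_mult intro!: mult_left_mono 2)
    finally show "cmod (qdiff q l f w - qdiff q l f u) \<le>
        (real q * K * 2 powr \<rho> * R + cmod l * K * 2 powr \<rho>) * (1 + u) powr \<rho>"
      by (simp add: algebra_simps)
  qed
qed

text \<open>
Induction on n: let h be the extension of T y.  An extension f = y(floor u) + \<delta>(u) with T f = h has to satisfy
\<delta>(qu) = l \<delta>(u) - \<eta>(u), where \<eta> measures by how much the step function of y fails to solve the equation.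
As \<eta>(u) is O((1 + u)^\<rho>) and |l| > q^\<rho>, the series obtained by solving this for \<delta>(u) and iterating
converges.  At integers \<eta> vanishes, hence so does \<delta>.
\<close>
lemma lift_exists:
  assumes l: "cmod l > R" and "slow_seq y" "\<And>N. (qdiff q l ^^ n) y N = 0"
  shows "\<exists>f. (\<forall>N. f (real N) = y N) \<and>
     (\<exists>K. \<forall>u\<ge>0. cmod (f u - y (nat \<lfloor>u\<rfloor>)) \<le> K * (1 + u) powr \<rho>) \<and>
     (\<forall>u\<ge>0. (qdiff q l ^^ n) f u = 0)"
  using assms(2,3)
proof (induction n arbitrary: y)
  case 0
  thus ?case by (intro exI[of _ "\<lambda>_. 0"]) (auto intro!: exI[of _ 0])
next
  case (Suc n)
  have "(qdiff q l ^^ n) (qdiff q l y) N = 0" for N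
    using Suc.prems(2)[of N] by (simp add: funpow_swap1)
  from Suc.IH[OF slow_seq_qdiff[OF Suc.prems(1)] this]
  obtain h K2 where h: "\<And>N. h (real N) = qdiff q l y N"
    and K2: "\<And>u. u \<ge> 0 \<Longrightarrow> cmod (h u - qdiff q l y (nat \<lfloor>u\<rfloor>)) \<le> K2 * (1 + u) powr \<rho>"
    and hn: "\<And>u. u \<ge> 0 \<Longrightarrow> (qdiff q l ^^ n) h u = 0" by blast
  obtain K1 where K1: "K1 \<ge> 0"
    "\<And>N r. r \<le> q \<Longrightarrow> cmod (y (q * N + r) - y (q * N)) \<le> K1 * (1 + real N) powr \<rho>"
    using slow_seq_block[OF Suc.prems(1)] by blast
  define \<eta> where "\<eta> u = y (nat \<lfloor>q * u\<rfloor>) - l * y (nat \<lfloor>u\<rfloor>) - h u" for u :: real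
  define \<delta> where "\<delta> u = (\<Sum>L. \<eta> (real q ^ L * u) / l ^ Suc L)" for u
  define f where "f u = y (nat \<lfloor>u\<rfloor>) + \<delta> u" for u
  have l0: "l \<noteq> 0" using l R_ge_1 by auto
  have eta: "cmod (\<eta> u) \<le> (K1 + K2) * (1 + u) powr \<rho>" if u: "u \<ge> 0" for u
  proof -
    define N where "N = nat \<lfloor>u\<rfloor>"
    define r where "r = nat \<lfloor>q * u\<rfloor> - q * N"
    have N: "real N \<le> u" "u < real N + 1" using u by (auto simp: N_def)
    have "real q * real N \<le> q * u" "real q * u < q * (real N + 1)" using N q2 by auto
    hence "real (q * N) \<le> q * u" "real q * u < real (q * N + q)" by (auto simp: algebra_simps)
    hence "q * N \<le> nat \<lfloor>q * u\<rfloor>" "nat \<lfloor>q * u\<rfloor> < q * N + q" by linarith+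
    hence r: "nat \<lfloor>q * u\<rfloor> = q * N + r" "r \<le> q" by (auto simp: r_def)
    have "\<eta> u = (y (q * N + r) - y (q * N)) - (h u - qdiff q l y N)"
      by (simp add: \<eta>_def r qdiff_def N_def)
    also have "cmod \<dots> \<le> K1 * (1 + real N) powr \<rho> + K2 * (1 + u) powr \<rho>"
      using K2[OF u] unfolding N_def[symmetric]
      by (intro order.trans[OF norm_triangle_ineq4 add_mono] K1 r)
    also have "K1 * (1 + real N) powr \<rho> \<le> K1 * (1 + u) powr \<rho>"
      using N rho K1 by (intro mult_left_mono powr_mono2) auto
    finally show ?thesis by (simp add: algebra_simps)
  qed
  define \<theta> where "\<theta> = R / cmod l"
  have \<theta>: "\<theta> < 1" "\<theta> \<ge> 0" using l R_ge_1 by (auto simp: \<theta>_def divide_simps)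
  have term_bound: "cmod (\<eta> (real q ^ L * u) / l ^ Suc L) \<le> (K1 + K2) * (1 + u) powr \<rho> / cmod l * \<theta> ^ L"
    if u: "u \<ge> 0" for u L
  proof -
    have "0 \<le> cmod (\<eta> 0)" by simp
    also have "\<dots> \<le> K1 + K2" using eta[of 0] by simp
    finally have K: "K1 + K2 \<ge> 0" .
    have "cmod (\<eta> (real q ^ L * u)) \<le> (K1 + K2) * (1 + real q ^ L * u) powr \<rho>"
      using u by (intro eta) auto
    also have "\<dots> \<le> (K1 + K2) * (R ^ L * (1 + u) powr \<rho>)"
      using K u by (intro mult_left_mono powr_scale_iter) auto
    finally have "cmod (\<eta> (real q ^ L * u)) / cmod l ^ Suc L \<le> (K1 + K2) * (R ^ L * (1 + u) powr \<rho>) / cmod l ^ Suc L"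
      by (intro divide_right_mono) auto
    thus ?thesis by (simp add: \<theta>_def norm_divide norm_power norm_mult power_divide mult_ac)
  qed
  have geo: "summable (\<lambda>L. (K1 + K2) * (1 + u) powr \<rho> / cmod l * \<theta> ^ L)" for u
    using \<theta> by (intro summable_mult summable_geometric) auto
  have summ: "summable (\<lambda>L. \<eta> (real q ^ L * u) / l ^ Suc L)" if "u \<ge> 0" for u
    using term_bound[OF that] by (intro summable_comparison_test'[OF geo[of u], of 0]) auto
  have delta_bound: "cmod (\<delta> u) \<le> (K1 + K2) / cmod l / (1 - \<theta>) * (1 + u) powr \<rho>" if "u \<ge> 0" for u
  proof -
    have "cmod (\<delta> u) \<le> (\<Sum>L. (K1 + K2) * (1 + u) powr \<rho> / cmod l * \<theta> ^ L)"
      unfolding \<delta>_def by (rule norm_suminf_le[OF term_bound[OF that] geo])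
    also have "\<dots> = (K1 + K2) * (1 + u) powr \<rho> / cmod l * (1 / (1 - \<theta>))"
      using \<theta> by (subst suminf_mult) (auto simp: suminf_geometric intro!: summable_geometric)
    finally show ?thesis by (simp add: mult_ac)
  qed
  have delta_rec: "\<delta> (q * u) - l * \<delta> u = - \<eta> u" if "u \<ge> 0" for u :: real
  proof -
    have shift: "(\<lambda>L. \<eta> (real q ^ Suc L * u) / l ^ Suc (Suc L)) = (\<lambda>L. \<eta> (real q ^ L * (q * u)) / l ^ Suc L / l)"
    proof
      fix L
      have "real q ^ Suc L * u = real q ^ L * (q * u)" by simp
      thus "\<eta> (real q ^ Suc L * u) / l ^ Suc (Suc L) = \<eta> (real q ^ L * (q * u)) / l ^ Suc L / l"
        by (simp only: power_Suc2[of l "Suc L"] divide_divide_eq_left)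
    qed
    have "\<delta> u = \<eta> u / l + (\<Sum>L. \<eta> (real q ^ L * (q * u)) / l ^ Suc L / l)"
      using suminf_split_head[OF summ[OF that], unfolded shift] by (simp add: \<delta>_def)
    also have "(\<Sum>L. \<eta> (real q ^ L * (q * u)) / l ^ Suc L / l) = \<delta> (q * u) / l"
      unfolding \<delta>_def using that by (intro suminf_divide summ) auto
    finally show ?thesis using l0 by (simp add: field_simps)
  qed
  have delta_nat: "\<delta> (real N) = 0" for N
  proof -
    have "\<eta> (real M) = 0" for M
    proof -
      have "nat \<lfloor>real q * real M\<rfloor> = q * M" 
        by (simp only: of_nat_mult[symmetric] floor_of_nat nat_int)
      thus ?thesis by (simp add: \<eta>_def h qdiff_def)
    qed
    from this[of "q ^ L * N" for L] show ?thesis by (simp add: \<delta>_def)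
  qed
  have qf: "qdiff q l f u = h u" if "u \<ge> 0" for u
    using delta_rec[OF that] by (simp add: qdiff_def f_def \<eta>_def algebra_simps)
  show ?case
  proof (intro exI[of _ f] conjI allI impI)
    show "f (real N) = y N" for N by (simp add: f_def delta_nat)
    show "\<exists>K. \<forall>u\<ge>0. cmod (f u - y (nat \<lfloor>u\<rfloor>)) \<le> K * (1 + u) powr \<rho>"
      using delta_bound by (auto simp: f_def intro!: exI[of _ "(K1 + K2) / cmod l / (1 - \<theta>)"])
    show "(qdiff q l ^^ Suc n) f u = 0" if "u \<ge> 0" for u
      using funpow_qdiff_cong[of "qdiff q l f" h u n q l] hn[OF that] qf that
      by (simp add: funpow_Suc_right del: funpow.simps)
  qed
qed

lemma slow_fun_lift:
  assumes "slow_seq y" "\<And>u. u \<ge> 0 \<Longrightarrow> cmod (f u - y (nat \<lfloor>u\<rfloor>)) \<le> K * (1 + u) powr \<rho>"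
  shows "slow_fun f"
proof -
  obtain K0 where K0: "\<And>N. cmod (y (Suc N) - y N) \<le> K0 * (1 + real N) powr \<rho>"
    using slow_seqD[OF assms(1)] by blast
  have K0': "K0 \<ge> 0" using order.trans[OF norm_ge_zero K0[of 0]] by simp
  have K': "K \<ge> 0" using order.trans[OF norm_ge_zero assms(2)[of 0]] by simp
  show ?thesis unfolding slow_fun_def
  proof (intro exI allI impI; elim conjE)
    fix u w :: real assume uw: "0 \<le> u" "u \<le> w" "w \<le> u + 1"
    define N where "N = nat \<lfloor>u\<rfloor>"
    have N: "real N \<le> u" using uw by (auto simp: N_def)
    have "nat \<lfloor>w\<rfloor> = N \<or> nat \<lfloor>w\<rfloor> = Suc N" unfolding N_def using uw by linarith
    hence "cmod (y (nat \<lfloor>w\<rfloor>) - y N) \<le> K0 * (1 + real N) powr \<rho>" using K0[of N] K0' by auto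
    also have "\<dots> \<le> K0 * (1 + u) powr \<rho>" using N K0' rho by (intro mult_left_mono powr_mono2) auto
    finally have 1: "cmod (y (nat \<lfloor>w\<rfloor>) - y N) \<le> K0 * (1 + u) powr \<rho>" .
    have "cmod (f w - y (nat \<lfloor>w\<rfloor>)) \<le> K * (1 + w) powr \<rho>" using uw by (intro assms) auto
    also have "\<dots> \<le> K * (2 * (1 + u)) powr \<rho>" using uw K' rho by (intro mult_left_mono powr_mono2) auto
    also have "\<dots> = K * 2 powr \<rho> * (1 + u) powr \<rho>" using uw by (subst powr_mult) auto
    finally have 2: "cmod (f w - y (nat \<lfloor>w\<rfloor>)) \<le> K * 2 powr \<rho> * (1 + u) powr \<rho>" .
    have 3: "cmod (f u - y N) \<le> K * (1 + u) powr \<rho>" using assms(2)[OF uw(1)] by (simp add: N_def)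
    have "f w - f u = (f w - y (nat \<lfloor>w\<rfloor>)) + (y (nat \<lfloor>w\<rfloor>) - y N) - (f u - y N)" by simp
    also have "cmod \<dots> \<le> cmod (f w - y (nat \<lfloor>w\<rfloor>)) + cmod (y (nat \<lfloor>w\<rfloor>) - y N) + cmod (f u - y N)"
      by (intro order.trans[OF norm_triangle_ineq4] add_mono norm_triangle_ineq order.refl)
    also have "\<dots> \<le> K * 2 powr \<rho> * (1 + u) powr \<rho> + K0 * (1 + u) powr \<rho> + K * (1 + u) powr \<rho>"
      by (intro add_mono 1 2 3)
    finally show "cmod (f w - f u) \<le> (K * 2 powr \<rho> + K0 + K) * (1 + u) powr \<rho>"
      by (simp add: algebra_simps)
  qed
qed

text \<open>
Dividing T f(w) - T f(u) = (f(qw) - f(qu)) - l (f(w) - f(u)) by l expresses the difference at distance w - u by the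
one at distance q(w - u).  If a bound K (1 + u)^\<rho> x^a holds at distance x = q(w - u), the bound obtained
at distance w - u has the factor q^a R / |l| < 1, so one constant K works at all scales.
\<close>
lemma slow_fun_hoelder:
  assumes a: "a > 0" "real q powr a * R < cmod l"
    and "slow_fun f" "\<And>u. u \<ge> 0 \<Longrightarrow> (qdiff q l ^^ n) f u = 0"
  shows "\<exists>K\<ge>0. \<forall>u w. 0 \<le> u \<and> u \<le> w \<and> w \<le> u + 1 \<longrightarrow>
           cmod (f w - f u) \<le> K * (1 + u) powr \<rho> * (w - u) powr a"
  using assms(3,4)
proof (induction n arbitrary: f)
  case 0
  thus ?case by (intro exI[of _ 0]) auto
next
  case (Suc n)
  have "(qdiff q l ^^ n) (qdiff q l f) u = 0" if "u \<ge> 0" for u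
    using Suc.prems(2)[OF that] by (simp add: funpow_swap1)
  from Suc.IH[OF slow_fun_qdiff[OF Suc.prems(1)] this]
  obtain K1 where K1: "K1 \<ge> 0" "\<And>u w. 0 \<le> u \<Longrightarrow> u \<le> w \<Longrightarrow> w \<le> u + 1 \<Longrightarrow>
      cmod (qdiff q l f w - qdiff q l f u) \<le> K1 * (1 + u) powr \<rho> * (w - u) powr a"
    by blast
  from Suc.prems(1) obtain K0 where K0: "\<And>u w. 0 \<le> u \<Longrightarrow> u \<le> w \<Longrightarrow> w \<le> u + 1 \<Longrightarrow>
      cmod (f w - f u) \<le> K0 * (1 + u) powr \<rho>"
    unfolding slow_fun_def by blast
  have K0': "K0 \<ge> 0" using order.trans[OF norm_ge_zero K0[of 0 0]] by simp
  define D where "D = cmod l - R * real q powr a"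
  have D: "D > 0" using a by (simp add: D_def mult_ac)
  have l0: "cmod l > 0" using a(2) by (meson less_le_trans not_less norm_ge_zero mult_nonneg_nonneg powr_ge_zero order.strict_trans1)
  \<comment> \<open>The first entry covers distances of at least 1/q, the second one makes the step from distance q x to x work.\<close>
  define K where "K = max (K0 * real q powr a) (K1 / D)"
  have K: "K \<ge> 0" "K0 * real q powr a \<le> K" "K1 \<le> K * D"
  proof -
    have "0 \<le> K0 * real q powr a" using K0' by simp
    thus "K \<ge> 0" by (simp add: K_def)
    show "K0 * real q powr a \<le> K" by (simp add: K_def)
    have "K1 = K1 / D * D" using D by simp
    also have "\<dots> \<le> K * D" using D by (intro mult_right_mono) (auto simp: K_def)
    finally show "K1 \<le> K * D" .
  qed
  have q0: "real q > 0" using q2 by simp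
  \<comment> \<open>At distances between 1/q and 1 the trivial bound suffices, as x^a is bounded below.\<close>
  have base: "cmod (f w - f u) \<le> K * (1 + u) powr \<rho> * (w - u) powr a"
    if uw: "0 \<le> u" "u \<le> w" "w \<le> u + 1" "w - u \<ge> 1 / real q" for u w
  proof -
    have "1 \<le> real q * (w - u)" using uw q0 by (simp add: field_simps)
    hence "1 \<le> (real q * (w - u)) powr a" using a by (intro ge_one_powr_ge_zero) auto
    hence *: "1 \<le> real q powr a * (w - u) powr a" using uw by (simp add: powr_mult)
    have "cmod (f w - f u) \<le> K0 * (1 + u) powr \<rho> * 1" using K0 uw by simp
    also have "\<dots> \<le> K0 * (1 + u) powr \<rho> * (real q powr a * (w - u) powr a)"
      using K0' by (intro mult_left_mono *) auto
    also have "\<dots> = K0 * real q powr a * ((1 + u) powr \<rho> * (w - u) powr a)" by simp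
    also have "\<dots> \<le> K * ((1 + u) powr \<rho> * (w - u) powr a)" by (intro mult_right_mono K) auto
    finally show ?thesis by (simp add: mult_ac)
  qed
  have main: "cmod (f w - f u) \<le> K * (1 + u) powr \<rho> * (w - u) powr a"
    if "0 \<le> u" "u \<le> w" "w \<le> u + 1" "w - u \<ge> 1 / real q ^ Suc L" for u w L
    using that
  proof (induction L arbitrary: u w)
    case (Suc L)
    show ?case
    proof (cases "w - u \<ge> 1 / real q")
      case True
      show ?thesis using base[OF Suc.prems(1-3) True] .
    next
      case False
      have "cmod (f (q * w) - f (q * u)) \<le> K * (1 + q * u) powr \<rho> * (q * w - q * u) powr a"
      proof (rule Suc.IH)
        show "0 \<le> q * u" "q * u \<le> q * w" using Suc.prems by (auto intro: mult_left_mono)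
        have "real q * (w - u) \<le> 1" using False q0 by (simp add: field_simps)
        thus "q * w \<le> q * u + 1" by (simp add: algebra_simps)
        have "real q * (1 / real q ^ Suc (Suc L)) \<le> real q * (w - u)" using Suc.prems by (intro mult_left_mono) auto
        thus "1 / real q ^ Suc L \<le> q * w - q * u" using q0 by (simp add: algebra_simps)
      qed
      also have "q * w - q * u = real q * (w - u)" by (simp add: algebra_simps)
      also have "(real q * (w - u)) powr a = real q powr a * (w - u) powr a"
        using Suc.prems by (simp add: powr_mult)
      also have "K * (1 + q * u) powr \<rho> * (real q powr a * (w - u) powr a) \<le>
                 K * (R * (1 + u) powr \<rho>) * (real q powr a * (w - u) powr a)"
        using Suc.prems K by (intro mult_left_mono mult_right_mono powr_scale) auto
      finally have 1: "cmod (f (q * w) - f (q * u)) \<le>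
          K * (R * (1 + u) powr \<rho>) * (real q powr a * (w - u) powr a)" .
      have "l * (f w - f u) = (f (q * w) - f (q * u)) - (qdiff q l f w - qdiff q l f u)"
        by (simp add: qdiff_def algebra_simps)
      also have "cmod \<dots> \<le> K * (R * (1 + u) powr \<rho>) * (real q powr a * (w - u) powr a) +
            K1 * (1 + u) powr \<rho> * (w - u) powr a"
        using Suc.prems by (intro order.trans[OF norm_triangle_ineq4] add_mono 1 K1) auto
      also have "\<dots> = (K * (R * real q powr a) + K1) * ((1 + u) powr \<rho> * (w - u) powr a)"
        by (simp add: algebra_simps)
      also have "\<dots> \<le> (cmod l * K) * ((1 + u) powr \<rho> * (w - u) powr a)"
        using K(3) by (intro mult_right_mono) (auto simp: D_def algebra_simps)
      finally have "cmod l * cmod (f w - f u) \<le> cmod l * (K * (1 + u) powr \<rho> * (w - u) powr a)"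
        by (simp add: norm_mult mult_ac)
      thus ?thesis using l0 by simp
    qed
  next
    case 0
    thus ?case by (intro base) auto
  qed
  show ?case
  proof (intro exI[of _ K] conjI allI impI K(1); elim conjE)
    fix u w :: real assume uw: "0 \<le> u" "u \<le> w" "w \<le> u + 1"
    show "cmod (f w - f u) \<le> K * (1 + u) powr \<rho> * (w - u) powr a"
    proof (cases "w = u")
      case False
      have "\<exists>L. (1 / real q) ^ L < w - u"
        using False uw q2 by (intro real_arch_pow_inv) auto
      then obtain L where L: "(1 / real q) ^ L < w - u" by blast
      have "1 / real q ^ Suc L \<le> 1 / real q ^ L"
        using q2 by (intro divide_left_mono power_increasing) auto
      hence "1 / real q ^ Suc L \<le> w - u" using L by (simp add: power_divide)
      thus ?thesis using main uw by blast
    qed auto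
  qed
qed

lemma slow_fun_growth:
  assumes "slow_fun f"
  shows "\<exists>K. \<forall>u\<ge>0. cmod (f u) \<le> K * (1 + u) powr (\<rho> + 1)"
proof -
  obtain K where K: "K \<ge> 0" "\<And>u w r. 0 \<le> u \<Longrightarrow> u \<le> w \<Longrightarrow> w \<le> u + real r \<Longrightarrow>
    cmod (f w - f u) \<le> real r * K * (1 + u + real r) powr \<rho>"
    using slow_fun_interval[OF assms] by blast
  show ?thesis
  proof (intro exI allI impI)
    fix u :: real assume u: "u \<ge> 0"
    define r where "r = nat \<lceil>u\<rceil>"
    have r: "u \<le> real r" "real r \<le> u + 1" using u unfolding r_def by linarith+
    have "cmod (f u - f 0) \<le> real r * K * (1 + 0 + real r) powr \<rho>" using u r by (intro K) auto
    also have "\<dots> \<le> (1 + u) * K * (2 * (1 + u)) powr \<rho>"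
      using r u K rho by (intro mult_mono powr_mono2) auto
    also have "\<dots> = K * 2 powr \<rho> * (1 + u) powr (\<rho> + 1)"
      using u by (subst powr_mult) (auto simp: powr_add)
    finally have 1: "cmod (f u - f 0) \<le> K * 2 powr \<rho> * (1 + u) powr (\<rho> + 1)" .
    have "cmod (f 0) * 1 \<le> cmod (f 0) * (1 + u) powr (\<rho> + 1)"
      using u rho by (intro mult_left_mono ge_one_powr_ge_zero) auto
    moreover have "cmod (f u) \<le> cmod (f u - f 0) + cmod (f 0)"
      by (metis diff_add_cancel norm_triangle_ineq)
    ultimately show "cmod (f u) \<le> (K * 2 powr \<rho> + cmod (f 0)) * (1 + u) powr (\<rho> + 1)"
      using 1 by (simp add: algebra_simps)
  qed
qed

text \<open>
A function in the kernel of T grows like u^(log_q |l|) along q^L u, faster than a sum of slow increments can.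
This excludes the case in which the asserted Hoelder exponents would exceed 1.
\<close>
lemma slow_fun_eq_0:
  assumes l: "cmod l > real q * R"
    and "slow_fun f" "\<And>u. u \<ge> 0 \<Longrightarrow> (qdiff q l ^^ n) f u = 0" "u \<ge> 0"
  shows "f u = 0"
  using assms(2-4)
proof (induction n arbitrary: f u)
  case (Suc n)
  have "(qdiff q l ^^ n) (qdiff q l f) u = 0" if "u \<ge> 0" for u
    using Suc.prems(2)[OF that] by (simp add: funpow_swap1)
  from Suc.IH[OF slow_fun_qdiff[OF Suc.prems(1)] this]
  have 0: "f (q * u) = l * f u" if "u \<ge> 0" for u :: real using that by (simp add: qdiff_def)
  have it: "f (real q ^ L * u) = l ^ L * f u" for L
  proof (induction L)
    case (Suc L)
    thus ?case using 0[of "real q ^ L * u"] \<open>u \<ge> 0\<close> by (simp add: mult_ac)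
  qed auto
  from slow_fun_growth[OF Suc.prems(1)] obtain K where
    K: "\<And>u. u \<ge> 0 \<Longrightarrow> cmod (f u) \<le> K * (1 + u) powr (\<rho> + 1)" by blast
  have K': "K \<ge> 0" using order.trans[OF norm_ge_zero K[of 0]] by simp
  define \<theta> where "\<theta> = real q * R / cmod l"
  have qR: "real q * R > 0" using q2 by simp
  have l0: "cmod l > 0" using l qR by linarith
  have \<theta>: "\<theta> \<ge> 0" "\<theta> < 1" using l l0 by (auto simp: \<theta>_def)
  have bound: "cmod (f u) \<le> K * (1 + u) powr (\<rho> + 1) * \<theta> ^ L" for L
  proof -
    have "cmod l ^ L * cmod (f u) \<le> K * (1 + real q ^ L * u) powr (\<rho> + 1)"
      using K[of "real q ^ L * u"] it[of L] \<open>u \<ge> 0\<close> by (simp add: norm_mult norm_power)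
    also have "(1 + real q ^ L * u) powr (\<rho> + 1) \<le> (real q ^ L * (1 + u)) powr (\<rho> + 1)"
      using q2 \<open>u \<ge> 0\<close> rho by (intro powr_mono2) (auto simp: algebra_simps)
    also have "\<dots> = (real q ^ L) powr (\<rho> + 1) * (1 + u) powr (\<rho> + 1)"
      using \<open>u \<ge> 0\<close> by (simp add: powr_mult)
    also have "(real q ^ L) powr (\<rho> + 1) = (real q * R) ^ L"
      using q2 by (simp add: powr_powr powr_add power_mult_distrib flip: powr_realpow) (simp add: mult_ac)
    finally have "cmod l ^ L * cmod (f u) \<le> K * ((real q * R) ^ L * (1 + u) powr (\<rho> + 1))"
      using K' by (simp add: mult_left_mono)
    thus ?thesis using l0 by (simp add: \<theta>_def field_simps)
  qed
  have "(\<lambda>L. K * (1 + u) powr (\<rho> + 1) * \<theta> ^ L) \<longlonglongrightarrow> K * (1 + u) powr (\<rho> + 1) * 0"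
    using \<theta> by (intro tendsto_mult tendsto_const LIMSEQ_power_zero) auto
  hence "cmod (f u) \<le> K * (1 + u) powr (\<rho> + 1) * 0"
    by (rule tendsto_lowerbound) (use bound in auto)
  thus ?case by simp
qed auto

text \<open>
The relation between y(qN + r) and y(N) reproduces any bound W that gains a multiple of V in each step, where V bounds
T y and the increments.
\<close>
lemma slow_seq_rec_bound:
  fixes V W :: "nat \<Rightarrow> real"
  assumes "slow_seq y" and K1: "\<And>N. N \<ge> 1 \<Longrightarrow> cmod (qdiff q l y N) \<le> B * V N"
    and V: "\<And>N. N \<ge> 1 \<Longrightarrow> real N powr \<rho> \<le> V N" and W: "\<And>N. N \<ge> 1 \<Longrightarrow> W N \<ge> 1"
    and c: "c > 0" and VW: "\<And>N r. N \<ge> 1 \<Longrightarrow> r < q \<Longrightarrow> cmod l * W N + c * V N \<le> W (q * N + r)"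
  shows "\<exists>K. \<forall>N\<ge>1. cmod (y N) \<le> K * W N"
proof -
  obtain K2 where K2: "K2 \<ge> 0" "\<And>N r. r \<le> q \<Longrightarrow>
     cmod (y (q * N + r) - y (q * N)) \<le> K2 * (1 + real N) powr \<rho>"
    using slow_seq_block[OF assms(1)] by blast
  \<comment> \<open>The values below q start the induction; the quotient pays for the inhomogeneous part.\<close>
  define K where "K = Max (insert ((B + K2 * 2 powr \<rho>) / c) (insert 0 ((\<lambda>N. cmod (y N)) ` {..<q})))"
  have Ky: "cmod (y N) \<le> K" if "N < q" for N unfolding K_def using that by (intro Max_ge) auto
  have "(B + K2 * 2 powr \<rho>) / c \<le> K" unfolding K_def by (intro Max_ge) auto
  hence Kc: "B + K2 * 2 powr \<rho> \<le> K * c" using c by (simp add: field_simps)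
  have K0: "K \<ge> 0" unfolding K_def by (intro Max_ge) auto
  have "cmod (y N) \<le> K * W N" if "N \<ge> 1" for N
    using that
  proof (induction N rule: less_induct)
    case (less M)
    show ?case
    proof (cases "M < q")
      case True
      have "cmod (y M) \<le> K * 1" using Ky[OF True] by simp
      also have "\<dots> \<le> K * W M" using W less.prems K0 by (intro mult_left_mono) auto
      finally show ?thesis .
    next
      case False
      define N r where "N = M div q" and "r = M mod q"
      have M: "M = q * N + r" "r < q" using q2 by (auto simp: N_def r_def)
      have N: "N \<ge> 1" "N < M" using False q2 by (auto simp: N_def div_greater_zero_iff Suc_le_eq)
      have "real N \<ge> 1" using N by simp
      hence "(1 + real N) powr \<rho> \<le> (2 * real N) powr \<rho>" using rho by (intro powr_mono2) auto
      also have "\<dots> = 2 powr \<rho> * real N powr \<rho>" by (simp add: powr_mult)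
      also have "\<dots> \<le> 2 powr \<rho> * V N" using V N by (intro mult_left_mono) auto
      finally have *: "K2 * (1 + real N) powr \<rho> \<le> K2 * (2 powr \<rho> * V N)"
        using K2 by (intro mult_left_mono) auto
      have V0: "V N \<ge> 0" using V[OF N(1)] by (rule order.trans[rotated]) auto
      have "y M = l * y N + (qdiff q l y N + (y (q * N + r) - y (q * N)))" by (simp add: M qdiff_def)
      also have "cmod \<dots> \<le> cmod l * (K * W N) + (B * V N + K2 * (2 powr \<rho> * V N))"
        using less.IH[OF N(2,1)] M
        by (intro order.trans[OF norm_triangle_ineq] add_mono K1 N)
           (auto simp: norm_mult intro!: mult_left_mono order.trans[OF K2(2) *])
      also have "\<dots> = K * (cmod l * W N) + (B + K2 * 2 powr \<rho>) * V N" by (simp add: algebra_simps)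
      also have "\<dots> \<le> K * (cmod l * W N) + (K * c) * V N" using V0 Kc by (intro add_left_mono mult_right_mono)
      also have "\<dots> = K * (cmod l * W N + c * V N)" by (simp add: algebra_simps)
      also have "\<dots> \<le> K * W M" unfolding M(1) using K0 M N by (intro mult_left_mono VW) auto
      finally show ?thesis .
    qed
  qed
  thus ?thesis by blast
qed

lemma small_bound:
  assumes l: "cmod l < R" and "slow_seq y" "\<And>N. (qdiff q l ^^ n) y N = 0"
  shows "\<exists>K. \<forall>N\<ge>1. cmod (y N) \<le> K * real N powr \<rho>"
  using assms(2,3)
proof (induction n arbitrary: y)
  case 0
  thus ?case by (auto intro!: exI[of _ 0])
next
  case (Suc n)
  have "(qdiff q l ^^ n) (qdiff q l y) N = 0" for N
    using Suc.prems(2)[of N] by (simp add: funpow_swap1)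
  from Suc.IH[OF slow_seq_qdiff[OF Suc.prems(1)] this]
  obtain K1 where K1: "\<And>N. N \<ge> 1 \<Longrightarrow> cmod (qdiff q l y N) \<le> K1 * real N powr \<rho>" by blast
  show ?case
  proof (rule slow_seq_rec_bound[OF Suc.prems(1), where c = "R - cmod l" and l = l and B = K1
           and V = "\<lambda>N. real N powr \<rho>" and W = "\<lambda>N. real N powr \<rho>"])
    show "cmod (qdiff q l y N) \<le> K1 * real N powr \<rho>" if "N \<ge> 1" for N using K1[OF that] .
    show "1 \<le> real N powr \<rho>" if "N \<ge> 1" for N using that rho by (intro ge_one_powr_ge_zero) auto
    show "R - cmod l > 0" using l by simp
  next
    fix N r assume N: "N \<ge> (1::nat)" "r < q"
    have "cmod l * real N powr \<rho> + (R - cmod l) * real N powr \<rho> = (real q * real N) powr \<rho>"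
      by (subst powr_mult) (auto simp: left_diff_distrib)
    also have "\<dots> \<le> real (q * N + r) powr \<rho>" using rho by (intro powr_mono2) auto
    finally show "cmod l * real N powr \<rho> + (R - cmod l) * real N powr \<rho> \<le> real (q * N + r) powr \<rho>" .
  qed auto
qed

text \<open>
For |l| = R the homogeneous part just reproduces N^\<rho>, and the inhomogeneous part of the same size is added once
per digit.  With x = log_q N, the weight (1 + x)^n absorbs this, because (2 + x) (1 + x)^n =
(1 + x)^(n + 1) + (1 + x)^n.
\<close>
lemma critical_bound:
  assumes l: "cmod l = R" and "slow_seq y" "\<And>N. (qdiff q l ^^ n) y N = 0"
  shows "\<exists>K. \<forall>N\<ge>1. cmod (y N) \<le> K * (real N powr \<rho> * (1 + log q N) ^ n)"
  using assms(2,3)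
proof (induction n arbitrary: y)
  case 0
  thus ?case by (auto intro!: exI[of _ 0])
next
  case (Suc n)
  have "(qdiff q l ^^ n) (qdiff q l y) N = 0" for N
    using Suc.prems(2)[of N] by (simp add: funpow_swap1)
  from Suc.IH[OF slow_seq_qdiff[OF Suc.prems(1)] this]
  obtain K1 where K1: "\<And>N. N \<ge> 1 \<Longrightarrow> cmod (qdiff q l y N) \<le> K1 * (real N powr \<rho> * (1 + log q N) ^ n)" by blast
  have lg: "log q (real N) \<ge> 0" if "N \<ge> 1" for N :: nat using that q2 by auto
  have one: "real N powr \<rho> \<ge> 1" if "N \<ge> 1" for N :: nat using that rho by (intro ge_one_powr_ge_zero) auto
  show ?case
  proof (rule slow_seq_rec_bound[OF Suc.prems(1), where c = R and l = l and B = K1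
           and V = "\<lambda>N. real N powr \<rho> * (1 + log q N) ^ n"
           and W = "\<lambda>N. real N powr \<rho> * (1 + log q N) ^ Suc n"])
    show "cmod (qdiff q l y N) \<le> K1 * (real N powr \<rho> * (1 + log q N) ^ n)" if "N \<ge> 1" for N
      using K1[OF that] .
    show "R > 0" using R_ge_1 by linarith
  next
    fix N r assume N: "N \<ge> (1::nat)" "r < q"
    define x where "x = log q (real N)"
    have x: "x \<ge> 0" using lg N by (simp add: x_def)
    have "real (q * N) > 0" using N q2 by simp
    hence "log q (q * N + r) \<ge> log q (q * N)" using q2 by (subst log_le_cancel_iff) auto
    also have "log q (q * N) = 1 + x" using N q2 by (simp add: log_mult x_def)
    finally have x2: "log q (q * N + r) \<ge> 1 + x" .
    have "cmod l * (real N powr \<rho> * (1 + x) ^ Suc n) + R * (real N powr \<rho> * (1 + x) ^ n) =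
          (real q * real N) powr \<rho> * ((1 + x) ^ n * (2 + x))"
      unfolding l by (subst powr_mult) (auto simp: distrib_left distrib_right mult_ac)
    also have "\<dots> \<le> (real (q * N + r)) powr \<rho> * ((2 + x) ^ n * (2 + x))"
      using rho x by (intro mult_mono powr_mono2 power_mono) auto
    also have "\<dots> = (real (q * N + r)) powr \<rho> * (2 + x) ^ Suc n" by simp
    also have "\<dots> \<le> (real (q * N + r)) powr \<rho> * (1 + log q (q * N + r)) ^ Suc n"
      using x x2 by (intro mult_left_mono power_mono) auto
    finally show "cmod l * (real N powr \<rho> * (1 + log q N) ^ Suc n) + R * (real N powr \<rho> * (1 + log q N) ^ n)
       \<le> (real (q * N + r)) powr \<rho> * (1 + log q (q * N + r)) ^ Suc n"
      by (simp add: x_def)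
  next
    fix N :: nat assume N: "N \<ge> 1"
    have "real N powr \<rho> * 1 \<le> real N powr \<rho> * (1 + log q N) ^ n"
      using lg[OF N] by (intro mult_left_mono one_le_power) auto
    thus "real N powr \<rho> \<le> real N powr \<rho> * (1 + log q N) ^ n" by simp
    have "1 * 1 \<le> real N powr \<rho> * (1 + log q N) ^ Suc n"
      using lg[OF N] one[OF N] by (intro mult_mono one_le_power) auto
    thus "1 \<le> real N powr \<rho> * (1 + log q N) ^ Suc n" by simp
  qed
qed

end

section \<open>Hoelder regularity and periodic coefficients\<close>

text \<open>
Hoelder continuity on bounded sets is, unlike global Hoelder continuity, stable under products, and for periodic functions
both notions agree.
\<close>
definition locally_hoelder :: "real \<Rightarrow> (real \<Rightarrow> complex) \<Rightarrow> bool" where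
  "locally_hoelder a f \<longleftrightarrow>
     (\<forall>B. \<exists>K. \<forall>x y. \<bar>x\<bar> \<le> B \<longrightarrow> \<bar>y\<bar> \<le> B \<longrightarrow> cmod (f x - f y) \<le> K * \<bar>x - y\<bar> powr a)"

lemma locally_hoelderD:
  assumes "locally_hoelder a f"
  shows "\<exists>K\<ge>0. \<forall>x y. \<bar>x\<bar> \<le> B \<longrightarrow> \<bar>y\<bar> \<le> B \<longrightarrow> cmod (f x - f y) \<le> K * \<bar>x - y\<bar> powr a"
proof -
  from assms obtain K where K: "\<forall>x y. \<bar>x\<bar> \<le> B \<longrightarrow> \<bar>y\<bar> \<le> B \<longrightarrow> cmod (f x - f y) \<le> K * \<bar>x - y\<bar> powr a"
    unfolding locally_hoelder_def by blast
  show ?thesis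
  proof (intro exI[of _ "\<bar>K\<bar>"] conjI allI impI)
    fix x y :: real assume "\<bar>x\<bar> \<le> B" "\<bar>y\<bar> \<le> B"
    with K have "cmod (f x - f y) \<le> K * \<bar>x - y\<bar> powr a" by blast
    also have "\<dots> \<le> \<bar>K\<bar> * \<bar>x - y\<bar> powr a" by (intro mult_right_mono) auto
    finally show "cmod (f x - f y) \<le> \<bar>K\<bar> * \<bar>x - y\<bar> powr a" .
  qed auto
qed

lemma locally_hoelder_bounded:
  assumes "locally_hoelder a f" "a > 0"
  shows "\<exists>M\<ge>0. \<forall>x. \<bar>x\<bar> \<le> B \<longrightarrow> cmod (f x) \<le> M"
proof -
  obtain K where K: "K \<ge> 0" "\<And>x y. \<bar>x\<bar> \<le> \<bar>B\<bar> \<Longrightarrow> \<bar>y\<bar> \<le> \<bar>B\<bar> \<Longrightarrow> cmod (f x - f y) \<le> K * \<bar>x - y\<bar> powr a"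
    using locally_hoelderD[OF assms(1), of "\<bar>B\<bar>"] by blast
  show ?thesis
  proof (intro exI[of _ "cmod (f 0) + K * \<bar>B\<bar> powr a"] conjI allI impI)
    fix x assume x: "\<bar>x\<bar> \<le> B"
    have "cmod (f x) \<le> cmod (f 0) + cmod (f x - f 0)"
      by (metis add_diff_cancel_left' diff_add_cancel norm_triangle_ineq add.commute)
    also have "cmod (f x - f 0) \<le> K * \<bar>x - 0\<bar> powr a" using x by (intro K) auto
    also have "\<dots> \<le> K * \<bar>B\<bar> powr a" using x K assms by (intro mult_left_mono powr_mono2) auto
    finally show "cmod (f x) \<le> cmod (f 0) + K * \<bar>B\<bar> powr a" by simp
  qed (use K in auto)
qed

lemma locally_hoelder_diff:
  assumes "locally_hoelder a f" "locally_hoelder a g"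
  shows "locally_hoelder a (\<lambda>x. f x - g x)"
  unfolding locally_hoelder_def
proof
  fix B
  obtain K where K: "\<And>x y. \<bar>x\<bar> \<le> B \<Longrightarrow> \<bar>y\<bar> \<le> B \<Longrightarrow> cmod (f x - f y) \<le> K * \<bar>x - y\<bar> powr a"
    using locally_hoelderD[OF assms(1), of B] by blast
  obtain L where L: "\<And>x y. \<bar>x\<bar> \<le> B \<Longrightarrow> \<bar>y\<bar> \<le> B \<Longrightarrow> cmod (g x - g y) \<le> L * \<bar>x - y\<bar> powr a"
    using locally_hoelderD[OF assms(2), of B] by blast
  show "\<exists>K. \<forall>x y. \<bar>x\<bar> \<le> B \<longrightarrow> \<bar>y\<bar> \<le> B \<longrightarrow> cmod (f x - g x - (f y - g y)) \<le> K * \<bar>x - y\<bar> powr a"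
  proof (intro exI allI impI)
    fix x y assume xy: "\<bar>x\<bar> \<le> B" "\<bar>y\<bar> \<le> B"
    have "f x - g x - (f y - g y) = (f x - f y) - (g x - g y)" by simp
    also have "cmod \<dots> \<le> K * \<bar>x - y\<bar> powr a + L * \<bar>x - y\<bar> powr a"
      using K[OF xy] L[OF xy] by (rule order.trans[OF norm_triangle_ineq4 add_mono])
    finally show "cmod (f x - g x - (f y - g y)) \<le> (K + L) * \<bar>x - y\<bar> powr a"
      by (simp add: distrib_right)
  qed
qed

lemma locally_hoelder_mult:
  assumes "locally_hoelder a f" "locally_hoelder a g" "a > 0"
  shows "locally_hoelder a (\<lambda>x. f x * g x)"
  unfolding locally_hoelder_def
proof
  fix B
  obtain K where K: "\<And>x y. \<bar>x\<bar> \<le> B \<Longrightarrow> \<bar>y\<bar> \<le> B \<Longrightarrow> cmod (f x - f y) \<le> K * \<bar>x - y\<bar> powr a"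
    using locally_hoelderD[OF assms(1), of B] by blast
  obtain L where L: "\<And>x y. \<bar>x\<bar> \<le> B \<Longrightarrow> \<bar>y\<bar> \<le> B \<Longrightarrow> cmod (g x - g y) \<le> L * \<bar>x - y\<bar> powr a"
    using locally_hoelderD[OF assms(2), of B] by blast
  obtain M where M: "M \<ge> 0" "\<And>x. \<bar>x\<bar> \<le> B \<Longrightarrow> cmod (f x) \<le> M"
    using locally_hoelder_bounded[OF assms(1,3), of B] by blast
  obtain M' where M': "M' \<ge> 0" "\<And>x. \<bar>x\<bar> \<le> B \<Longrightarrow> cmod (g x) \<le> M'"
    using locally_hoelder_bounded[OF assms(2,3), of B] by blast
  show "\<exists>K. \<forall>x y. \<bar>x\<bar> \<le> B \<longrightarrow> \<bar>y\<bar> \<le> B \<longrightarrow> cmod (f x * g x - f y * g y) \<le> K * \<bar>x - y\<bar> powr a"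
  proof (intro exI allI impI)
    fix x y assume xy: "\<bar>x\<bar> \<le> B" "\<bar>y\<bar> \<le> B"
    have "f x * g x - f y * g y = f x * (g x - g y) + g y * (f x - f y)" by (simp add: algebra_simps)
    also have "cmod \<dots> \<le> M * (L * \<bar>x - y\<bar> powr a) + M' * (K * \<bar>x - y\<bar> powr a)"
      unfolding norm_mult[symmetric]
      using K[OF xy] L[OF xy] M(2)[OF xy(1)] M'(2)[OF xy(2)] M(1) M'(1)
      by (intro order.trans[OF norm_triangle_ineq add_mono]) (auto simp: norm_mult intro!: mult_mono)
    finally show "cmod (f x * g x - f y * g y) \<le> (M * L + M' * K) * \<bar>x - y\<bar> powr a"
      by (simp add: algebra_simps)
  qed
qed

lemma locally_hoelder_const: "locally_hoelder a (\<lambda>_. c)"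
  by (auto simp: locally_hoelder_def intro!: exI[of _ 0])

lemma locally_hoelder_shift:
  assumes "locally_hoelder a f"
  shows "locally_hoelder a (\<lambda>t. f (t + c))"
  unfolding locally_hoelder_def
proof
  fix B
  obtain K where K: "\<And>x y. \<bar>x\<bar> \<le> B + \<bar>c\<bar> \<Longrightarrow> \<bar>y\<bar> \<le> B + \<bar>c\<bar> \<Longrightarrow> cmod (f x - f y) \<le> K * \<bar>x - y\<bar> powr a"
    using locally_hoelderD[OF assms(1), of "B + \<bar>c\<bar>"] by blast
  show "\<exists>K. \<forall>x y. \<bar>x\<bar> \<le> B \<longrightarrow> \<bar>y\<bar> \<le> B \<longrightarrow> cmod (f (x + c) - f (y + c)) \<le> K * \<bar>x - y\<bar> powr a"
  proof (intro exI allI impI)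
    fix x y assume "\<bar>x\<bar> \<le> B" "\<bar>y\<bar> \<le> B"
    thus "cmod (f (x + c) - f (y + c)) \<le> K * \<bar>x - y\<bar> powr a"
      using K[of "x + c" "y + c"] by auto
  qed
qed

text \<open>
On a bounded set |x - y| is at most a multiple of |x - y|^a because a \<le> 1.
\<close>
lemma locally_hoelder_of_lipschitz:
  assumes "\<And>B. \<exists>L. \<forall>x y. \<bar>x\<bar> \<le> B \<longrightarrow> \<bar>y\<bar> \<le> B \<longrightarrow> cmod (f x - f y) \<le> L * \<bar>x - y\<bar>" and a: "0 < a" "a \<le> 1"
  shows "locally_hoelder a f"
  unfolding locally_hoelder_def
proof
  fix B
  obtain L where L: "\<And>x y. \<bar>x\<bar> \<le> B \<Longrightarrow> \<bar>y\<bar> \<le> B \<Longrightarrow> cmod (f x - f y) \<le> L * \<bar>x - y\<bar>"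
    using assms(1)[of B] by blast
  show "\<exists>K. \<forall>x y. \<bar>x\<bar> \<le> B \<longrightarrow> \<bar>y\<bar> \<le> B \<longrightarrow> cmod (f x - f y) \<le> K * \<bar>x - y\<bar> powr a"
  proof (intro exI allI impI)
    fix x y assume xy: "\<bar>x\<bar> \<le> B" "\<bar>y\<bar> \<le> B"
    show "cmod (f x - f y) \<le> (\<bar>L\<bar> * (2 * B) powr (1 - a)) * \<bar>x - y\<bar> powr a"
    proof (cases "x = y")
      case False
      have "cmod (f x - f y) \<le> \<bar>L\<bar> * \<bar>x - y\<bar>"
        by (rule order.trans[OF L[OF xy]]) (intro mult_right_mono, auto)
      also have "\<bar>x - y\<bar> = \<bar>x - y\<bar> powr (1 - a) * \<bar>x - y\<bar> powr a"
        using False by (simp flip: powr_add)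
      also have "\<bar>L\<bar> * \<dots> \<le> \<bar>L\<bar> * ((2 * B) powr (1 - a) * \<bar>x - y\<bar> powr a)"
        using xy a by (intro mult_left_mono mult_right_mono powr_mono2) auto
      finally show ?thesis by (simp only: mult_ac)
    qed auto
  qed
qed

lemma exp_lipschitz:
  fixes c :: complex
  shows "\<exists>L\<ge>0. \<forall>x y :: real. \<bar>x\<bar> \<le> B \<longrightarrow> \<bar>y\<bar> \<le> B \<longrightarrow> cmod (exp (c * of_real x) - exp (c * of_real y)) \<le> L * \<bar>x - y\<bar>"
proof (intro exI conjI allI impI)
  fix x y :: real assume xy: "\<bar>x\<bar> \<le> B" "\<bar>y\<bar> \<le> B"
  have "cmod (exp (c * of_real x) - exp (c * of_real y)) \<le> (cmod c * exp (cmod c * B)) * cmod (of_real x - of_real y)"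
  proof (rule field_differentiable_bound[of "cball 0 B"])
    fix z :: complex assume z: "z \<in> cball 0 B"
    show "((\<lambda>z. exp (c * z)) has_field_derivative c * exp (c * z)) (at z within cball 0 B)"
      by (auto intro!: derivative_eq_intros)
    have "cmod (exp (c * z)) \<le> exp (cmod (c * z))" by (rule norm_exp)
    also have "\<dots> \<le> exp (cmod c * B)" using z by (auto simp: norm_mult intro!: mult_left_mono)
    finally show "cmod (c * exp (c * z)) \<le> cmod c * exp (cmod c * B)"
      by (auto simp: norm_mult intro!: mult_left_mono)
  qed (use xy in auto)
  thus "cmod (exp (c * of_real x) - exp (c * of_real y)) \<le> (cmod c * exp (cmod c * B)) * \<bar>x - y\<bar>"
    by (simp flip: of_real_diff)
qed auto

lemma locally_hoelder_exp:
  assumes "0 < a" "a \<le> 1"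
  shows "locally_hoelder a (\<lambda>t. exp (c * of_real t))"
  by (rule locally_hoelder_of_lipschitz[OF _ assms]) (use exp_lipschitz in blast)

lemma locally_hoelder_power:
  assumes "0 < a" "a \<le> 1"
  shows "locally_hoelder a (\<lambda>t. of_real t ^ n)"
proof (induction n)
  case (Suc n)
  have "locally_hoelder a (\<lambda>t. of_real t)"
    by (rule locally_hoelder_of_lipschitz[OF _ assms]) (auto intro!: exI[of _ 1] simp flip: of_real_diff)
  from locally_hoelder_mult[OF this Suc assms(1)] show ?case by simp
qed (simp add: locally_hoelder_const)

lemma periodic_add_int:
  fixes f :: "real \<Rightarrow> complex"
  assumes "\<And>t. f (t + 1) = f t"
  shows "f (t + of_int j) = f t"
proof -
  have nat: "f (t + real n) = f t" for t n
  proof (induction n)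
    case (Suc n)
    have "f (t + real (Suc n)) = f ((t + real n) + 1)" by (simp add: algebra_simps)
    thus ?case using Suc assms by simp
  qed auto
  show ?thesis
  proof (cases "j \<ge> 0")
    case True
    thus ?thesis using nat[of t "nat j"] by simp
  next
    case False
    thus ?thesis using nat[of "t + of_int j" "nat (-j)"] by simp
  qed
qed

text \<open>
Translating by integers moves two points at distance at most 1 into a fixed bounded set; at larger distances
boundedness suffices.
\<close>
lemma hoelder_continuous_of_locally:
  assumes f: "locally_hoelder a f" and a: "a > 0" and per: "\<And>t. f (t + 1) = f t"
  shows "hoelder_continuous a f"
proof -
  obtain K where K: "K \<ge> 0" "\<And>x y. \<bar>x\<bar> \<le> 2 \<Longrightarrow> \<bar>y\<bar> \<le> 2 \<Longrightarrow> cmod (f x - f y) \<le> K * \<bar>x - y\<bar> powr a"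
    using locally_hoelderD[OF f, of 2] by blast
  obtain M where M: "M \<ge> 0" "\<And>x. \<bar>x\<bar> \<le> 1 \<Longrightarrow> cmod (f x) \<le> M"
    using locally_hoelder_bounded[OF f a, of 1] by blast
  have M': "cmod (f x) \<le> M" for x
    using M(2)[of "frac x"] periodic_add_int[of f x "- \<lfloor>x\<rfloor>", OF per] frac_lt_1[of x] frac_ge_0[of x]
    by (auto simp: frac_def)
  show ?thesis unfolding hoelder_continuous_def
  proof (intro exI allI)
    fix x y
    show "dist (f x) (f y) \<le> (K + 2 * M) * dist x y powr a"
    proof (cases "\<bar>x - y\<bar> \<le> 1")
      case True
      define j where "j = - \<lfloor>x\<rfloor>"
      have "x + of_int j \<ge> 0" "x + of_int j < 1" unfolding j_def by linarith+
      hence "cmod (f (x + of_int j) - f (y + of_int j)) \<le> K * \<bar>(x + of_int j) - (y + of_int j)\<bar> powr a"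
        using True by (intro K) auto
      hence "dist (f x) (f y) \<le> K * dist x y powr a"
        using periodic_add_int[of f, OF per] by (simp add: dist_norm)
      also have "\<dots> \<le> (K + 2 * M) * dist x y powr a" using M by (intro mult_right_mono) auto
      finally show ?thesis .
    next
      case False
      have "dist (f x) (f y) \<le> M + M"
        unfolding dist_norm by (intro order.trans[OF norm_triangle_ineq4 add_mono] M')
      also have "\<dots> \<le> (K + 2 * M) * 1" using K by simp
      also have "\<dots> \<le> (K + 2 * M) * dist x y powr a"
        using False a K M by (intro mult_left_mono ge_one_powr_ge_zero) (auto simp: dist_norm)
      finally show ?thesis .
    qed
  qed
qed

lemma hoelder_continuous_imp_continuous:
  assumes "hoelder_continuous a f" "a > 0"
  shows "continuous_on UNIV f"
proof (rule continuous_at_imp_continuous_on, rule ballI)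
  fix x :: real
  from assms obtain K where K: "\<And>x y. dist (f x) (f y) \<le> K * dist x y powr a"
    unfolding hoelder_continuous_def by blast
  have "((\<lambda>y. K * dist y x powr a) \<longlongrightarrow> K * dist x x powr a) (at x)"
    using assms(2) by (intro tendsto_intros tendsto_powr') auto
  hence lim: "((\<lambda>y. K * dist y x powr a) \<longlongrightarrow> 0) (at x)" using assms(2) by simp
  have "((\<lambda>y. dist (f y) (f x)) \<longlongrightarrow> 0) (at x)"
    by (rule Lim_null_comparison[OF _ lim]) (use K in auto)
  thus "isCont f x" unfolding isCont_def by (rule tendsto_dist_iff[THEN iffD2])
qed

definition fdiff :: "(real \<Rightarrow> complex) \<Rightarrow> real \<Rightarrow> complex" where
  "fdiff g t = g (t + 1) - g t"

lemma funpow_fdiff_diff: "(fdiff ^^ n) (\<lambda>t. f t - g t) = (\<lambda>t. (fdiff ^^ n) f t - (fdiff ^^ n) g t)"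
  by (induction n) (auto simp: fdiff_def fun_eq_iff)

text \<open>
A periodic factor passes through the difference operator, and Pascal's rule lowers the binomial coefficient.
\<close>
lemma funpow_fdiff_gbinomial:
  assumes "\<And>t. h (t + 1) = h t" "j \<le> n"
  shows "(fdiff ^^ j) (\<lambda>t. (of_real t gchoose n) * h t) = (\<lambda>t. (of_real t gchoose (n - j)) * h t)"
  using assms(2)
proof (induction j)
  case (Suc j)
  obtain i where i: "n - j = Suc i" "n - Suc j = i" using Suc.prems by (metis Suc_diff_Suc Suc_le_lessD)
  have "(fdiff ^^ Suc j) (\<lambda>t. (of_real t gchoose n) * h t) = fdiff (\<lambda>t. (of_real t gchoose (n - j)) * h t)"
    using Suc by simp
  also have "\<dots> = (\<lambda>t. (of_real t gchoose i) * h t)"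
  proof
    fix t
    have "(of_real (t + 1) gchoose Suc i) = (of_real t gchoose i) + (of_real t gchoose Suc i :: complex)"
      by (simp add: gbinomial_Suc_Suc)
    thus "fdiff (\<lambda>t. (of_real t gchoose (n - j)) * h t) t = (of_real t gchoose i) * h t"
      unfolding fdiff_def i assms(1) by (simp only: ring_distribs) simp
  qed
  finally show ?case by (simp add: i)
qed auto

lemma gbinomial_eq_powers:
  "\<exists>c :: nat \<Rightarrow> complex. \<forall>z. z gchoose n = (\<Sum>k\<le>n. z ^ k * c k)"
proof -
  define p :: "complex poly" where "p = Polynomial.smult (1 / fact n) (\<Prod>i<n. [:- of_nat i, 1:])"
  have "degree p \<le> degree (\<Prod>i<n. [:- (of_nat i :: complex), 1:])" by (simp add: p_def)
  also have "\<dots> \<le> (\<Sum>i<n. degree [:- (of_nat i :: complex), 1:])" 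
    using degree_prod_sum_le[of "{..<n}" "\<lambda>i. [:- (of_nat i :: complex), 1:]"] by (simp add: o_def)
  finally have deg: "degree p \<le> n" by simp
  have "z gchoose n = (\<Sum>k\<le>n. z ^ k * coeff p k)" for z
  proof -
    have "z gchoose n = poly p z"
      by (simp add: p_def poly_prod gbinomial_prod_rev atLeast0LessThan)
    also have "\<dots> = (\<Sum>k\<le>degree p. coeff p k * z ^ k)" by (rule poly_altdef)
    also have "\<dots> = (\<Sum>k\<le>n. coeff p k * z ^ k)"
      using deg by (intro sum.mono_neutral_left) (auto simp: coeff_eq_0)
    finally show ?thesis by (simp add: mult.commute)
  qed
  thus ?thesis by blast
qed

lemma locally_hoelder_fdiff:
  "locally_hoelder a g \<Longrightarrow> locally_hoelder a ((fdiff ^^ n) g)"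
proof (induction n)
  case (Suc n)
  from locally_hoelder_diff[OF locally_hoelder_shift[OF Suc.IH[OF Suc.prems]] Suc.IH[OF Suc.prems]]
  have "locally_hoelder a (\<lambda>t. (fdiff ^^ n) g (t + 1) - (fdiff ^^ n) g t)" .
  moreover have "(fdiff ^^ Suc n) g = (\<lambda>t. (fdiff ^^ n) g (t + 1) - (fdiff ^^ n) g t)"
    by (auto simp: fdiff_def)
  ultimately show ?case by simp
qed auto

text \<open>
Induction on n: h = \<Delta>^n g is periodic, and \<Delta>^n maps the function (t choose n) h(t) to h, so that
subtracting it from g leaves a function with vanishing n-th difference.
\<close>
lemma periodic_decomposition:
  fixes g :: "real \<Rightarrow> complex"
  assumes "\<And>t. (fdiff ^^ n) g t = 0"
    and S: "\<And>a. a \<in> S \<Longrightarrow> 0 < a \<and> a \<le> 1" and "\<And>a. a \<in> S \<Longrightarrow> locally_hoelder a g"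
  shows "\<exists>\<Phi>. (\<forall>k<n. \<forall>t. \<Phi> k (t + 1) = \<Phi> k t) \<and> (\<forall>t. g t = (\<Sum>k<n. of_real t ^ k * \<Phi> k t)) \<and>
             (\<forall>k<n. \<forall>a\<in>S. locally_hoelder a (\<Phi> k))"
  using assms(1,3)
proof (induction n arbitrary: g)
  case 0
  thus ?case by auto
next
  case (Suc n)
  define h where "h = (fdiff ^^ n) g"
  have h: "h (t + 1) = h t" for t 
    using Suc.prems(1)[of t] unfolding h_def funpow.simps comp_def fdiff_def[of "(fdiff ^^ n) g"] by simp
  have hl: "locally_hoelder a h" if "a \<in> S" for a
    unfolding h_def using that by (intro locally_hoelder_fdiff Suc.prems)
  obtain c :: "nat \<Rightarrow> complex" where c: "\<And>z. z gchoose n = (\<Sum>k\<le>n. z ^ k * c k)"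
    using gbinomial_eq_powers by blast
  define b where "b t = (of_real t gchoose n) * h t" for t
  have bl: "locally_hoelder a b" if "a \<in> S" for a
  proof -
    have a: "0 < a" "a \<le> 1" using S that by auto
    have "locally_hoelder a (\<lambda>t. \<Sum>k\<in>A. of_real t ^ k * c k)" if "finite A" for A
      using that
    proof (induction A rule: finite_induct)
      case (insert k A)
      have "locally_hoelder a (\<lambda>t. of_real t ^ k * c k - (0 - (\<Sum>k\<in>A. of_real t ^ k * c k)))"
        by (intro locally_hoelder_diff locally_hoelder_mult locally_hoelder_const locally_hoelder_power a insert.IH)
      thus ?case using insert by simp
    qed (auto intro: locally_hoelder_const)
    from locally_hoelder_mult[OF this[of "{..n}"] hl[OF \<open>a \<in> S\<close>] a(1)] show ?thesis
      by (simp add: b_def[abs_def] c)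
  qed
  have "(fdiff ^^ n) (\<lambda>t. g t - b t) t = 0" for t
    using funpow_fdiff_gbinomial[of h n n] h
    by (simp add: funpow_fdiff_diff b_def[abs_def]) (simp add: h_def)
  from Suc.IH[OF this] locally_hoelder_diff[OF Suc.prems(2) bl]
  obtain \<Psi> where \<Psi>: "\<And>k t. k < n \<Longrightarrow> \<Psi> k (t + 1) = \<Psi> k t"
      "\<And>t. g t - b t = (\<Sum>k<n. of_real t ^ k * \<Psi> k t)"
      "\<And>k a. k < n \<Longrightarrow> a \<in> S \<Longrightarrow> locally_hoelder a (\<Psi> k)" by blast
  define \<Phi> where "\<Phi> k t = (if k < n then \<Psi> k t else 0) - (0 - c k * h t)" for k t
  show ?case
  proof (intro exI[of _ \<Phi>] conjI allI impI ballI)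
    fix t
    have "g t = (\<Sum>k<n. of_real t ^ k * \<Psi> k t) + b t" using \<Psi>(2)[of t] by (simp add: algebra_simps)
    also have "b t = (\<Sum>k<n. of_real t ^ k * (c k * h t)) + of_real t ^ n * (c n * h t)"
      by (simp add: b_def c lessThan_Suc_atMost[symmetric] distrib_left distrib_right sum_distrib_left sum_distrib_right mult_ac)
    also have "(\<Sum>k<n. of_real t ^ k * \<Psi> k t) + \<dots> = (\<Sum>k<Suc n. of_real t ^ k * \<Phi> k t)"
      by (simp add: \<Phi>_def sum.distrib ring_distribs)
    finally show "g t = (\<Sum>k<Suc n. of_real t ^ k * \<Phi> k t)" .
  next
    fix k a assume k: "k < Suc n" and a: "a \<in> S"
    have "locally_hoelder a (\<lambda>t. if k < n then \<Psi> k t else 0)"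
      using \<Psi>(3)[of k a] a by (cases "k < n") (auto intro: locally_hoelder_const)
    thus "locally_hoelder a (\<Phi> k)" unfolding \<Phi>_def using S[OF a]
      by (intro locally_hoelder_diff locally_hoelder_mult locally_hoelder_const hl a) auto
  qed (auto simp: \<Phi>_def \<Psi>(1) h)
qed

text \<open>
The contribution of the eigenvalue l to the main term, as a function of t = log_q N.
\<close>
definition periodic_sum :: "complex \<Rightarrow> nat \<Rightarrow> (nat \<Rightarrow> real \<Rightarrow> complex) \<Rightarrow> real \<Rightarrow> complex" where
  "periodic_sum l n \<Phi> t = exp (Ln l * of_real t) * (\<Sum>k<n. of_real t ^ k * \<Phi> k t)"

context q_scale begin

text \<open>
Scaling by q is translation of t by 1 under u = q^t, and the factor l^(-t) absorbs the eigenvalue.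
\<close>
lemma funpow_fdiff_qdiff:
  assumes l: "l \<noteq> 0"
  shows "(fdiff ^^ n) (\<lambda>t. exp (- Ln l * of_real t) * f (q powr t)) =
         (\<lambda>t. exp (- Ln l * of_real t) * (qdiff q l ^^ n) f (q powr t) / l ^ n)"
proof (induction n)
  case (Suc n)
  have E: "exp (- Ln l * of_real (t + 1)) = exp (- Ln l * of_real t) / l" for t
    using l by (simp add: ring_distribs exp_diff)
  show ?case
  proof
    fix t
    define F where "F = (qdiff q l ^^ n) f"
    have "(fdiff ^^ Suc n) (\<lambda>t. exp (- Ln l * of_real t) * f (q powr t)) t =
          fdiff (\<lambda>t. exp (- Ln l * of_real t) * F (q powr t) / l ^ n) t"
      using Suc by (simp add: F_def)
    also have "\<dots> = exp (- Ln l * of_real t) * (F (q * q powr t) - l * F (q powr t)) / l ^ Suc n"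
      unfolding fdiff_def E using l q2 by (simp add: powr_add field_simps)
    finally show "(fdiff ^^ Suc n) (\<lambda>t. exp (- Ln l * of_real t) * f (q powr t)) t =
       exp (- Ln l * of_real t) * (qdiff q l ^^ Suc n) f (q powr t) / l ^ Suc n"
      by (simp add: qdiff_def F_def)
  qed
qed auto

lemma locally_hoelder_q_powr:
  assumes a: "0 < a" "real q powr a * R < cmod l"
    and f: "slow_fun f" "\<And>u. u \<ge> 0 \<Longrightarrow> (qdiff q l ^^ n) f u = 0"
  shows "locally_hoelder a (\<lambda>t. f (q powr t))"
proof -
  obtain K where K: "K \<ge> 0" "\<And>u w. 0 \<le> u \<Longrightarrow> u \<le> w \<Longrightarrow> w \<le> u + 1 \<Longrightarrow>
           cmod (f w - f u) \<le> K * (1 + u) powr \<rho> * (w - u) powr a"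
    using slow_fun_hoelder[OF a f] by blast
  obtain K2 where K2: "K2 \<ge> 0" "\<And>u w r. 0 \<le> u \<Longrightarrow> u \<le> w \<Longrightarrow> w \<le> u + real r \<Longrightarrow>
    cmod (f w - f u) \<le> real r * K2 * (1 + u + real r) powr \<rho>"
    using slow_fun_interval[OF f(1)] by blast
  show ?thesis unfolding locally_hoelder_def
  proof
    fix B :: real
    define U where "U = q powr B"
    define r where "r = nat \<lceil>U\<rceil>"
    define M where "M = max (K * (1 + U) powr \<rho>) (real r * K2 * (1 + U + real r) powr \<rho>)"
    have U: "U \<le> real r" unfolding r_def by linarith
    have M0: "M \<ge> 0" using K by (auto simp: M_def le_max_iff_disj)
    have le: "cmod (f w - f u) \<le> M * (w - u) powr a" if "0 \<le> u" "u \<le> w" "w \<le> U" for u w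
    proof (cases "w \<le> u + 1")
      case True
      have "cmod (f w - f u) \<le> K * (1 + u) powr \<rho> * (w - u) powr a" using K that True by simp
      also have "\<dots> \<le> K * (1 + U) powr \<rho> * (w - u) powr a"
        using K that rho by (intro mult_right_mono mult_left_mono powr_mono2) auto
      also have "\<dots> \<le> M * (w - u) powr a" by (intro mult_right_mono) (auto simp: M_def)
      finally show ?thesis .
    next
      case False
      have "cmod (f w - f u) \<le> real r * K2 * (1 + u + real r) powr \<rho>"
        using that U by (intro K2) auto
      also have "\<dots> \<le> real r * K2 * (1 + U + real r) powr \<rho>"
        using K2 that rho by (intro mult_left_mono powr_mono2) auto
      also have "\<dots> \<le> M * 1" by (simp add: M_def)
      also have "\<dots> \<le> M * (w - u) powr a"
        using False a M0 by (intro mult_left_mono ge_one_powr_ge_zero) auto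
      finally show ?thesis .
    qed
    have qexp: "of_real (q powr t) = exp (of_real (ln q) * of_real t)" for t :: real
      using q2 by (simp add: powr_def mult.commute exp_of_real flip: of_real_mult)
    obtain L where L: "L \<ge> 0" "\<And>x y :: real. \<bar>x\<bar> \<le> B \<Longrightarrow> \<bar>y\<bar> \<le> B \<Longrightarrow>
        cmod (exp (of_real (ln q) * of_real x) - exp (of_real (ln q) * of_real y)) \<le> L * \<bar>x - y\<bar>"
      using exp_lipschitz[of B "of_real (ln q)"] by blast
    have L': "\<bar>q powr x - q powr y\<bar> \<le> L * \<bar>x - y\<bar>" if "\<bar>x\<bar> \<le> B" "\<bar>y\<bar> \<le> B" for x y
    proof -
      have "\<bar>q powr x - q powr y\<bar> = cmod (of_real (q powr x) - of_real (q powr y))"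
        by (metis norm_of_real of_real_diff real_norm_def)
      also have "\<dots> \<le> L * \<bar>x - y\<bar>" unfolding qexp by (rule L(2)[OF that])
      finally show ?thesis .
    qed
    have main: "cmod (f (q powr y) - f (q powr x)) \<le> (M * L powr a) * \<bar>y - x\<bar> powr a"
      if "\<bar>x\<bar> \<le> B" "\<bar>y\<bar> \<le> B" "x \<le> y" for x y
    proof -
      have q1: "q powr x \<le> q powr y" "q powr y \<le> U" using that q2 by (auto simp: U_def)
      have "cmod (f (q powr y) - f (q powr x)) \<le> M * (q powr y - q powr x) powr a"
        using q1 by (intro le) auto
      also have "\<dots> \<le> M * (L * \<bar>y - x\<bar>) powr a"
        using L'[OF that(2,1)] M0 a q1 by (intro mult_left_mono powr_mono2) auto
      also have "\<dots> = (M * L powr a) * \<bar>y - x\<bar> powr a" using L by (simp add: powr_mult)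
      finally show ?thesis .
    qed
    show "\<exists>K. \<forall>x y. \<bar>x\<bar> \<le> B \<longrightarrow> \<bar>y\<bar> \<le> B \<longrightarrow> cmod (f (q powr x) - f (q powr y)) \<le> K * \<bar>x - y\<bar> powr a"
    proof (intro exI allI impI)
      fix x y assume "\<bar>x\<bar> \<le> B" "\<bar>y\<bar> \<le> B"
      thus "cmod (f (q powr x) - f (q powr y)) \<le> (M * L powr a) * \<bar>x - y\<bar> powr a"
        using main[of x y] main[of y x]
        by (cases "x \<le> y") (auto simp: norm_minus_commute abs_minus_commute)
    qed
  qed
qed

text \<open>
If |l| > q R, the extension vanishes and so do the coefficients; otherwise the exponents below log_q (|l| / R) are below 1, as
\<open>periodic_decomposition\<close> demands.
\<close>
theorem periodic_expansion:
  assumes l: "cmod l > R" and y: "slow_seq y" "\<And>N. (qdiff q l ^^ n) y N = 0"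
  shows "\<exists>\<Phi>. (\<forall>k<n. \<forall>t. \<Phi> k (t + 1) = \<Phi> k t) \<and>
    (\<forall>k<n. \<forall>a. 0 < a \<and> a < log q (cmod l / R) \<longrightarrow> hoelder_continuous a (\<Phi> k)) \<and>
    (\<forall>N\<ge>1. y N = periodic_sum l n \<Phi> (log q N)) \<and>
    (\<exists>K. \<forall>u>0. cmod (periodic_sum l n \<Phi> (log q u) - y (nat \<lfloor>u\<rfloor>)) \<le> K * (1 + u) powr \<rho>)"
proof -
  have l0: "l \<noteq> 0" using l R_ge_1 by auto
  obtain f K where f: "\<And>N. f (real N) = y N"
     and K: "\<And>u. u \<ge> 0 \<Longrightarrow> cmod (f u - y (nat \<lfloor>u\<rfloor>)) \<le> K * (1 + u) powr \<rho>"
     and fn: "\<And>u. u \<ge> 0 \<Longrightarrow> (qdiff q l ^^ n) f u = 0"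
    using lift_exists[OF l y] by blast
  have slow: "slow_fun f" using slow_fun_lift[OF y(1) K] by blast
  define g where "g t = exp (- Ln l * of_real t) * f (q powr t)" for t
  have gn: "(fdiff ^^ n) g t = 0" for t
    unfolding g_def[abs_def] funpow_fdiff_qdiff[OF l0] using fn by simp
  define b where "b = log q (cmod l / R)"
  have b0: "0 < a \<Longrightarrow> a < b \<Longrightarrow> real q powr a * R < cmod l" for a
  proof -
    assume a: "0 < a" "a < b"
    have "real q powr a < real q powr b" using a q2 by simp
    also have "\<dots> = cmod l / R" using q2 l0 by (simp add: b_def powr_log_cancel)
    finally show ?thesis using R_ge_1 q2 by (simp add: field_simps)
  qed
  have "\<exists>\<Phi>. (\<forall>k<n. \<forall>t. \<Phi> k (t + 1) = \<Phi> k t) \<and> (\<forall>t. g t = (\<Sum>k<n. of_real t ^ k * \<Phi> k t)) \<and>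
             (\<forall>k<n. \<forall>a\<in>{0<..<b}. locally_hoelder a (\<Phi> k))"
  proof (cases "cmod l > q * R")
    case True
    have "g t = 0" for t unfolding g_def using slow_fun_eq_0[OF True slow fn] by simp
    thus ?thesis by (intro exI[of _ "\<lambda>_ _. 0"]) (auto intro: locally_hoelder_const)
  next
    case False
    have "cmod l / R \<le> q" using False R_ge_1 q2 by (simp add: field_simps)
    hence "b \<le> log q q" unfolding b_def using q2 l0 by (subst log_le_cancel_iff) auto
    hence b1: "b \<le> 1" using q2 by simp
    show ?thesis
    proof (rule periodic_decomposition[OF gn])
      fix a assume a: "a \<in> {0<..<b}"
      thus a': "0 < a \<and> a \<le> 1" using b1 by auto
      show "locally_hoelder a g" unfolding g_def
        using a a' by (intro locally_hoelder_mult locally_hoelder_exp locally_hoelder_q_powr[OF _ b0 slow fn]) auto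
    qed
  qed
  then obtain \<Phi> where \<Phi>: "\<And>k t. k < n \<Longrightarrow> \<Phi> k (t + 1) = \<Phi> k t" "\<And>t. g t = (\<Sum>k<n. of_real t ^ k * \<Phi> k t)"
     "\<And>k a. k < n \<Longrightarrow> 0 < a \<Longrightarrow> a < b \<Longrightarrow> locally_hoelder a (\<Phi> k)"
    by (elim exE conjE) (rule that, auto)
  have eq: "periodic_sum l n \<Phi> (log q u) = f u" if "u > 0" for u
  proof -
    have "exp (Ln l * of_real (log q u)) * exp (- Ln l * of_real (log q u)) = 1"
      by (simp flip: exp_add)
    thus ?thesis using \<Phi>(2)[of "log q u"] that q2
      by (simp add: periodic_sum_def g_def powr_log_cancel flip: \<Phi>(2))
  qed
  show ?thesis
  proof (intro exI[of _ \<Phi>] conjI allI impI; (elim conjE)?)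
    show "hoelder_continuous a (\<Phi> k)" if "k < n" "0 < a" "a < log q (cmod l / R)" for k a
      using hoelder_continuous_of_locally[OF \<Phi>(3)] \<Phi>(1) that by (auto simp: b_def)
    show "\<exists>K. \<forall>u>0. cmod (periodic_sum l n \<Phi> (log q u) - y (nat \<lfloor>u\<rfloor>)) \<le> K * (1 + u) powr \<rho>"
      using K by (intro exI[of _ K]) (simp add: eq)
  qed (use \<Phi>(1) eq f in auto)
qed

end

section \<open>Convergence of Fourier series\<close>

text \<open>
For polynomials this is integration by parts; polynomials are uniformly dense by the Weierstrass theorem.
\<close>
lemma riemann_lebesgue:
  fixes h :: "real \<Rightarrow> complex"
  assumes h: "continuous_on {a..b} h" and \<omega>: "filterlim (\<lambda>n. \<bar>\<omega> n\<bar>) at_top sequentially"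
  shows "(\<lambda>n. integral {a..b} (\<lambda>t. h t * exp (\<i> * of_real (\<omega> n * t)))) \<longlonglongrightarrow> 0"
proof (cases "a \<le> b")
  case False
  thus ?thesis by simp
next
  case ab: True
  show ?thesis
  proof (rule LIMSEQ_I)
    fix e :: real assume e: "e > 0"
    define d where "d = e / (2 * (b - a + 1))"
    have d: "d > 0" using e ab by (simp add: d_def)
    obtain p where p: "polynomial_function p" "\<And>x. x \<in> {a..b} \<Longrightarrow> norm (h x - p x) < d"
      using Stone_Weierstrass_polynomial_function[OF compact_Icc h d] by blast
    obtain p' where p': "polynomial_function p'" "\<And>x. (p has_vector_derivative p' x) (at x)"
      using has_vector_derivative_polynomial_function[OF p(1)] by blast
    have cont: "continuous_on {a..b} p" "continuous_on {a..b} p'"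
      using p(1) p'(1) by (auto intro: continuous_on_polymonial_function)
    have "\<exists>M. \<forall>t\<in>{a..b}. cmod (p t) \<le> M" "\<exists>M. \<forall>t\<in>{a..b}. cmod (p' t) \<le> M"
      using compact_imp_bounded[OF compact_continuous_image[OF cont(1) compact_Icc]]
            compact_imp_bounded[OF compact_continuous_image[OF cont(2) compact_Icc]]
      by (simp_all add: bounded_iff)
    then obtain M M' where M: "\<And>t. t \<in> {a..b} \<Longrightarrow> cmod (p t) \<le> M"
      and M': "\<And>t. t \<in> {a..b} \<Longrightarrow> cmod (p' t) \<le> M'" by blast
    define B where "B = 2 * M + M' * (b - a)"
    have bound: "cmod (integral {a..b} (\<lambda>t. p t * exp (\<i> * of_real (w * t)))) \<le> B / \<bar>w\<bar>" if w: "w \<noteq> 0" for w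
    proof -
      define E where "E t = exp (\<i> * of_real (w * t))" for t
      have E1: "cmod (E t) = 1" for t by (simp add: E_def)
      have dE: "(E has_vector_derivative (\<i> * w * E t)) (at t within S)" for t S
        unfolding E_def by (auto intro!: derivative_eq_intros has_vector_derivative_real_field simp: mult_ac)
      have contE: "continuous_on S E" for S unfolding E_def by (intro continuous_intros)
      have "((\<lambda>t. p t * (\<i> * w * E t) + p' t * E t) has_integral p b * E b - p a * E a) {a..b}"
        by (rule fundamental_theorem_of_calculus[OF ab])
           (intro has_vector_derivative_mult dE has_vector_derivative_at_within[OF p'(2)])
      hence "((\<lambda>t. p t * (\<i> * w * E t) + p' t * E t - p' t * E t) has_integral (p b * E b - p a * E a) - integral {a..b} (\<lambda>t. p' t * E t)) {a..b}"
        by (rule has_integral_diff) (intro integrable_integral integrable_continuous_real continuous_intros cont contE)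
      hence "((\<lambda>t. (1 / (\<i> * w)) * (p t * (\<i> * w * E t))) has_integral (1 / (\<i> * w)) * ((p b * E b - p a * E a) - integral {a..b} (\<lambda>t. p' t * E t))) {a..b}"
        by (intro has_integral_mult_right) simp
      hence "integral {a..b} (\<lambda>t. p t * E t) = (1 / (\<i> * w)) * ((p b * E b - p a * E a) - integral {a..b} (\<lambda>t. p' t * E t))"
        using w by (intro integral_unique) (simp add: field_simps)
      hence "cmod (integral {a..b} (\<lambda>t. p t * E t)) = (1 / \<bar>w\<bar>) * cmod ((p b * E b - p a * E a) - integral {a..b} (\<lambda>t. p' t * E t))"
        by (simp add: norm_mult norm_divide)
      also have "\<dots> \<le> (1 / \<bar>w\<bar>) * B"
      proof (intro mult_left_mono)
        have "cmod (integral {a..b} (\<lambda>t. p' t * E t)) \<le> M' * (b - a)"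
          by (rule integral_bound[OF ab]) (auto simp: norm_mult E1 M' intro!: continuous_intros cont contE)
        moreover have "cmod (p b * E b - p a * E a) \<le> M + M"
          using M[of a] M[of b] ab by (intro order.trans[OF norm_triangle_ineq4 add_mono]) (auto simp: norm_mult E1)
        ultimately show "cmod ((p b * E b - p a * E a) - integral {a..b} (\<lambda>t. p' t * E t)) \<le> B"
          unfolding B_def by (intro order.trans[OF norm_triangle_ineq4]) linarith
      qed auto
      finally show ?thesis by (simp add: E_def)
    qed
    have "eventually (\<lambda>n. \<bar>\<omega> n\<bar> > max 1 (2 * B / e)) sequentially"
      using \<omega> unfolding filterlim_at_top_dense by blast
    then obtain n0 where n0: "\<And>n. n \<ge> n0 \<Longrightarrow> \<bar>\<omega> n\<bar> > max 1 (2 * B / e)"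
      by (auto simp: eventually_sequentially)
    show "\<exists>n0. \<forall>n\<ge>n0. norm (integral {a..b} (\<lambda>t. h t * exp (\<i> * of_real (\<omega> n * t))) - 0) < e"
    proof (intro exI allI impI)
      fix n assume "n \<ge> n0"
      note n = n0[OF this]
      define E where "E t = exp (\<i> * of_real (\<omega> n * t))" for t
      have contE: "continuous_on S E" for S unfolding E_def by (intro continuous_intros)
      have "integral {a..b} (\<lambda>t. h t * E t) = integral {a..b} (\<lambda>t. (h t - p t) * E t + p t * E t)"
        by (simp add: algebra_simps)
      also have "\<dots> = integral {a..b} (\<lambda>t. (h t - p t) * E t) + integral {a..b} (\<lambda>t. p t * E t)"
        by (intro integral_add integrable_continuous_real continuous_intros h cont contE)
      also have "cmod \<dots> \<le> d * (b - a) + B / \<bar>\<omega> n\<bar>"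
      proof (intro order.trans[OF norm_triangle_ineq add_mono])
        show "cmod (integral {a..b} (\<lambda>t. (h t - p t) * E t)) \<le> d * (b - a)"
          using p(2) by (intro integral_bound[OF ab] continuous_intros h cont contE)
                        (auto simp: norm_mult E_def less_imp_le)
        show "cmod (integral {a..b} (\<lambda>t. p t * E t)) \<le> B / \<bar>\<omega> n\<bar>"
          using bound[of "\<omega> n"] n unfolding E_def by auto
      qed
      also have "d * (b - a) \<le> d * (b - a + 1)" using d by (intro mult_left_mono) auto
      also have "\<dots> = e / 2" using ab by (simp add: d_def field_simps)
      also have "B / \<bar>\<omega> n\<bar> < e / 2"
      proof -
        have "2 * B / e < \<bar>\<omega> n\<bar>" "\<bar>\<omega> n\<bar> > 0" using n by auto
        thus ?thesis using e by (simp add: field_simps)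
      qed
      finally show "norm (integral {a..b} (\<lambda>t. h t * exp (\<i> * of_real (\<omega> n * t))) - 0) < e"
        by (simp add: E_def)
    qed
  qed
qed

text \<open>
Translation by the integer part of c reduces this to 0 \<le> c < 1, where the part beyond 1 is moved back by one
period.
\<close>
lemma integral_periodic_shift:
  fixes F :: "real \<Rightarrow> complex"
  assumes F: "continuous_on UNIV F" and per: "\<And>t. F (t + 1) = F t"
  shows "integral {c..c+1} F = integral {0..1} F"
proof -
  define n where "n = \<lfloor>c\<rfloor>"
  define r where "r = c - of_int n"
  have r: "0 \<le> r" "r < 1" unfolding r_def n_def by linarith+
  have cont: "continuous_on S F" for S by (rule continuous_on_subset[OF F]) auto
  have int: "F integrable_on {x..y}" for x y by (intro integrable_continuous_real cont)
  have "integral {c..c+1} F = integral {r + of_int n..r + 1 + of_int n} F" by (simp add: r_def)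
  also have "\<dots> = integral {r..r+1} (\<lambda>t. F (t + of_int n))"
    using integral_shift_real_ivl[of "r + of_int n" "of_int n" "r + 1 + of_int n" F] by simp
  also have "(\<lambda>t. F (t + of_int n)) = F" using periodic_add_int[of F, OF per] by auto
  also have "integral {r..r+1} F = integral {r..1} F + integral {1..r+1} F"
    using r by (intro Henstock_Kurzweil_Integration.integral_combine[symmetric] int) auto
  also have "integral {1..r+1} F = integral {0+1..r+1} F" by simp
  also have "\<dots> = integral {0..r} (\<lambda>t. F (t + 1))" using integral_shift_real_ivl[of "0 + 1" 1 "r + 1" F] by simp
  also have "(\<lambda>t. F (t + 1)) = F" using per by auto
  also have "integral {r..1} F + integral {0..r} F = integral {0..1} F"
    using r by (subst add.commute, intro Henstock_Kurzweil_Integration.integral_combine int) auto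
  finally show ?thesis .
qed

definition dirichlet_kernel :: "nat \<Rightarrow> real \<Rightarrow> complex" where
  "dirichlet_kernel L t = (\<Sum>j = - int L..int L. exp (\<i> * of_real (- 2 * pi * of_int j * t)))"

text \<open>
Multiplication by exp (-2 \<pi> i t) - 1 makes the sum telescope.  This yields both the bound of order 1/|t| near 0 and, away
from the integers, the two oscillating terms to which \<open>riemann_lebesgue\<close> applies.
\<close>
lemma dirichlet_kernel_telescope:
  "dirichlet_kernel L t * (exp (\<i> * of_real (- 2 * pi * t)) - 1) =
     exp (\<i> * of_real ((- 2 * pi * of_nat (L + 1)) * t)) - exp (\<i> * of_real ((2 * pi * of_nat L) * t))"
proof (induction L)
  case 0
  thus ?case by (simp add: dirichlet_kernel_def)
next
  case (Suc L)
  define w where "w = exp (\<i> * of_real (- 2 * pi * t))"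
  have set: "{- int (Suc L)..int (Suc L)} = insert (- int (Suc L)) (insert (int (Suc L)) {- int L..int L})"
    by auto
  have e1: "exp (\<i> * of_real (- 2 * pi * of_int (int (Suc L)) * t)) * (w - 1) =
        exp (\<i> * of_real ((- 2 * pi * of_nat (Suc L + 1)) * t)) - exp (\<i> * of_real ((- 2 * pi * of_nat (L + 1)) * t))"
    unfolding w_def right_diff_distrib exp_add[symmetric] by (simp add: algebra_simps)
  have e2: "exp (\<i> * of_real (- 2 * pi * of_int (- int (Suc L)) * t)) * (w - 1) =
        exp (\<i> * of_real ((2 * pi * of_nat L) * t)) - exp (\<i> * of_real ((2 * pi * of_nat (Suc L)) * t))"
    unfolding w_def right_diff_distrib exp_add[symmetric] by (simp add: algebra_simps)
  have "dirichlet_kernel (Suc L) t = exp (\<i> * of_real (- 2 * pi * of_int (- int (Suc L)) * t)) +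
          (exp (\<i> * of_real (- 2 * pi * of_int (int (Suc L)) * t)) + dirichlet_kernel L t)"
    unfolding dirichlet_kernel_def set by (subst sum.insert; simp)+
  hence "dirichlet_kernel (Suc L) t * (w - 1) =
     (exp (\<i> * of_real ((2 * pi * of_nat L) * t)) - exp (\<i> * of_real ((2 * pi * of_nat (Suc L)) * t))) +
     ((exp (\<i> * of_real ((- 2 * pi * of_nat (Suc L + 1)) * t)) - exp (\<i> * of_real ((- 2 * pi * of_nat (L + 1)) * t))) +
     (exp (\<i> * of_real ((- 2 * pi * of_nat (L + 1)) * t)) - exp (\<i> * of_real ((2 * pi * of_nat L) * t))))"
    using Suc.IH by (simp only: distrib_right e1 e2 flip: w_def)
  thus ?case by (simp add: w_def)
qed

lemma exp_2pi_eq_1_iff: "exp (\<i> * of_real (- 2 * pi * t)) = 1 \<longleftrightarrow> t \<in> \<int>"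
proof
  assume "exp (\<i> * of_real (- 2 * pi * t)) = 1"
  then obtain n :: int where "- 2 * pi * t = of_int (2 * n) * pi"
    unfolding exp_eq_1 by auto
  hence "pi * t = pi * of_int (- n)" by simp
  hence "t = of_int (- n)" by (subst (asm) mult_left_cancel) auto
  thus "t \<in> \<int>" by (metis Ints_of_int)
next
  assume "t \<in> \<int>"
  then obtain n where "t = of_int n" by (auto elim: Ints_cases)
  thus "exp (\<i> * of_real (- 2 * pi * t)) = 1"
    unfolding exp_eq_1 by (auto intro!: exI[of _ "- n"])
qed

lemma integral_dirichlet_kernel: "integral {-1/2..1/2} (dirichlet_kernel L) = 1"
proof -
  have "integral {-1/2..1/2} (\<lambda>t. exp (\<i> * of_real (- 2 * pi * of_int j * t))) = (if j = 0 then 1 else 0)" for j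
  proof (cases "j = 0")
    case False
    define c where "c = \<i> * of_real (- 2 * pi * of_int j)"
    have c: "c \<noteq> 0" using False by (simp add: c_def)
    have "((\<lambda>t. exp (c * of_real t)) has_integral exp (c * of_real (1/2)) / c - exp (c * of_real (-1/2)) / c) {-1/2..1/2}"
      using c by (intro fundamental_theorem_of_calculus)
         (auto intro!: derivative_eq_intros has_vector_derivative_real_field)
    moreover have "exp (c * of_real (1/2)) = exp (c * of_real (-1/2)) * exp (\<i> * of_real (- 2 * pi * of_int j))"
      by (simp add: c_def algebra_simps flip: exp_add)
    hence "exp (c * of_real (1/2)) = exp (c * of_real (-1/2))"
      unfolding exp_2pi_eq_1_iff[THEN iffD2, OF Ints_of_int] by simp
    ultimately have "((\<lambda>t. exp (c * of_real t)) has_integral 0) {-1/2..1/2}" by simp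
    thus ?thesis using False by (intro integral_unique) (simp add: c_def mult_ac)
  qed auto
  moreover have "integral {-1/2..1/2} (dirichlet_kernel L) =
      (\<Sum>j = - int L..int L. integral {-1/2..1/2} (\<lambda>t. exp (\<i> * of_real (- 2 * pi * of_int j * t))))"
    unfolding dirichlet_kernel_def
    by (intro integral_sum) (auto intro!: integrable_continuous_real continuous_intros)
  ultimately show ?thesis by (simp add: sum.delta')
qed

text \<open>
After translation by u, the partial sum minus \<Phi>(u) is the integral over [-1/2, 1/2] of \<Psi>(t) = \<Phi>(t + u) - \<Phi>(u)
against the Dirichlet kernel.  Near 0 the integrand is bounded by a multiple of |t|^(a - 1), which is integrable,
so a small neighbourhood contributes little uniformly in L; the rest tends to 0 by the
Riemann-Lebesgue lemma.
\<close>
theorem fourier_series_converges: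
  fixes \<Phi> :: "real \<Rightarrow> complex"
  assumes h: "hoelder_continuous a \<Phi>" and a: "a > 0" and per: "\<And>t. \<Phi> (t + 1) = \<Phi> t"
  shows "(\<lambda>L. \<Sum>j = - int L..int L. integral {0..1} (\<lambda>t. \<Phi> t * exp (\<i> * of_real (- 2 * pi * of_int j * t))) *
            exp (\<i> * of_real (2 * pi * of_int j * u))) \<longlonglongrightarrow> \<Phi> u"
proof -
  define \<Psi> where "\<Psi> t = \<Phi> (t + u) - \<Phi> u" for t
  define w where "w t = exp (\<i> * of_real (- 2 * pi * t)) - 1" for t :: real
  have cont\<Phi>: "continuous_on S \<Phi>" for S
    by (rule continuous_on_subset[OF hoelder_continuous_imp_continuous[OF h a]]) auto
  have cont\<Phi>u: "continuous_on S (\<lambda>t. \<Phi> (t + u))" for S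
    by (rule continuous_on_compose2[OF cont\<Phi>[of UNIV]]) (auto intro!: continuous_intros)
  have cont\<Psi>: "continuous_on S \<Psi>" for S unfolding \<Psi>_def by (intro continuous_intros cont\<Phi>u)
  have contD: "continuous_on S (dirichlet_kernel L)" for S L
    unfolding dirichlet_kernel_def by (intro continuous_intros)
  have contw: "continuous_on S w" for S unfolding w_def by (intro continuous_intros)
  obtain K0 where K0: "\<And>x y. dist (\<Phi> x) (\<Phi> y) \<le> K0 * dist x y powr a"
    using h unfolding hoelder_continuous_def by blast
  have K: "cmod (\<Psi> t) \<le> K0 * \<bar>t\<bar> powr a" for t
    using K0[of "t + u" u] by (simp add: \<Psi>_def dist_norm)
  have K0': "K0 \<ge> 0" using order.trans[OF zero_le_dist K0[of 0 1]] by (simp add: dist_norm)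

  have coeff: "integral {0..1} (\<lambda>t. \<Phi> t * exp (\<i> * of_real (- 2 * pi * of_int j * t))) * exp (\<i> * of_real (2 * pi * of_int j * u))
       = integral {-1/2..1/2} (\<lambda>t. \<Phi> (t + u) * exp (\<i> * of_real (- 2 * pi * of_int j * t)))" (is "?l = ?r") for j
  proof -
    define F where "F t = \<Phi> t * exp (\<i> * of_real (- 2 * pi * of_int j * (t - u)))" for t
    have Fp: "F (t + 1) = F t" for t
    proof -
      have "\<i> * of_real (- 2 * pi * of_int j * (t + 1 - u)) =
             \<i> * of_real (- 2 * pi * of_int j * (t - u)) + \<i> * of_real (- 2 * pi * of_int j)"
        by (simp add: algebra_simps)
      hence "exp (\<i> * of_real (- 2 * pi * of_int j * (t + 1 - u))) =
             exp (\<i> * of_real (- 2 * pi * of_int j * (t - u))) * exp (\<i> * of_real (- 2 * pi * of_int j))"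
        by (simp only: exp_add)
      thus ?thesis unfolding F_def exp_2pi_eq_1_iff[THEN iffD2, OF Ints_of_int] per by simp
    qed
    have Fc: "continuous_on S F" for S unfolding F_def by (intro continuous_intros cont\<Phi>)
    have "?l = integral {0..1} (\<lambda>t. \<Phi> t * exp (\<i> * of_real (- 2 * pi * of_int j * t)) * exp (\<i> * of_real (2 * pi * of_int j * u)))"
      by (rule integral_mult_left[symmetric])
    also have "(\<lambda>t. \<Phi> t * exp (\<i> * of_real (- 2 * pi * of_int j * t)) * exp (\<i> * of_real (2 * pi * of_int j * u))) = F"
      by (auto simp: F_def mult.assoc fun_eq_iff algebra_simps simp flip: exp_add)
    also have "integral {0..1} F = integral {u - 1/2..u - 1/2 + 1} F"
      by (rule integral_periodic_shift[OF Fc Fp, symmetric])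
    also have "\<dots> = integral {-1/2 + u..1/2 + u} F" by (simp add: algebra_simps)
    also have "\<dots> = integral {-1/2..1/2} (\<lambda>t. F (t + u))" 
      using integral_shift_real_ivl[of "- 1 / 2 + u" u "1 / 2 + u" F] by simp
    also have "\<dots> = ?r" by (simp add: F_def)
    finally show ?thesis .
  qed
  have partial: "(\<Sum>j = - int L..int L. integral {0..1} (\<lambda>t. \<Phi> t * exp (\<i> * of_real (- 2 * pi * of_int j * t))) *
            exp (\<i> * of_real (2 * pi * of_int j * u))) - \<Phi> u = integral {-1/2..1/2} (\<lambda>t. \<Psi> t * dirichlet_kernel L t)" for L
  proof -
    have "(\<Sum>j = - int L..int L. integral {0..1} (\<lambda>t. \<Phi> t * exp (\<i> * of_real (- 2 * pi * of_int j * t))) *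
            exp (\<i> * of_real (2 * pi * of_int j * u))) =
          integral {-1/2..1/2} (\<lambda>t. \<Sum>j = - int L..int L. \<Phi> (t + u) * exp (\<i> * of_real (- 2 * pi * of_int j * t)))"
      unfolding coeff by (subst integral_sum) (auto intro!: integrable_continuous_real continuous_intros cont\<Phi>u)
    also have "\<dots> = integral {-1/2..1/2} (\<lambda>t. \<Phi> (t + u) * dirichlet_kernel L t)"
      by (simp add: dirichlet_kernel_def sum_distrib_left)
    finally have eq: "(\<Sum>j = - int L..int L. integral {0..1} (\<lambda>t. \<Phi> t * exp (\<i> * of_real (- 2 * pi * of_int j * t))) *
            exp (\<i> * of_real (2 * pi * of_int j * u))) = integral {-1/2..1/2} (\<lambda>t. \<Phi> (t + u) * dirichlet_kernel L t)" .
    have "integral {-1/2..1/2} (\<lambda>t. \<Psi> t * dirichlet_kernel L t) =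
          integral {-1/2..1/2} (\<lambda>t. \<Phi> (t + u) * dirichlet_kernel L t - \<Phi> u * dirichlet_kernel L t)"
      by (simp add: \<Psi>_def algebra_simps)
    also have "\<dots> = integral {-1/2..1/2} (\<lambda>t. \<Phi> (t + u) * dirichlet_kernel L t) - integral {-1/2..1/2} (\<lambda>t. \<Phi> u * dirichlet_kernel L t)"
      by (intro integral_diff integrable_continuous_real continuous_intros cont\<Phi>u contD)
    also have "integral {-1/2..1/2} (\<lambda>t. \<Phi> u * dirichlet_kernel L t) = \<Phi> u"
      unfolding integral_mult_right integral_dirichlet_kernel by simp
    finally show ?thesis unfolding eq by simp
  qed
  have w_lower: "\<exists>\<delta>>0. \<delta> < 1/2 \<and> (\<forall>t. \<bar>t\<bar> < \<delta> \<longrightarrow> \<bar>t\<bar> \<le> cmod (w t))"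
  proof -
    have "((\<lambda>z. exp (\<i> * (- 2 * of_real pi * z))) has_field_derivative (- 2 * of_real pi * \<i>)) (at 0)"
      by (auto intro!: derivative_eq_intros)
    hence "((\<lambda>z. (exp (\<i> * (- 2 * of_real pi * z)) - 1) / z) \<longlongrightarrow> (- 2 * of_real pi * \<i>)) (at 0)"
      by (simp add: DERIV_def)
    hence "((\<lambda>z. cmod ((exp (\<i> * (- 2 * of_real pi * z)) - 1) / z)) \<longlongrightarrow> cmod (- 2 * of_real pi * \<i>)) (at 0)"
      by (rule tendsto_norm)
    moreover have "1 < cmod (- 2 * of_real pi * \<i>)" using pi_gt3 by (simp add: norm_mult)
    ultimately have "eventually (\<lambda>z. cmod ((exp (\<i> * (- 2 * of_real pi * z)) - 1) / z) > 1) (at 0)"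
      by (rule order_tendstoD(1))
    then obtain \<delta> where \<delta>: "\<delta> > 0" "\<And>z. z \<noteq> 0 \<Longrightarrow> cmod z < \<delta> \<Longrightarrow> cmod ((exp (\<i> * (- 2 * of_real pi * z)) - 1) / z) > 1"
      by (auto simp: eventually_at dist_norm)
    show ?thesis
    proof (intro exI[of _ "min \<delta> (1/4)"] conjI allI impI)
      fix t :: real assume t: "\<bar>t\<bar> < min \<delta> (1/4)"
      show "\<bar>t\<bar> \<le> cmod (w t)"
      proof (cases "t = 0")
        case False
        thus ?thesis using \<delta>(2)[of "of_real t"] t by (simp add: w_def norm_divide pos_less_divide_eq)
      qed auto
    qed (use \<delta> in auto)
  qed
  then obtain \<delta> where \<delta>: "\<delta> > 0" "\<delta> < 1/2" "\<And>t. \<bar>t\<bar> < \<delta> \<Longrightarrow> \<bar>t\<bar> \<le> cmod (w t)" by blast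
  have near: "cmod (\<Psi> t * dirichlet_kernel L t) \<le> 2 * K0 * \<bar>t\<bar> powr (a - 1)" if t: "\<bar>t\<bar> < \<delta>" for t L
  proof (cases "t = 0")
    case True
    thus ?thesis using K[of 0] a by simp
  next
    case False
    have "cmod (dirichlet_kernel L t) * \<bar>t\<bar> \<le> cmod (dirichlet_kernel L t) * cmod (w t)"
      using \<delta>(3)[OF t] by (intro mult_left_mono) auto
    also have "\<dots> = cmod (dirichlet_kernel L t * w t)" by (simp add: norm_mult)
    also have "\<dots> \<le> 1 + 1"
      unfolding w_def dirichlet_kernel_telescope
      by (intro order.trans[OF norm_triangle_ineq4 add_mono]) (simp_all only: norm_exp_i_times order.refl)
    finally have "cmod (dirichlet_kernel L t) \<le> 2 / \<bar>t\<bar>" using False by (simp add: field_simps)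
    hence "cmod (\<Psi> t * dirichlet_kernel L t) \<le> (K0 * \<bar>t\<bar> powr a) * (2 / \<bar>t\<bar>)"
      unfolding norm_mult by (intro mult_mono K) (use K0' in auto)
    also have "\<dots> = 2 * K0 * \<bar>t\<bar> powr (a - 1)" using False by (simp add: powr_diff)
    finally show ?thesis .
  qed
  have int: "(\<lambda>t. \<Psi> t * dirichlet_kernel L t) integrable_on {x..y}" for L x y
    by (intro integrable_continuous_real continuous_intros cont\<Psi> contD)
  have small: "cmod (integral {-\<epsilon>..\<epsilon>} (\<lambda>t. \<Psi> t * dirichlet_kernel L t)) \<le> 4 * K0 * (\<epsilon> powr a / a)"
    if \<epsilon>: "0 < \<epsilon>" "\<epsilon> < \<delta>" for \<epsilon> L
  proof -
    have 1: "((\<lambda>t. t powr (a - 1)) has_integral \<epsilon> powr a / a) {0..\<epsilon>}"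
      using has_integral_powr_from_0[of "a - 1" \<epsilon>] a \<epsilon> by simp
    have p: "((\<lambda>t. \<bar>t\<bar> powr (a - 1)) has_integral \<epsilon> powr a / a) {0..\<epsilon>}"
      by (rule has_integral_eq[OF _ 1]) auto
    have m: "((\<lambda>t. \<bar>t\<bar> powr (a - 1)) has_integral \<epsilon> powr a / a) {-\<epsilon>..0}"
      using has_integral_reflect_real[of "\<lambda>t. \<bar>t\<bar> powr (a - 1)" _ \<epsilon> 0] p by simp
    have "((\<lambda>t. \<bar>t\<bar> powr (a - 1)) has_integral \<epsilon> powr a / a + \<epsilon> powr a / a) {-\<epsilon>..\<epsilon>}"
      by (rule has_integral_combine[OF _ _ m p]) (use \<epsilon> in auto)
    from has_integral_mult_right[OF this, of "2 * K0"]
    have g: "((\<lambda>t. 2 * K0 * \<bar>t\<bar> powr (a - 1)) has_integral 4 * K0 * (\<epsilon> powr a / a)) {-\<epsilon>..\<epsilon>}"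
      by (simp add: algebra_simps)
    have "cmod (integral {-\<epsilon>..\<epsilon>} (\<lambda>t. \<Psi> t * dirichlet_kernel L t)) \<le> integral {-\<epsilon>..\<epsilon>} (\<lambda>t. 2 * K0 * \<bar>t\<bar> powr (a - 1))"
      using g \<epsilon> by (intro integral_norm_bound_integral int near) (auto simp: has_integral_integrable)
    also have "\<dots> = 4 * K0 * (\<epsilon> powr a / a)" using g by (rule integral_unique)
    finally show ?thesis .
  qed
  have away: "(\<lambda>L. integral {x..y} (\<lambda>t. \<Psi> t * dirichlet_kernel L t)) \<longlonglongrightarrow> 0"
    if xy: "{x..y} \<inter> \<int> = {}" for x y
  proof -
    define h where "h t = \<Psi> t / w t" for t
    have w0: "w t \<noteq> 0" if "t \<in> {x..y}" for t
      using exp_2pi_eq_1_iff[of t] xy that by (auto simp: w_def)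
    have hc: "continuous_on {x..y} h" unfolding h_def by (intro continuous_intros cont\<Psi> contw) (use w0 in auto)
    have lim: "filterlim (\<lambda>n. \<bar>c * real n + c'\<bar>) at_top sequentially" if "c \<noteq> 0" for c c'
    proof (rule filterlim_at_top_mono[of "\<lambda>n. \<bar>c\<bar> * real n + (- \<bar>c'\<bar>)"])
      show "filterlim (\<lambda>n. \<bar>c\<bar> * real n + (- \<bar>c'\<bar>)) at_top sequentially"
        using that by (intro filterlim_tendsto_add_at_top[OF tendsto_const, of _ _ "- \<bar>c'\<bar>", simplified add.commute[of "- \<bar>c'\<bar>"]]
             filterlim_tendsto_pos_mult_at_top[OF tendsto_const] filterlim_real_sequentially) auto
      show "eventually (\<lambda>n. \<bar>c\<bar> * real n + (- \<bar>c'\<bar>) \<le> \<bar>c * real n + c'\<bar>) sequentially"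
      proof (rule always_eventually, rule allI)
        fix n
        have "\<bar>c * real n\<bar> - \<bar>c'\<bar> \<le> \<bar>c * real n + c'\<bar>" by linarith
        thus "\<bar>c\<bar> * real n + (- \<bar>c'\<bar>) \<le> \<bar>c * real n + c'\<bar>" by (simp add: abs_mult)
      qed
    qed
    have "(\<lambda>L. integral {x..y} (\<lambda>t. h t * exp (\<i> * of_real ((- 2 * pi * real L + (- 2 * pi)) * t))) -
               integral {x..y} (\<lambda>t. h t * exp (\<i> * of_real ((2 * pi * real L + 0) * t)))) \<longlonglongrightarrow> 0 - 0"
      by (intro tendsto_diff riemann_lebesgue hc lim) auto
    moreover have "integral {x..y} (\<lambda>t. \<Psi> t * dirichlet_kernel L t) =
        integral {x..y} (\<lambda>t. h t * exp (\<i> * of_real ((- 2 * pi * real L + (- 2 * pi)) * t))) -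
               integral {x..y} (\<lambda>t. h t * exp (\<i> * of_real ((2 * pi * real L + 0) * t)))" for L
    proof (subst integral_diff[symmetric], goal_cases)
      case 3
      show ?case
      proof (rule integral_cong)
        fix t assume t: "t \<in> {x..y}"
        have "\<Psi> t * dirichlet_kernel L t = h t * (dirichlet_kernel L t * w t)" using w0[OF t] by (simp add: h_def)
        also have "dirichlet_kernel L t * w t = exp (\<i> * of_real ((- 2 * pi * of_nat (L + 1)) * t)) - exp (\<i> * of_real ((2 * pi * of_nat L) * t))"
          unfolding w_def by (rule dirichlet_kernel_telescope)
        also have "- 2 * pi * of_nat (L + 1) = - 2 * pi * real L + (- 2 * pi)" by (simp add: algebra_simps)
        finally show "\<Psi> t * dirichlet_kernel L t = h t * exp (\<i> * of_real ((- 2 * pi * real L + (- 2 * pi)) * t)) - h t * exp (\<i> * of_real ((2 * pi * real L + 0) * t))"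
          by (simp only: right_diff_distrib add_0_right)
      qed
    qed (intro integrable_continuous_real continuous_intros hc)+
    ultimately show ?thesis by simp
  qed
  have lim0: "(\<lambda>L. integral {-1/2..1/2} (\<lambda>t. \<Psi> t * dirichlet_kernel L t)) \<longlonglongrightarrow> 0"
  proof (rule LIMSEQ_I)
    fix e :: real assume e: "e > 0"
    have "((\<lambda>\<epsilon>. 4 * K0 * (\<epsilon> powr a / a)) \<longlongrightarrow> 4 * K0 * (0 powr a / a)) (at_right 0)"
      using a by (intro tendsto_intros tendsto_powr') (auto simp: eventually_at_filter)
    hence "((\<lambda>\<epsilon>. 4 * K0 * (\<epsilon> powr a / a)) \<longlongrightarrow> 0) (at_right 0)" using a by simp
    hence "eventually (\<lambda>\<epsilon>. 4 * K0 * (\<epsilon> powr a / a) < e / 2) (at_right 0)"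
      by (rule order_tendstoD) (use e in auto)
    moreover have "eventually (\<lambda>\<epsilon>. \<epsilon> \<in> {0<..<\<delta>}) (at_right 0)"
      using \<delta> by (intro eventually_at_right_real)
    ultimately have "eventually (\<lambda>\<epsilon>. 4 * K0 * (\<epsilon> powr a / a) < e / 2 \<and> \<epsilon> \<in> {0<..<\<delta>}) (at_right 0)"
      by (rule eventually_conj)
    then obtain \<epsilon> where \<epsilon>: "4 * K0 * (\<epsilon> powr a / a) < e / 2" "0 < \<epsilon>" "\<epsilon> < \<delta>"
      using eventually_happens'[of "at_right (0::real)"] by auto
    have "(\<lambda>L. integral {-1/2..-\<epsilon>} (\<lambda>t. \<Psi> t * dirichlet_kernel L t) + integral {\<epsilon>..1/2} (\<lambda>t. \<Psi> t * dirichlet_kernel L t)) \<longlonglongrightarrow> 0 + 0"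
    proof (intro tendsto_add away)
      have "x \<notin> \<int>" if "0 < \<bar>x\<bar>" "\<bar>x\<bar> < 1" for x :: real
        using that Ints_nonzero_abs_ge1[of x] by auto
      thus "{-1/2..-\<epsilon>} \<inter> \<int> = {}" "{\<epsilon>..1/2} \<inter> \<int> = {}" using \<epsilon> by force+
    qed
    hence "eventually (\<lambda>L. cmod (integral {-1/2..-\<epsilon>} (\<lambda>t. \<Psi> t * dirichlet_kernel L t) + integral {\<epsilon>..1/2} (\<lambda>t. \<Psi> t * dirichlet_kernel L t)) < e / 2) sequentially"
      using e by (auto simp: tendsto_iff dest!: spec[of _ "e/2"])
    then obtain n0 where n0: "\<And>L. L \<ge> n0 \<Longrightarrow> cmod (integral {-1/2..-\<epsilon>} (\<lambda>t. \<Psi> t * dirichlet_kernel L t) + integral {\<epsilon>..1/2} (\<lambda>t. \<Psi> t * dirichlet_kernel L t)) < e / 2"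
      by (auto simp: eventually_sequentially)
    show "\<exists>n0. \<forall>n\<ge>n0. norm (integral {-1/2..1/2} (\<lambda>t. \<Psi> t * dirichlet_kernel n t) - 0) < e"
    proof (intro exI allI impI)
      fix L assume L: "L \<ge> n0"
      define G where "G t = \<Psi> t * dirichlet_kernel L t" for t
      have Gi: "G integrable_on {x..y}" for x y unfolding G_def[abs_def] by (rule int)
      have "integral {-1/2..1/2} G = integral {-1/2..-\<epsilon>} G + integral {-\<epsilon>..1/2} G"
        using \<epsilon> \<delta> by (intro Henstock_Kurzweil_Integration.integral_combine[symmetric] Gi) auto
      also have "integral {-\<epsilon>..1/2} G = integral {-\<epsilon>..\<epsilon>} G + integral {\<epsilon>..1/2} G"
        using \<epsilon> \<delta> by (intro Henstock_Kurzweil_Integration.integral_combine[symmetric] Gi) auto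
      finally have "integral {-1/2..1/2} G = (integral {-1/2..-\<epsilon>} G + integral {\<epsilon>..1/2} G) + integral {-\<epsilon>..\<epsilon>} G"
        by simp
      also have "cmod \<dots> \<le> cmod (integral {-1/2..-\<epsilon>} G + integral {\<epsilon>..1/2} G) + cmod (integral {-\<epsilon>..\<epsilon>} G)"
        by (rule norm_triangle_ineq)
      also have "\<dots> < e / 2 + e / 2"
        using n0[OF L] small[OF \<epsilon>(2,3), of L] \<epsilon>(1) by (intro add_strict_mono) (auto simp: G_def[abs_def])
      finally show "norm (integral {-1/2..1/2} (\<lambda>t. \<Psi> t * dirichlet_kernel L t) - 0) < e" by (simp add: G_def[abs_def])
    qed
  qed
  from lim0[folded partial] show ?thesis by (rule LIM_zero_cancel)
qed

section \<open>Dirichlet series\<close>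

text \<open>
Summable bounds on each compact set: the criterion behind absolute and locally uniform convergence
and the holomorphy of the sum.
\<close>
definition converges_normally_on :: "(nat \<Rightarrow> complex \<Rightarrow> complex) \<Rightarrow> complex set \<Rightarrow> bool" where
  "converges_normally_on f S \<longleftrightarrow>
     (\<forall>K. compact K \<and> K \<subseteq> S \<longrightarrow> (\<exists>M. summable M \<and> (\<forall>n. \<forall>x\<in>K. cmod (f n x) \<le> M n)))"

lemma converges_normallyD:
  assumes "converges_normally_on f S"
  shows "x \<in> S \<Longrightarrow> summable (\<lambda>n. cmod (f n x))"
    and "compact K \<Longrightarrow> K \<subseteq> S \<Longrightarrow> uniform_limit K (\<lambda>N x. \<Sum>n<N. f n x) (\<lambda>x. \<Sum>n. f n x) sequentially"
proof -
  assume "x \<in> S"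
  hence "compact {x} \<and> {x} \<subseteq> S" by auto
  from assms[unfolded converges_normally_on_def, THEN spec, THEN mp, OF this]
  obtain M where M: "summable M" "\<And>n. cmod (f n x) \<le> M n" by auto
  show "summable (\<lambda>n. cmod (f n x))"
    by (rule summable_comparison_test'[OF M(1), of 0]) (use M(2) in auto)
next
  assume K: "compact K" "K \<subseteq> S"
  from assms[unfolded converges_normally_on_def, THEN spec, THEN mp, OF conjI[OF K]]
  obtain M where M: "summable M" "\<And>n x. x \<in> K \<Longrightarrow> cmod (f n x) \<le> M n" by auto
  show "uniform_limit K (\<lambda>N x. \<Sum>n<N. f n x) (\<lambda>x. \<Sum>n. f n x) sequentially"
    using M by (intro Weierstrass_m_test)
qed

lemma converges_normally_holomorphic:
  assumes "converges_normally_on f S" "open S" "\<And>n. f n holomorphic_on S"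
  shows "(\<lambda>x. \<Sum>n. f n x) holomorphic_on S"
proof (rule holomorphic_uniform_sequence[OF assms(2)])
  fix x assume x: "x \<in> S"
  obtain e where e: "e > 0" "cball x e \<subseteq> S" using assms(2) x by (auto simp: open_contains_cball)
  thus "\<exists>d>0. cball x d \<subseteq> S \<and> uniform_limit (cball x d) (\<lambda>N x. \<Sum>n<N. f n x) (\<lambda>x. \<Sum>n. f n x) sequentially"
    using converges_normallyD(2)[OF assms(1), of "cball x e"] by auto
qed (use assms(3) in \<open>auto intro!: holomorphic_intros\<close>)

lemma compact_Re_lower:
  assumes "compact K" "K \<subseteq> {s. Re s > c}"
  shows "\<exists>\<sigma>>c. \<forall>s\<in>K. Re s \<ge> \<sigma>"
proof (cases "K = {}")
  case True
  thus ?thesis by (intro exI[of _ "c + 1"]) auto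
next
  case False
  obtain x where "x \<in> K" "\<forall>y\<in>K. Re x \<le> Re y"
    using continuous_attains_inf[OF assms(1) False continuous_on_Re[OF continuous_on_id]] by blast
  thus ?thesis using assms(2) by (intro exI[of _ "Re x"]) auto
qed

definition dirichlet_summand :: "(nat \<Rightarrow> complex) \<Rightarrow> nat \<Rightarrow> complex \<Rightarrow> complex" where
  "dirichlet_summand a n s = of_nat (Suc n) powr (- s) * a (Suc n)"

definition dirichlet_series :: "(nat \<Rightarrow> complex) \<Rightarrow> complex \<Rightarrow> complex" where
  "dirichlet_series a s = (\<Sum>n. dirichlet_summand a n s)"

definition polynomially_bounded :: "real \<Rightarrow> (nat \<Rightarrow> complex) \<Rightarrow> bool" where
  "polynomially_bounded \<rho> a \<longleftrightarrow> (\<exists>K. \<forall>n\<ge>1. cmod (a n) \<le> K * real n powr \<rho>)"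

lemma norm_of_nat_powr: "n > 0 \<Longrightarrow> cmod (of_nat n powr s) = real n powr Re s"
  using norm_powr_real_powr[of "of_nat n" s] by (simp add: powr_def)

lemma dirichlet_summand_bound:
  assumes K: "\<And>n. n \<ge> 1 \<Longrightarrow> cmod (a n) \<le> K * real n powr \<rho>" and s: "Re s \<ge> \<sigma>"
  shows "cmod (dirichlet_summand a n s) \<le> K * real (Suc n) powr (\<rho> - \<sigma>)"
proof -
  have K0: "K \<ge> 0" using order.trans[OF norm_ge_zero K[of 1]] by simp
  have "cmod (dirichlet_summand a n s) = real (Suc n) powr (- Re s) * cmod (a (Suc n))"
    by (simp only: dirichlet_summand_def norm_mult norm_of_nat_powr[OF zero_less_Suc]) simp
  also have "\<dots> \<le> real (Suc n) powr (- \<sigma>) * (K * real (Suc n) powr \<rho>)"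
    using s K[of "Suc n"] K0 by (intro mult_mono powr_mono) (auto simp del: of_nat_Suc)
  also have "\<dots> = K * real (Suc n) powr (\<rho> - \<sigma>)" by (simp add: powr_diff powr_minus field_simps)
  finally show ?thesis .
qed

lemma summable_Suc_powr: "c < -1 \<Longrightarrow> summable (\<lambda>n. real (Suc n) powr c)"
  using summable_real_powr_iff[of c] by (subst summable_Suc_iff) auto

lemma dirichlet_normally:
  assumes "polynomially_bounded \<rho> a"
  shows "converges_normally_on (dirichlet_summand a) {s. Re s > \<rho> + 1}"
  unfolding converges_normally_on_def
proof (intro allI impI; elim conjE)
  fix K assume K: "compact K" "K \<subseteq> {s. Re s > \<rho> + 1}"
  obtain \<sigma> where \<sigma>: "\<sigma> > \<rho> + 1" "\<And>s. s \<in> K \<Longrightarrow> Re s \<ge> \<sigma>" using compact_Re_lower[OF K] by blast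
  obtain C where C: "\<And>n. n \<ge> 1 \<Longrightarrow> cmod (a n) \<le> C * real n powr \<rho>"
    using assms unfolding polynomially_bounded_def by blast
  show "\<exists>M. summable M \<and> (\<forall>n. \<forall>x\<in>K. cmod (dirichlet_summand a n x) \<le> M n)"
  proof (intro exI[of _ "\<lambda>n. C * real (Suc n) powr (\<rho> - \<sigma>)"] conjI allI ballI)
    show "summable (\<lambda>n. C * real (Suc n) powr (\<rho> - \<sigma>))"
      using \<sigma> by (intro summable_mult summable_Suc_powr) auto
    show "cmod (dirichlet_summand a n x) \<le> C * real (Suc n) powr (\<rho> - \<sigma>)" if "x \<in> K" for n x
      by (rule dirichlet_summand_bound[OF C \<sigma>(2)[OF that]])
  qed
qed

lemma open_Re_gt: "open {s. Re s > c}" by (rule open_halfspace_Re_gt)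

lemma dirichlet_summand_holomorphic: "dirichlet_summand a n holomorphic_on S"
  unfolding dirichlet_summand_def[abs_def] by (intro holomorphic_intros) (auto simp del: of_nat_Suc)

lemma dirichlet_series_holomorphic:
  assumes "polynomially_bounded \<rho> a"
  shows "dirichlet_series a holomorphic_on {s. Re s > \<rho> + 1}"
  unfolding dirichlet_series_def[abs_def]
  by (rule converges_normally_holomorphic[OF dirichlet_normally[OF assms] open_Re_gt dirichlet_summand_holomorphic])

lemma dirichlet_series_bounded:
  assumes "polynomially_bounded \<rho> a" "\<sigma> > \<rho> + 1"
  shows "\<exists>B\<ge>0. \<forall>s. Re s \<ge> \<sigma> \<longrightarrow> cmod (dirichlet_series a s) \<le> B"
proof -
  obtain C where C: "\<And>n. n \<ge> 1 \<Longrightarrow> cmod (a n) \<le> C * real n powr \<rho>"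
    using assms unfolding polynomially_bounded_def by blast
  define B where "B = (\<Sum>n. C * real (Suc n) powr (\<rho> - \<sigma>))"
  have "cmod (dirichlet_series a s) \<le> B" if "Re s \<ge> \<sigma>" for s
    unfolding dirichlet_series_def B_def
    using assms(2) by (intro norm_suminf_le dirichlet_summand_bound C that summable_mult summable_Suc_powr) auto
  moreover have "B \<ge> 0" using order.trans[OF norm_ge_zero calculation[of "of_real \<sigma>"]] by simp
  ultimately show ?thesis by blast
qed

definition binomial_shift :: "(complex \<Rightarrow> complex) \<Rightarrow> real \<Rightarrow> nat \<Rightarrow> complex \<Rightarrow> complex" where
  "binomial_shift D x k s = ((- s) gchoose Suc k) * of_real x ^ Suc k * D (s + of_nat (Suc k))"

text \<open>
The majorant is the coefficient of x^k in (1 - x)^(-B).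
\<close>
lemma gbinomial_bound:
  assumes "cmod s \<le> B"
  shows "cmod ((- s) gchoose k) \<le> pochhammer B k / fact k"
proof -
  have "cmod (pochhammer s k) = (\<Prod>i<k. cmod (s + of_nat i))"
    by (simp add: pochhammer_prod prod_norm atLeast0LessThan)
  also have "\<dots> \<le> (\<Prod>i<k. B + real i)"
  proof (intro prod_mono conjI)
    fix i
    show "cmod (s + of_nat i) \<le> B + real i"
      by (rule order.trans[OF norm_triangle_ineq]) (use assms in auto)
  qed auto
  also have "\<dots> = pochhammer B k" by (simp add: pochhammer_prod atLeast0LessThan)
  finally show ?thesis
    by (simp add: gbinomial_pochhammer norm_mult norm_divide norm_power divide_right_mono)
qed

lemma pochhammer_summable:
  fixes x B :: real
  assumes "0 \<le> x" "x < 1"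
  shows "summable (\<lambda>k. pochhammer B k / fact k * x ^ k)"
proof -
  have "(\<lambda>k. ((- B) gchoose k) * (- x) ^ k) sums (1 + (- x)) powr (- B)"
    using assms by (intro gen_binomial_real) auto
  also have "(\<lambda>k. ((- B) gchoose k) * (- x) ^ k) = (\<lambda>k. pochhammer B k / fact k * x ^ k)"
  proof
    fix k
    have "(-1) ^ k * (-1 :: real) ^ k = 1" by (simp flip: power_mult_distrib)
    moreover have "((- B) gchoose k) * (- x) ^ k = ((-1) ^ k * (-1) ^ k) * (pochhammer B k / fact k * x ^ k)"
      unfolding gbinomial_pochhammer power_minus[of x] by simp
    ultimately show "((- B) gchoose k) * (- x) ^ k = pochhammer B k / fact k * x ^ k" by simp
  qed
  finally show ?thesis by (rule sums_summable)
qed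

text \<open>
The arguments s + k + 1 stay in a half plane on which D is bounded, and the binomial coefficients against powers of
x < 1 are summable.  Each shift gains at least 1 in the real part, which is why the half plane of convergence is wider by 1 than
that of D.
\<close>
lemma binomial_shift_normally:
  assumes x: "0 \<le> x" "x < 1"
    and D: "\<And>\<sigma>. \<sigma> > c + 1 \<Longrightarrow> \<exists>B\<ge>0. \<forall>s. Re s \<ge> \<sigma> \<longrightarrow> cmod (D s) \<le> B"
  shows "converges_normally_on (binomial_shift D x) {s. Re s > c}"
  unfolding converges_normally_on_def
proof (intro allI impI; elim conjE)
  fix K assume K: "compact K" "K \<subseteq> {s. Re s > c}"
  obtain \<sigma> where \<sigma>: "\<sigma> > c" "\<And>s. s \<in> K \<Longrightarrow> Re s \<ge> \<sigma>" using compact_Re_lower[OF K] by blast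
  obtain B where B: "\<And>s. s \<in> K \<Longrightarrow> cmod s \<le> B" using compact_imp_bounded[OF K(1)] unfolding bounded_iff by blast
  obtain M where M: "M \<ge> 0" "\<And>s. Re s \<ge> \<sigma> + 1 \<Longrightarrow> cmod (D s) \<le> M" using D[of "\<sigma> + 1"] \<sigma> by auto
  show "\<exists>M. summable M \<and> (\<forall>n. \<forall>s\<in>K. cmod (binomial_shift D x n s) \<le> M n)"
  proof (intro exI[of _ "\<lambda>k. pochhammer B (Suc k) / fact (Suc k) * x ^ Suc k * M"] conjI allI ballI)
    show "summable (\<lambda>k. pochhammer B (Suc k) / fact (Suc k) * x ^ Suc k * M)"
      by (intro summable_mult2 summable_Suc_iff[THEN iffD2] pochhammer_summable x)
    fix k s assume s: "s \<in> K"
    have "cmod (binomial_shift D x k s) = cmod ((- s) gchoose Suc k) * x ^ Suc k * cmod (D (s + of_nat (Suc k)))"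
      using x by (simp add: binomial_shift_def norm_mult norm_power)
    also have "\<dots> \<le> pochhammer B (Suc k) / fact (Suc k) * x ^ Suc k * M"
    proof -
      have p0: "0 \<le> pochhammer B (Suc k) / fact (Suc k)"
        by (rule order.trans[OF norm_ge_zero gbinomial_bound[OF B[OF s]]])
      have "\<sigma> + 1 \<le> Re (s + of_nat (Suc k))" using \<sigma>(2)[OF s] by simp
      thus ?thesis
        using x by (intro mult_mono gbinomial_bound[OF B[OF s]] M mult_nonneg_nonneg p0 zero_le_power norm_ge_zero order.refl)
    qed
    finally show "cmod (binomial_shift D x k s) \<le> pochhammer B (Suc k) / fact (Suc k) * x ^ Suc k * M" .
  qed
qed

text \<open>
Tannery's theorem, applied to the partial sums over n as functions of k.
\<close>
lemma suminf_swap: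
  fixes f :: "nat \<Rightarrow> nat \<Rightarrow> complex"
  assumes "\<And>n k. cmod (f n k) \<le> \<beta> n * \<alpha> k" "summable \<alpha>" "summable \<beta>" "\<And>n. \<beta> n \<ge> 0" "\<And>k. \<alpha> k \<ge> 0"
  shows "(\<Sum>n. \<Sum>k. f n k) = (\<Sum>k. \<Sum>n. f n k)"
proof -
  have s1: "summable (f n)" for n
    by (rule summable_comparison_test'[OF summable_mult[OF assms(2)], of 0 _ "\<beta> n"]) (use assms in auto)
  have s2: "summable (\<lambda>n. f n k)" for k
    by (rule summable_comparison_test'[OF summable_mult2[OF assms(3)], of 0 _ "\<alpha> k"]) (use assms in auto)
  have s3: "summable (\<lambda>n. \<Sum>k. f n k)"
  proof (rule summable_comparison_test'[OF summable_mult2[OF assms(3)], of 0 _ "suminf \<alpha>"])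
    fix n
    have "cmod (\<Sum>k. f n k) \<le> (\<Sum>k. \<beta> n * \<alpha> k)"
      by (intro norm_suminf_le assms summable_mult)
    thus "norm (\<Sum>k. f n k) \<le> \<beta> n * suminf \<alpha>" by (simp add: suminf_mult assms)
  qed
  have "(\<lambda>N. \<Sum>k. \<Sum>n<N. f n k) \<longlonglongrightarrow> (\<Sum>k. \<Sum>n. f n k)"
  proof -
    have b: "cmod (\<Sum>n<N. f n k) \<le> suminf \<beta> * \<alpha> k" for k N
    proof -
      have "cmod (\<Sum>n<N. f n k) \<le> (\<Sum>n<N. \<beta> n * \<alpha> k)"
        by (intro sum_norm_le assms)
      also have "\<dots> = (\<Sum>n<N. \<beta> n) * \<alpha> k" by (simp add: sum_distrib_right)
      also have "\<dots> \<le> suminf \<beta> * \<alpha> k" using assms by (intro mult_right_mono sum_le_suminf) auto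
      finally show ?thesis .
    qed
    show ?thesis
      using tannerys_theorem[of "\<lambda>k N. \<Sum>n<N. f n k" "\<lambda>k. \<Sum>n. f n k" sequentially "\<lambda>k. suminf \<beta> * \<alpha> k"]
        summable_LIMSEQ[OF s2] summable_mult[OF assms(2)] b by (simp add: case_prod_unfold)
  qed
  moreover have "(\<lambda>N. \<Sum>k. \<Sum>n<N. f n k) = (\<lambda>N. \<Sum>n<N. \<Sum>k. f n k)"
    by (auto simp: suminf_sum s1)
  ultimately show ?thesis
    using summable_LIMSEQ[OF s3] by (metis LIMSEQ_unique)
qed

text \<open>
Binomial expansion of (1 + r / (qN))^(-s).  It converges since r < q and N \<ge> 1; this is the reason for treating n < q
separately in the functional equation.
\<close>
lemma of_nat_powr_scale:
  fixes s :: complex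
  assumes N: "N \<ge> 1" and q: "q \<ge> 1" and r: "r < q"
  shows "(\<lambda>k. of_nat q powr (- s) * (((- s) gchoose k) * of_real (real r / real q) ^ k * of_nat N powr (- (s + of_nat k))))
           sums (of_nat (q * N + r) powr (- s))"
proof -
  define z :: complex where "z = of_real (real r / (real q * real N))"
  have "real r < real q * real N" 
  proof -
    have "real r < real q * 1" using r by simp
    also have "\<dots> \<le> real q * real N" using N by (intro mult_left_mono) auto
    finally show ?thesis .
  qed
  hence z: "norm z < 1" using q N by (simp add: z_def norm_divide norm_mult)
  have "of_nat (q * N + r) = of_nat (q * N) * (1 + z)"
    using q N by (simp add: z_def field_simps)
  also have "1 + z = of_real (1 + real r / (real q * real N))" by (simp add: z_def)
  also have "(of_nat (q * N) * of_real (1 + real r / (real q * real N))) powr (- s) =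
       of_nat (q * N) powr (- s) * of_real (1 + real r / (real q * real N)) powr (- s)"
    by (rule powr_times_real) auto
  also have "of_nat (q * N) powr (- s) = of_nat q powr (- s) * of_nat N powr (- s)"
    unfolding of_nat_mult by (rule powr_times_real) auto
  also have "of_real (1 + real r / (real q * real N)) = 1 + z" by (simp add: z_def)
  finally have eq: "of_nat (q * N + r) powr (- s) = of_nat q powr (- s) * of_nat N powr (- s) * (1 + z) powr (- s)" .
  have "(\<lambda>k. ((- s) gchoose k) * z ^ k) sums (1 + z) powr (- s)"
    by (rule gen_binomial_complex[OF z])
  hence "(\<lambda>k. of_nat q powr (- s) * of_nat N powr (- s) * (((- s) gchoose k) * z ^ k)) sums (of_nat (q * N + r) powr (- s))"
    unfolding eq by (rule sums_mult)
  also have "(\<lambda>k. of_nat q powr (- s) * of_nat N powr (- s) * (((- s) gchoose k) * z ^ k)) =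
       (\<lambda>k. of_nat q powr (- s) * (((- s) gchoose k) * of_real (real r / real q) ^ k * of_nat N powr (- (s + of_nat k))))"
  proof
    fix k
    have "of_nat N powr (- (s + of_nat k)) = of_nat N powr (- s) / of_nat N ^ k"
      using N by (simp add: powr_diff diff_conv_add_uminus[symmetric] del: diff_conv_add_uminus flip: powr_complexpow)
    moreover have "z ^ k = of_real (real r / real q) ^ k / of_nat N ^ k"
      by (simp add: z_def power_divide power_mult_distrib)
    ultimately show "of_nat q powr (- s) * of_nat N powr (- s) * (((- s) gchoose k) * z ^ k) =
        of_nat q powr (- s) * (((- s) gchoose k) * of_real (real r / real q) ^ k * of_nat N powr (- (s + of_nat k)))"
      by simp
  qed
  finally show ?thesis .
qed

lemma dirichlet_residue_class:
  assumes b: "polynomially_bounded \<rho> b" and q: "q \<ge> 1" and r: "r < q" and s: "Re s > \<rho> + 1"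
  shows "summable (\<lambda>n. of_nat (q * Suc n + r) powr (- s) * b (Suc n))"
    and "(\<Sum>n. of_nat (q * Suc n + r) powr (- s) * b (Suc n)) =
         of_nat q powr (- s) * (dirichlet_series b s + (\<Sum>k. binomial_shift (dirichlet_series b) (real r / real q) k s))"
proof -
  define x where "x = real r / real q"
  have x: "0 \<le> x" "x < 1" using r q by (auto simp: x_def)
  define f where "f n k = ((- s) gchoose k) * of_real x ^ k * dirichlet_summand b n (s + of_nat k)" for n k
  obtain C where C: "\<And>n. n \<ge> 1 \<Longrightarrow> cmod (b n) \<le> C * real n powr \<rho>"
    using b unfolding polynomially_bounded_def by blast
  have C0: "C \<ge> 0" using order.trans[OF norm_ge_zero C[of 1]] by simp
  define \<alpha> where "\<alpha> k = pochhammer (cmod s) k / fact k * x ^ k" for k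
  define \<beta> where "\<beta> n = C * real (Suc n) powr (\<rho> - Re s)" for n
  have \<alpha>: "summable \<alpha>" unfolding \<alpha>_def[abs_def] by (rule pochhammer_summable[OF x])
  have \<beta>: "summable \<beta>" unfolding \<beta>_def[abs_def] using s by (intro summable_mult summable_Suc_powr) auto
  have \<alpha>0: "\<alpha> k \<ge> 0" for k
    unfolding \<alpha>_def using x by (intro mult_nonneg_nonneg order.trans[OF norm_ge_zero gbinomial_bound[of s "cmod s" k]]) auto
  have bound: "cmod (f n k) \<le> \<beta> n * \<alpha> k" for n k
  proof -
    have "cmod (f n k) = cmod ((- s) gchoose k) * x ^ k * cmod (dirichlet_summand b n (s + of_nat k))"
      using x by (simp add: f_def norm_mult norm_power)
    also have "\<dots> \<le> \<alpha> k * \<beta> n"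
      using x \<alpha>0[of k] order.trans[OF norm_ge_zero gbinomial_bound[of s "cmod s" k]] unfolding \<alpha>_def \<beta>_def
      by (intro mult_mono gbinomial_bound dirichlet_summand_bound C) auto
    finally show ?thesis by (simp add: mult.commute)
  qed
  have sk: "f n sums (of_nat (q * Suc n + r) powr (- s) * b (Suc n) / of_nat q powr (- s))" for n
  proof -
    have "(\<lambda>k. of_nat q powr (- s) * (((- s) gchoose k) * of_real x ^ k * of_nat (Suc n) powr (- (s + of_nat k))) * (b (Suc n) / of_nat q powr (- s)))
       sums (of_nat (q * Suc n + r) powr (- s) * (b (Suc n) / of_nat q powr (- s)))"
      unfolding x_def by (intro sums_mult2 of_nat_powr_scale q r) auto
    also have "(\<lambda>k. of_nat q powr (- s) * (((- s) gchoose k) * of_real x ^ k * of_nat (Suc n) powr (- (s + of_nat k))) * (b (Suc n) / of_nat q powr (- s))) = f n"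
      using q by (auto simp: f_def dirichlet_summand_def fun_eq_iff simp del: of_nat_Suc)
    finally show ?thesis by simp
  qed
  have qn: "of_nat q powr (- s) \<noteq> (0 :: complex)" using q by simp
  have sk': "(\<Sum>k. f n k) * of_nat q powr (- s) = of_nat (q * Suc n + r) powr (- s) * b (Suc n)" for n
    using sk[of n] qn by (simp add: sums_iff del: of_nat_Suc)
  have "summable (\<lambda>n. \<Sum>k. f n k)"
  proof (rule summable_comparison_test'[OF summable_mult2[OF \<beta>], of 0 _ "suminf \<alpha>"])
    fix n
    have "cmod (\<Sum>k. f n k) \<le> (\<Sum>k. \<beta> n * \<alpha> k)"
      by (intro norm_suminf_le bound summable_mult \<alpha>)
    thus "norm (\<Sum>k. f n k) \<le> \<beta> n * suminf \<alpha>" by (simp add: suminf_mult \<alpha>)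
  qed
  from summable_mult2[OF this, of "of_nat q powr (- s)"]
  show "summable (\<lambda>n. of_nat (q * Suc n + r) powr (- s) * b (Suc n))"
    unfolding sk' .
  have "(\<Sum>n. of_nat (q * Suc n + r) powr (- s) * b (Suc n)) = (\<Sum>n. (\<Sum>k. f n k) * of_nat q powr (- s))"
    unfolding sk' ..
  also have "\<dots> = (\<Sum>n. \<Sum>k. f n k) * of_nat q powr (- s)"
    by (rule suminf_mult2[symmetric]) fact
  also have "(\<Sum>n. \<Sum>k. f n k) = (\<Sum>k. \<Sum>n. f n k)"
    using C0 by (intro suminf_swap[OF bound \<alpha> \<beta>] \<alpha>0) (auto simp: \<beta>_def)
  also have "(\<lambda>k. \<Sum>n. f n k) = (\<lambda>k. ((- s) gchoose k) * of_real x ^ k * dirichlet_series b (s + of_nat k))"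
  proof
    fix k
    have "s + of_nat k \<in> {s. Re s > \<rho> + 1}" using s by auto
    from converges_normallyD(1)[OF dirichlet_normally[OF b] this]
    have "summable (\<lambda>n. dirichlet_summand b n (s + of_nat k))" by (rule summable_norm_cancel)
    thus "(\<Sum>n. f n k) = ((- s) gchoose k) * of_real x ^ k * dirichlet_series b (s + of_nat k)"
      unfolding f_def dirichlet_series_def by (rule suminf_mult)
  qed
  also have "(\<Sum>k. ((- s) gchoose k) * of_real x ^ k * dirichlet_series b (s + of_nat k)) =
       dirichlet_series b s + (\<Sum>k. binomial_shift (dirichlet_series b) x k s)"
  proof -
    have "s \<in> {s. Re s > \<rho>}" using s by auto
    from converges_normallyD(1)[OF binomial_shift_normally[OF x dirichlet_series_bounded[OF b]] this]
    have "summable (\<lambda>k. binomial_shift (dirichlet_series b) x k s)" by (rule summable_norm_cancel)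
    hence "summable (\<lambda>k. ((- s) gchoose (Suc k)) * of_real x ^ (Suc k) * dirichlet_series b (s + of_nat (Suc k)))"
      by (simp only: binomial_shift_def)
    hence "summable (\<lambda>k. ((- s) gchoose k) * of_real x ^ k * dirichlet_series b (s + of_nat k))"
      by (subst (asm) summable_Suc_iff)
    from suminf_split_head[OF this] show ?thesis by (simp add: binomial_shift_def)
  qed
  finally show "(\<Sum>n. of_nat (q * Suc n + r) powr (- s) * b (Suc n)) =
         of_nat q powr (- s) * (dirichlet_series b s + (\<Sum>k. binomial_shift (dirichlet_series b) (real r / real q) k s))"
    by (simp add: x_def)
qed

text \<open>
Grouping the terms by blocks of length q; the block of n = 0 gives the finite sum.
\<close>
theorem dirichlet_functional_equation:
  assumes W: "polynomially_bounded \<rho> W" and b: "\<And>r. r < q \<Longrightarrow> polynomially_bounded \<rho> (b r)"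
    and rec: "\<And>n r. r < q \<Longrightarrow> W (q * n + r) = b r n" and q: "q \<ge> 1" and s: "Re s > \<rho> + 1"
  shows "dirichlet_series W s = (\<Sum>n=1..<q. of_nat n powr (- s) * W n) +
     of_nat q powr (- s) * (\<Sum>r<q. dirichlet_series (b r) s + (\<Sum>k. binomial_shift (dirichlet_series (b r)) (real r / real q) k s))"
proof -
  define f where "f n = of_nat n powr (- s) * W n" for n
  have "s \<in> {s. Re s > \<rho> + 1}" using s by auto
  from converges_normallyD(1)[OF dirichlet_normally[OF W] this]
  have "summable (\<lambda>n. dirichlet_summand W n s)" by (rule summable_norm_cancel)
  hence "(\<lambda>n. f (Suc n)) sums dirichlet_series W s"
    by (simp add: f_def dirichlet_series_def dirichlet_summand_def summable_sums del: of_nat_Suc)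
  hence "f sums dirichlet_series W s" by (subst (asm) sums_Suc_iff) (simp add: f_def)
  from sums_group[OF this, of q]
  have gr: "(\<lambda>n. sum f {n * q..<n * q + q}) sums dirichlet_series W s" using q by simp
  define g where "g n = (\<Sum>r<q. f (q * n + r))" for n
  have blk: "sum f {n * q..<n * q + q} = g n" for n
    using sum.shift_bounds_nat_ivl[of f 0 "n * q" q] by (simp add: g_def atLeast0LessThan add_ac mult_ac)
  have "g sums dirichlet_series W s" using gr by (simp only: blk)
  hence "dirichlet_series W s = g 0 + (\<Sum>n. g (Suc n))"
    using suminf_split_head[of g] by (simp add: sums_iff)
  hence "dirichlet_series W s = (\<Sum>r<q. f r) + (\<Sum>n. \<Sum>r<q. f (q * Suc n + r))"
    by (simp add: g_def)
  also have "(\<Sum>n. \<Sum>r<q. f (q * Suc n + r)) = (\<Sum>n. \<Sum>r<q. of_nat (q * Suc n + r) powr (- s) * b r (Suc n))"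
    by (intro suminf_cong sum.cong refl) (simp add: f_def rec del: mult_Suc_right of_nat_add of_nat_mult)
  also have "\<dots> = (\<Sum>r<q. \<Sum>n. of_nat (q * Suc n + r) powr (- s) * b r (Suc n))"
    by (intro suminf_sum dirichlet_residue_class(1)[OF b q _ s]) auto
  also have "\<dots> = (\<Sum>r<q. of_nat q powr (- s) * (dirichlet_series (b r) s + (\<Sum>k. binomial_shift (dirichlet_series (b r)) (real r / real q) k s)))"
    by (intro sum.cong refl dirichlet_residue_class(2)[OF b q _ s]) auto
  also have "(\<Sum>r<q. f r) = (\<Sum>n=1..<q. f n)"
    by (intro sum.mono_neutral_right) (auto simp: f_def not_less_eq_eq)
  finally show ?thesis by (simp only: f_def sum_distrib_left)
qed

section \<open>Laplace transforms of periodic functions\<close>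

text \<open>
For a 1-periodic function \<Phi>, the Laplace transform of \<Phi> is this quotient: the geometric series over the periods gives
1 / (1 - exp (-z)).  The formula also defines its meromorphic continuation.
\<close>
definition laplace_period :: "(real \<Rightarrow> complex) \<Rightarrow> complex \<Rightarrow> complex" where
  "laplace_period \<Phi> z = integral {0..1} (\<lambda>t. \<Phi> t * exp (- z * of_real t)) / (1 - exp (- z))"

text \<open>
The part of the Laplace transform of t^k \<Phi>(t) that belongs to the period from L to L + 1.
\<close>
definition laplace_block :: "(real \<Rightarrow> complex) \<Rightarrow> nat \<Rightarrow> nat \<Rightarrow> complex \<Rightarrow> complex" where
  "laplace_block \<Phi> k L z = integral {real L..real L + 1} (\<lambda>t. of_real t ^ k * \<Phi> t * exp (- z * of_real t))"

lemma integral_exp_deriv: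
  fixes f :: "real \<Rightarrow> complex" and L :: "real \<Rightarrow> real"
  assumes f: "continuous_on {a..b} f" and L: "continuous_on {a..b} L"
  shows "((\<lambda>z. integral {a..b} (\<lambda>t. f t * exp (- z * of_real (L t)))) has_field_derivative
           - integral {a..b} (\<lambda>t. of_real (L t) * f t * exp (- z * of_real (L t)))) (at z)"
proof -
  have "((\<lambda>z. integral (cbox a b) (\<lambda>t. f t * exp (- z * of_real (L t)))) has_field_derivative
           integral (cbox a b) (\<lambda>t. - (of_real (L t) * f t * exp (- z * of_real (L t))))) (at z within UNIV)"
  proof (rule leibniz_rule_field_derivative)
    show "((\<lambda>z. f t * exp (- z * of_real (L t))) has_field_derivative - (of_real (L t) * f t * exp (- x * of_real (L t)))) (at x within UNIV)" for x t
      by (auto intro!: derivative_eq_intros)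
    show "(\<lambda>t. f t * exp (- x * of_real (L t))) integrable_on cbox a b" for x
      using f L by (intro integrable_continuous continuous_intros) auto
    have "continuous_on (UNIV \<times> cbox a b) (\<lambda>x. f (snd x))" "continuous_on (UNIV \<times> cbox a b) (\<lambda>x. L (snd x))"
      by (intro continuous_on_compose2[OF f] continuous_on_compose2[OF L]; auto intro!: continuous_intros)+
    thus "continuous_on (UNIV \<times> cbox a b) (\<lambda>(x, t). - (of_real (L t) * f t * exp (- x * of_real (L t))))"
      unfolding case_prod_unfold by (intro continuous_intros)
  qed auto
  thus ?thesis by simp
qed

lemma laplace_block_deriv:
  assumes "continuous_on UNIV \<Phi>"
  shows "(laplace_block \<Phi> k L has_field_derivative - laplace_block \<Phi> (Suc k) L z) (at z)"
proof -
  have "continuous_on S \<Phi>" for S by (rule continuous_on_subset[OF assms]) auto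
  hence "continuous_on {real L..real L + 1} (\<lambda>t. of_real t ^ k * \<Phi> t)" by (intro continuous_intros)
  from integral_exp_deriv[OF this continuous_on_id, of z] show ?thesis
    unfolding laplace_block_def[abs_def] by (simp add: mult_ac)
qed

lemma laplace_period_holomorphic:
  assumes "continuous_on UNIV \<Phi>"
  shows "laplace_period \<Phi> holomorphic_on {z. exp z \<noteq> 1}"
proof -
  have "continuous_on {0..1} \<Phi>" by (rule continuous_on_subset[OF assms]) auto
  from integral_exp_deriv[OF this continuous_on_id]
  have "(\<lambda>z. integral {0..1} (\<lambda>t. \<Phi> t * exp (- z * of_real t))) holomorphic_on S" for S
    by (auto simp: holomorphic_on_def field_differentiable_def intro: DERIV_subset)
  moreover have "1 - exp (- z) \<noteq> 0" if "exp z \<noteq> 1" for z :: complex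
    using that by (auto simp: exp_minus)
  ultimately show ?thesis unfolding laplace_period_def[abs_def]
    by (intro holomorphic_intros) auto
qed

lemma open_exp_neq_1: "open {z :: complex. exp z \<noteq> 1}"
  by (intro open_Collect_neq continuous_intros)

lemma higher_deriv_laplace_holomorphic:
  assumes "continuous_on UNIV \<Phi>"
  shows "(deriv ^^ k) (laplace_period \<Phi>) holomorphic_on {z. exp z \<noteq> 1}"
  by (intro holomorphic_higher_deriv laplace_period_holomorphic assms open_exp_neq_1)

lemma laplace_period_meromorphic:
  assumes "continuous_on UNIV \<Phi>"
  shows "laplace_period \<Phi> meromorphic_on UNIV"
proof -
  have "continuous_on {0..1} \<Phi>" by (rule continuous_on_subset[OF assms]) auto
  from integral_exp_deriv[OF this continuous_on_id]
  have "(\<lambda>z. integral {0..1} (\<lambda>t. \<Phi> t * exp (- z * of_real t))) holomorphic_on UNIV"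
    by (auto simp: holomorphic_on_def field_differentiable_def)
  hence "(\<lambda>z. integral {0..1} (\<lambda>t. \<Phi> t * exp (- z * of_real t))) analytic_on UNIV"
    by (simp add: analytic_on_open)
  moreover have "(\<lambda>z. 1 - exp (- z)) analytic_on (UNIV :: complex set)" by (intro analytic_intros)
  ultimately show ?thesis unfolding laplace_period_def[abs_def]
    by (intro meromorphic_on_divide analytic_on_imp_meromorphic_on)
qed

lemma power_le_fact_exp:
  fixes x c :: real
  assumes "x \<ge> 0" "c > 0"
  shows "x ^ k \<le> fact k / c ^ k * exp (c * x)"
proof -
  have "(\<Sum>n\<in>{k}. (c * x) ^ n /\<^sub>R fact n) \<le> (\<Sum>n. (c * x) ^ n /\<^sub>R fact n)"
    using assms by (intro sum_le_suminf[OF summable_exp_generic]) auto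
  hence "(c * x) ^ k / fact k \<le> exp (c * x)" by (simp add: exp_def divide_inverse mult.commute)
  hence "c ^ k * x ^ k \<le> fact k * exp (c * x)" by (simp add: field_simps power_mult_distrib)
  thus ?thesis using assms by (simp add: field_simps)
qed

text \<open>
One half of the exponential decay absorbs the factor t^k.
\<close>
lemma laplace_block_bound:
  assumes c: "continuous_on UNIV \<Phi>" and M: "\<And>t. cmod (\<Phi> t) \<le> M" and \<sigma>: "\<sigma> > 0" and z: "Re z \<ge> \<sigma>"
  shows "cmod (laplace_block \<Phi> k L z) \<le> fact k / (\<sigma> / 2) ^ k * M * exp (- \<sigma> / 2) ^ L"
proof -
  have cont: "continuous_on S \<Phi>" for S by (rule continuous_on_subset[OF c]) auto
  have M0: "M \<ge> 0" using order.trans[OF norm_ge_zero M] .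
  have "cmod (laplace_block \<Phi> k L z) \<le> fact k / (\<sigma> / 2) ^ k * M * exp (- \<sigma> / 2) ^ L * (real L + 1 - real L)"
    unfolding laplace_block_def
  proof (rule integral_bound)
    show "continuous_on {real L..real L + 1} (\<lambda>t. of_real t ^ k * \<Phi> t * exp (- z * of_real t))"
      by (intro continuous_intros cont)
    fix t assume t: "t \<in> {real L..real L + 1}"
    have "cmod (of_real t ^ k * \<Phi> t * exp (- z * of_real t)) = t ^ k * cmod (\<Phi> t) * exp (- (Re z * t))"
      using t by (simp add: norm_mult norm_power)
    also have "\<dots> \<le> (fact k / (\<sigma> / 2) ^ k * exp (\<sigma> / 2 * t)) * M * exp (- (\<sigma> * t))"
      using t z \<sigma> M M0 by (intro mult_mono power_le_fact_exp) (auto intro!: mult_right_mono)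
    also have "\<dots> = fact k / (\<sigma> / 2) ^ k * M * (exp (\<sigma> / 2 * t) * exp (- (\<sigma> * t)))" by simp
    also have "\<dots> \<le> fact k / (\<sigma> / 2) ^ k * M * exp (- \<sigma> / 2) ^ L"
    proof (intro mult_left_mono)
      have "exp (\<sigma> / 2 * t) * exp (- (\<sigma> * t)) = exp (- (\<sigma> / 2 * t))"
        by (simp flip: exp_add)
      also have "\<dots> \<le> exp (- (\<sigma> / 2 * real L))"
        using t \<sigma> by (auto intro!: mult_left_mono)
      also have "\<dots> = exp (- \<sigma> / 2) ^ L" by (simp flip: exp_of_nat_mult add: mult_ac)
      finally show "exp (\<sigma> / 2 * t) * exp (- (\<sigma> * t)) \<le> exp (- \<sigma> / 2) ^ L" .
    qed (use M0 \<sigma> in auto)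
    finally show "cmod (of_real t ^ k * \<Phi> t * exp (- z * of_real t)) \<le> fact k / (\<sigma> / 2) ^ k * M * exp (- \<sigma> / 2) ^ L" .
  qed auto
  thus ?thesis by simp
qed

lemma laplace_block_periodic:
  assumes c: "continuous_on UNIV \<Phi>" and per: "\<And>t. \<Phi> (t + 1) = \<Phi> t"
  shows "laplace_block \<Phi> 0 L z = exp (- z) ^ L * integral {0..1} (\<lambda>t. \<Phi> t * exp (- z * of_real t))"
proof -
  have per': "\<Phi> (t + real L) = \<Phi> t" for t
  proof (induction L)
    case (Suc L)
    thus ?case using per[of "t + real L"] by (simp add: add_ac)
  qed auto
  have "laplace_block \<Phi> 0 L z = integral {0..1} (\<lambda>t. \<Phi> (t + real L) * exp (- z * of_real (t + real L)))"
    using integral_shift_real_ivl[of "real L" "real L" "real L + 1" "\<lambda>t. \<Phi> t * exp (- z * of_real t)"]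
    by (simp add: laplace_block_def)
  also have "(\<lambda>t. \<Phi> (t + real L) * exp (- z * of_real (t + real L))) = (\<lambda>t. exp (- z) ^ L * (\<Phi> t * exp (- z * of_real t)))"
  proof
    fix t
    have "exp (- z * of_real (t + real L)) = exp (- z) ^ L * exp (- z * of_real t)"
      by (simp add: ring_distribs exp_diff exp_minus divide_inverse flip: exp_of_nat_mult) (simp add: mult_ac flip: exp_minus exp_of_nat_mult)
    thus "\<Phi> (t + real L) * exp (- z * of_real (t + real L)) = exp (- z) ^ L * (\<Phi> t * exp (- z * of_real t))"
      by (simp add: per')
  qed
  finally show ?thesis by simp
qed

text \<open>
Differentiating the Laplace transform of \<Phi> k times produces the factor (-t)^k; the series over the periods converges
locally uniformly, so it may be differentiated term by term.
\<close>
theorem laplace_block_sums: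
  assumes c: "continuous_on UNIV \<Phi>" and per: "\<And>t. \<Phi> (t + 1) = \<Phi> t" and M: "\<And>t. cmod (\<Phi> t) \<le> M"
    and z: "Re z > 0"
  shows "(\<lambda>L. (-1) ^ k * laplace_block \<Phi> k L z) sums (deriv ^^ k) (laplace_period \<Phi>) z"
  using z
proof (induction k arbitrary: z)
  case 0
  have "norm (exp (- z)) < 1" using 0 by simp
  from sums_mult2[OF geometric_sums[OF this], of "integral {0..1} (\<lambda>t. \<Phi> t * exp (- z * of_real t))"]
  show ?case by (simp add: laplace_block_periodic[OF c per] laplace_period_def)
next
  case (Suc k)
  define H where "H = {z. Re z > 0}"
  define g where "g = (deriv ^^ k) (laplace_period \<Phi>)"
  have H: "open H" by (simp add: H_def open_halfspace_Re_gt)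
  have "\<exists>g'. \<forall>x\<in>H. (g has_field_derivative g' x) (at x) \<and>
           (\<lambda>n. \<Sum>L<n. (-1) ^ k * - laplace_block \<Phi> (Suc k) L x) \<longlonglongrightarrow> g' x"
  proof (rule has_complex_derivative_uniform_sequence[OF H, where f = "\<lambda>n x. \<Sum>L<n. (-1) ^ k * laplace_block \<Phi> k L x"])
    show "((\<lambda>x. \<Sum>L<n. (-1) ^ k * laplace_block \<Phi> k L x) has_field_derivative
            (\<Sum>L<n. (-1) ^ k * - laplace_block \<Phi> (Suc k) L x)) (at x)" for n x
      by (intro DERIV_sum DERIV_cmult laplace_block_deriv c)
    fix x assume x: "x \<in> H"
    define \<sigma> where "\<sigma> = Re x / 2"
    have \<sigma>: "\<sigma> > 0" using x by (simp add: \<sigma>_def H_def)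
    have Re: "Re y \<ge> \<sigma>" if "y \<in> cball x \<sigma>" for y
      using abs_Re_le_cmod[of "x - y"] that by (auto simp: \<sigma>_def dist_norm abs_if split: if_splits)
    have "uniform_limit (cball x \<sigma>) (\<lambda>n y. \<Sum>L<n. (-1) ^ k * laplace_block \<Phi> k L y) (\<lambda>y. \<Sum>L. (-1) ^ k * laplace_block \<Phi> k L y) sequentially"
    proof (rule Weierstrass_m_test)
      show "norm ((-1) ^ k * laplace_block \<Phi> k L y) \<le> fact k / (\<sigma> / 2) ^ k * M * exp (- \<sigma> / 2) ^ L"
        if "y \<in> cball x \<sigma>" for L y
        using laplace_block_bound[OF c M \<sigma> Re[OF that]] by (simp add: norm_mult norm_power)
      show "summable (\<lambda>L. fact k / (\<sigma> / 2) ^ k * M * exp (- \<sigma> / 2) ^ L)"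
        using \<sigma> by (intro summable_mult summable_geometric) auto
    qed
    moreover have "(\<Sum>L. (-1) ^ k * laplace_block \<Phi> k L y) = g y" if "y \<in> cball x \<sigma>" for y
      using Suc.IH[of y] Re[OF that] \<sigma> by (simp add: g_def sums_iff)
    ultimately have "uniform_limit (cball x \<sigma>) (\<lambda>n y. \<Sum>L<n. (-1) ^ k * laplace_block \<Phi> k L y) g sequentially"
      by (subst uniform_limit_cong'[of "cball x \<sigma>" _ _ _ "\<lambda>y. \<Sum>L. (-1) ^ k * laplace_block \<Phi> k L y"]) auto
    moreover have "cball x \<sigma> \<subseteq> H" using Re \<sigma> by (force simp: H_def)
    ultimately show "\<exists>d>0. cball x d \<subseteq> H \<and> uniform_limit (cball x d) (\<lambda>n y. \<Sum>L<n. (-1) ^ k * laplace_block \<Phi> k L y) g sequentially"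
      using \<sigma> by blast
  qed
  then obtain g' where g': "(g has_field_derivative g' z) (at z)"
      "(\<lambda>n. \<Sum>L<n. (-1) ^ k * - laplace_block \<Phi> (Suc k) L z) \<longlonglongrightarrow> g' z"
    using Suc.prems by (auto simp: H_def)
  have "g' z = (deriv ^^ Suc k) (laplace_period \<Phi>) z"
    using DERIV_imp_deriv[OF g'(1)] by (simp add: g_def)
  with g'(2) show ?case by (simp add: sums_def)
qed

text \<open>
Near a point z0 with exp z0 = 1 the denominator has a simple zero with derivative 1, hence the transform is C / (z - z0) plus a
holomorphic function; this can be differentiated.
\<close>
lemma laplace_period_polar_part:
  assumes c: "continuous_on UNIV \<Phi>" and z0: "exp z0 = 1"
  defines "C \<equiv> integral {0..1} (\<lambda>t. \<Phi> t * exp (- z0 * of_real t))"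
  obtains u where "u holomorphic_on ball z0 1"
    "\<And>z j. z \<in> ball z0 1 - {z0} \<Longrightarrow> (deriv ^^ j) (laplace_period \<Phi>) z = (-1) ^ j * fact j * C / (z - z0) ^ Suc j + (deriv ^^ j) u z"
proof -
  define h where "h = laplace_period \<Phi>"
  \<comment> \<open>Distinct solutions of exp z = 1 differ by at least 2 \<pi>, so the unit ball contains no other one.\<close>
  have ne: "exp z \<noteq> 1" if z: "z \<in> ball z0 1 - {z0}" for z
  proof
    assume "exp z = 1"
    hence "exp (z - z0) = 1" using z0 by (simp add: exp_diff)
    then obtain n :: int where n: "Re (z - z0) = 0" "Im (z - z0) = of_int (2 * n) * pi" unfolding exp_eq_1 by blast
    have "\<bar>Im (z - z0)\<bar> < 1" using abs_Im_le_cmod[of "z - z0"] z by (simp add: dist_norm norm_minus_commute)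
    hence "\<bar>of_int (2 * n)\<bar> * pi < 1" using n by (simp add: abs_mult)
    moreover have "1 * 1 \<le> \<bar>of_int (2 * n)\<bar> * pi" if "n \<noteq> 0"
      using that pi_gt3 by (intro mult_mono) linarith+
    ultimately have "n = 0" by force
    hence "z = z0" using n by (simp add: complex_eq_iff)
    thus False using z by simp
  qed
  have hol: "h holomorphic_on ball z0 1 - {z0}"
    unfolding h_def by (rule holomorphic_on_subset[OF laplace_period_holomorphic[OF c]]) (use ne in auto)
  have "continuous_on {0..1} \<Phi>" by (rule continuous_on_subset[OF c]) auto
  from DERIV_isCont[OF integral_exp_deriv[OF this continuous_on_id, of z0]]
  have I: "((\<lambda>z. integral {0..1} (\<lambda>t. \<Phi> t * exp (- z * of_real t))) \<longlongrightarrow> C) (at z0)"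
    by (simp add: isCont_def C_def)
  have "((\<lambda>z. 1 - exp (- z)) has_field_derivative exp (- z0)) (at z0)" by (auto intro!: derivative_eq_intros)
  hence "((\<lambda>z. (1 - exp (- z)) / (z - z0)) \<longlongrightarrow> 1) (at z0)"
    using z0 by (simp add: has_field_derivative_iff exp_minus)
  from tendsto_divide[OF I this]
  have lim: "((\<lambda>z. (z - z0) * h z) \<longlongrightarrow> C) (at z0)"
    by (simp add: h_def laplace_period_def[abs_def] mult_ac)
  define p where "p = (\<lambda>z. if z = z0 then C else (z - z0) * h z)"
  have p: "p holomorphic_on ball z0 1"
    unfolding p_def by (rule removable_singularity[OF _ _ lim]) (auto intro!: holomorphic_intros hol)
  define u where "u = (\<lambda>z. if z = z0 then deriv p z0 else (p z - p z0) / (z - z0))"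
  have u: "u holomorphic_on ball z0 1"
    unfolding u_def by (rule pole_lemma_open[OF p]) auto
  show ?thesis
  proof (rule that[OF u])
    fix z j assume "z \<in> ball z0 1 - {z0}"
    thus "(deriv ^^ j) (laplace_period \<Phi>) z = (-1) ^ j * fact j * C / (z - z0) ^ Suc j + (deriv ^^ j) u z"
    proof (induction j arbitrary: z)
      case 0
      hence "z \<noteq> z0" by auto
      thus ?case by (simp add: u_def p_def h_def diff_divide_distrib)
    next
      case (Suc j)
      have op: "open (ball z0 1 - {z0})" by auto
      have z: "z - z0 \<noteq> 0" "z \<in> ball z0 1" using Suc.prems by auto
      have "((deriv ^^ j) u) holomorphic_on ball z0 1" by (intro holomorphic_intros u) auto
      hence du: "((deriv ^^ j) u has_field_derivative (deriv ^^ Suc j) u z) (at z)"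
        using z by (simp add: holomorphic_derivI)
      have "deriv ((deriv ^^ j) (laplace_period \<Phi>)) z =
            deriv (\<lambda>z. (-1) ^ j * fact j * C / (z - z0) ^ Suc j + (deriv ^^ j) u z) z"
        by (intro deriv_cong_ev refl eventually_mono[OF eventually_nhds_in_open[OF op Suc.prems]] Suc.IH)
      also have "\<dots> = (-1) ^ Suc j * fact (Suc j) * C / (z - z0) ^ Suc (Suc j) + (deriv ^^ Suc j) u z"
      proof (intro DERIV_imp_deriv DERIV_add du)
        have aux: "((-1) ^ j * fact j * C) * - (inverse (w ^ Suc j) * (of_nat (Suc j) * w ^ j) * inverse (w ^ Suc j)) =
                (-1) ^ Suc j * fact (Suc j) * C / w ^ Suc (Suc j)" if "w \<noteq> 0" for w
          using that by (simp add: field_simps)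
        have d1: "((\<lambda>z. z - z0) has_field_derivative 1) (at z)" by (auto intro!: derivative_eq_intros)
        have "((\<lambda>z. (z - z0) ^ Suc j) has_field_derivative of_nat (Suc j) * (z - z0) ^ j) (at z)"
          using DERIV_power[OF d1, of "Suc j"] by (simp only: diff_Suc_Suc diff_zero One_nat_def mult_1_left)
        from DERIV_cmult[OF DERIV_inverse_fun[OF this], of "(-1) ^ j * fact j * C"] z
        have "((\<lambda>z. ((-1) ^ j * fact j * C) * inverse ((z - z0) ^ Suc j)) has_field_derivative
                ((-1) ^ j * fact j * C) * - (inverse ((z - z0) ^ Suc j) * (of_nat (Suc j) * (z - z0) ^ j) * inverse ((z - z0) ^ Suc j))) (at z)"
          by (simp add: mult_ac)
        also have "((-1) ^ j * fact j * C) * - (inverse ((z - z0) ^ Suc j) * (of_nat (Suc j) * (z - z0) ^ j) * inverse ((z - z0) ^ Suc j)) =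
                (-1) ^ Suc j * fact (Suc j) * C / (z - z0) ^ Suc (Suc j)"
          using aux z(1) by blast
        finally show "((\<lambda>z. (-1) ^ j * fact j * C / (z - z0) ^ Suc j) has_field_derivative
             (-1) ^ Suc j * fact (Suc j) * C / (z - z0) ^ Suc (Suc j)) (at z)"
          by (simp only: divide_inverse)
      qed
      finally show ?case by simp
    qed
  qed
qed

text \<open>
Multiplication by (s - s0)^k turns b k into the coefficient of 1 / (s - s0).
\<close>
lemma residue_polar_sum:
  assumes k: "k < m" and u: "u analytic_on {s0}"
    and ev: "eventually (\<lambda>s. f s = (\<Sum>j<m. b j / (s - s0) ^ Suc j) + u s) (at s0)"
  shows "residue (\<lambda>s. f s * (s - s0) ^ k) s0 = b k"
proof -
  obtain r where r: "r > 0" "u holomorphic_on ball s0 r"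
    using u by (auto simp: analytic_on_def)
  have tm: "residue (\<lambda>s. b j / (s - s0) ^ Suc j * (s - s0) ^ k) s0 = (if j = k then b k else 0)" for j
  proof (cases "j < k")
    case True
    have "residue (\<lambda>s. b j / (s - s0) ^ Suc j * (s - s0) ^ k) s0 = residue (\<lambda>s. b j * (s - s0) ^ (k - Suc j)) s0"
    proof (intro residue_cong refl eventually_mono[OF eventually_neq_at_within[of s0]])
      fix s assume s: "s \<noteq> s0"
      have "(s - s0) ^ k = (s - s0) ^ Suc j * (s - s0) ^ (k - Suc j)"
        using True by (subst power_add[symmetric]) simp
      thus "b j / (s - s0) ^ Suc j * (s - s0) ^ k = b j * (s - s0) ^ (k - Suc j)"
        using s by simp
    qed
    also have "\<dots> = 0" by (rule residue_holo[of UNIV]) (auto intro!: holomorphic_intros)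
    finally show ?thesis using True by simp
  next
    case False
    have "residue (\<lambda>s. b j / (s - s0) ^ Suc j * (s - s0) ^ k) s0 = residue (\<lambda>s. b j / (s - s0) ^ Suc (j - k)) s0"
    proof (intro residue_cong refl eventually_mono[OF eventually_neq_at_within[of s0]])
      fix s assume s: "s \<noteq> s0"
      have "(s - s0) ^ Suc j = (s - s0) ^ Suc (j - k) * (s - s0) ^ k"
        using False by (subst power_add[symmetric]) simp
      thus "b j / (s - s0) ^ Suc j * (s - s0) ^ k = b j / (s - s0) ^ Suc (j - k)"
        using s by simp
    qed
    also have "\<dots> = (deriv ^^ (j - k)) (\<lambda>_. b j) s0 / fact (j - k)"
      by (rule residue_holomorphic_over_power[of UNIV]) auto
    finally show ?thesis using False by auto
  qed
  have hol: "(\<lambda>s. b j / (s - s0) ^ Suc j * (s - s0) ^ k) holomorphic_on ball s0 r - {s0}" for j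
    by (intro holomorphic_intros) auto
  have sum: "residue (\<lambda>s. \<Sum>j\<in>J. b j / (s - s0) ^ Suc j * (s - s0) ^ k) s0 = (\<Sum>j\<in>J. if j = k then b k else 0)"
    if "finite J" for J
    using that
  proof (induction J rule: finite_induct)
    case empty
    show ?case by (simp add: residue_const)
  next
    case (insert j J)
    have "residue (\<lambda>s. b j / (s - s0) ^ Suc j * (s - s0) ^ k + (\<Sum>j\<in>J. b j / (s - s0) ^ Suc j * (s - s0) ^ k)) s0
       = residue (\<lambda>s. b j / (s - s0) ^ Suc j * (s - s0) ^ k) s0 + residue (\<lambda>s. \<Sum>j\<in>J. b j / (s - s0) ^ Suc j * (s - s0) ^ k) s0"
      using r by (intro residue_add[of "ball s0 r"] hol holomorphic_on_sum) auto
    thus ?case unfolding sum.insert[OF insert.hyps] tm insert.IH by simp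
  qed
  have "residue (\<lambda>s. f s * (s - s0) ^ k) s0 =
        residue (\<lambda>s. (\<Sum>j<m. b j / (s - s0) ^ Suc j * (s - s0) ^ k) + u s * (s - s0) ^ k) s0"
    by (intro residue_cong refl eventually_mono[OF ev]) (simp add: distrib_right sum_distrib_right)
  also have "\<dots> = residue (\<lambda>s. \<Sum>j<m. b j / (s - s0) ^ Suc j * (s - s0) ^ k) s0 + residue (\<lambda>s. u s * (s - s0) ^ k) s0"
    using r by (intro residue_add[of "ball s0 r"] hol holomorphic_on_sum holomorphic_intros) (auto intro: holomorphic_on_subset)
  also have "residue (\<lambda>s. u s * (s - s0) ^ k) s0 = 0"
    using r by (intro residue_holo[of "ball s0 r"] holomorphic_intros) auto
  also have "residue (\<lambda>s. \<Sum>j<m. b j / (s - s0) ^ Suc j * (s - s0) ^ k) s0 = b k"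
    using k by (subst sum) auto
  finally show ?thesis by simp
qed

section \<open>Mellin transforms of summatory functions\<close>

lemma sum_growth:
  assumes x: "polynomially_bounded \<rho> x" and rho: "\<rho> \<ge> 0"
  shows "\<exists>K. \<forall>N\<ge>1. cmod (\<Sum>n<N. x n) \<le> K * real N powr (\<rho> + 1)"
proof -
  obtain C where C: "\<And>n. n \<ge> 1 \<Longrightarrow> cmod (x n) \<le> C * real n powr \<rho>"
    using x unfolding polynomially_bounded_def by blast
  have C0: "C \<ge> 0" using order.trans[OF norm_ge_zero C[of 1]] by simp
  show ?thesis
  proof (intro exI allI impI)
    fix N :: nat assume N: "N \<ge> 1"
    have N1: "1 \<le> real N powr \<rho>" using N rho by (intro ge_one_powr_ge_zero) auto
    have "cmod (\<Sum>n<N. x n) \<le> (\<Sum>n<N. (cmod (x 0) + C) * real N powr \<rho>)"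
    proof (rule sum_norm_le)
      fix n assume n: "n \<in> {..<N}"
      show "cmod (x n) \<le> (cmod (x 0) + C) * real N powr \<rho>"
      proof (cases "n = 0")
        case True
        have "cmod (x 0) * 1 \<le> (cmod (x 0) + C) * real N powr \<rho>"
          using N1 C0 by (intro mult_mono) auto
        thus ?thesis using True by simp
      next
        case False
        hence "cmod (x n) \<le> C * real n powr \<rho>" by (intro C) auto
        also have "\<dots> \<le> (cmod (x 0) + C) * real N powr \<rho>"
          using n C0 rho by (intro mult_mono powr_mono2) auto
        finally show ?thesis .
      qed
    qed
    also have "\<dots> = (cmod (x 0) + C) * real N powr (\<rho> + 1)" using N by (simp add: powr_add)
    finally show "cmod (\<Sum>n<N. x n) \<le> (cmod (x 0) + C) * real N powr (\<rho> + 1)" .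
  qed
qed

text \<open>
The boundary term X(N) N^(-s) vanishes in the limit because X(N) = O(N^(\<rho> + 1)).  The constant x(0), which does not
occur in the Dirichlet series, comes from X(1).
\<close>
lemma abel_summation_dirichlet:
  assumes x: "polynomially_bounded \<rho> x" and rho: "\<rho> \<ge> 0" and s: "Re s > \<rho> + 1"
  shows "(\<lambda>n. (\<Sum>i<Suc (Suc n). x i) * (of_nat (Suc n) powr (- s) - of_nat (Suc (Suc n)) powr (- s)))
           sums (x 0 + dirichlet_series x s)"
proof -
  define X where "X N = (\<Sum>i<N. x i)" for N
  have part: "(\<Sum>n<M. X (Suc (Suc n)) * (of_nat (Suc n) powr (- s) - of_nat (Suc (Suc n)) powr (- s))) =
      x 0 + (\<Sum>n<M. dirichlet_summand x n s) - X (Suc M) * of_nat (Suc M) powr (- s)" for M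
  proof (induction M)
    case 0
    show ?case by (simp add: X_def)
  next
    case (Suc M)
    have "X (Suc (Suc M)) = X (Suc M) + x (Suc M)" by (simp add: X_def)
    thus ?case unfolding sum.lessThan_Suc Suc.IH dirichlet_summand_def
      by (simp add: algebra_simps del: of_nat_Suc)
  qed
  obtain K where K: "\<And>N. N \<ge> 1 \<Longrightarrow> cmod (X N) \<le> K * real N powr (\<rho> + 1)"
    using sum_growth[OF x rho] unfolding X_def by blast
  have "(\<lambda>M. X (Suc M) * of_nat (Suc M) powr (- s)) \<longlonglongrightarrow> 0"
  proof (rule Lim_null_comparison[OF always_eventually])
    show "\<forall>M. norm (X (Suc M) * of_nat (Suc M) powr (- s)) \<le> K * real (Suc M) powr (\<rho> + 1 - Re s)"
    proof
      fix M
      have "norm (X (Suc M) * of_nat (Suc M) powr (- s)) \<le> (K * real (Suc M) powr (\<rho> + 1)) * real (Suc M) powr (- Re s)"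
        using K[of "Suc M"] order.trans[OF norm_ge_zero K[of "Suc M"]] unfolding norm_mult norm_of_nat_powr[OF zero_less_Suc]
        by (intro mult_mono) (auto simp del: of_nat_Suc)
      also have "\<dots> = K * real (Suc M) powr (\<rho> + 1 - Re s)" by (simp add: powr_diff powr_minus divide_inverse del: of_nat_Suc)
      finally show "norm (X (Suc M) * of_nat (Suc M) powr (- s)) \<le> K * real (Suc M) powr (\<rho> + 1 - Re s)" .
    qed
    have "(\<lambda>M. real M powr (\<rho> + 1 - Re s)) \<longlonglongrightarrow> 0"
      using s by (intro tendsto_neg_powr filterlim_real_sequentially) auto
    hence "(\<lambda>M. K * real M powr (\<rho> + 1 - Re s)) \<longlonglongrightarrow> K * 0" by (intro tendsto_intros)
    thus "(\<lambda>M. K * real (Suc M) powr (\<rho> + 1 - Re s)) \<longlonglongrightarrow> 0"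
      by (subst filterlim_sequentially_Suc) simp
  qed
  moreover have "s \<in> {s. Re s > \<rho> + 1}" using s by auto
  from converges_normallyD(1)[OF dirichlet_normally[OF x] this]
  have "summable (\<lambda>n. dirichlet_summand x n s)" by (rule summable_norm_cancel)
  hence "(\<lambda>M. \<Sum>n<M. dirichlet_summand x n s) \<longlonglongrightarrow> dirichlet_series x s"
    unfolding dirichlet_series_def by (rule summable_LIMSEQ)
  ultimately have "(\<lambda>M. x 0 + (\<Sum>n<M. dirichlet_summand x n s) - X (Suc M) * of_nat (Suc M) powr (- s)) \<longlonglongrightarrow>
      x 0 + dirichlet_series x s - 0"
    by (intro tendsto_intros)
  thus ?thesis unfolding sums_def X_def[symmetric] part by simp
qed

text \<open>
This is u^(-s - 1).
\<close>
definition mellin_kernel :: "complex \<Rightarrow> real \<Rightarrow> complex" where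
  "mellin_kernel s u = exp (- (s + 1) * of_real (ln u))"

lemma continuous_on_mellin_kernel:
  "(\<And>u. u \<in> S \<Longrightarrow> u > 0) \<Longrightarrow> continuous_on S (mellin_kernel s)"
  unfolding mellin_kernel_def by (intro continuous_intros) force

lemma integral_mellin_kernel:
  assumes a: "0 < a" "a \<le> b" and s: "s \<noteq> 0"
  shows "integral {a..b} (mellin_kernel s) = (exp (- s * of_real (ln a)) - exp (- s * of_real (ln b))) / s"
proof -
  have "(mellin_kernel s has_integral (- exp (- s * of_real (ln b)) / s) - (- exp (- s * of_real (ln a)) / s)) {a..b}"
  proof (rule fundamental_theorem_of_calculus)
    fix u assume "u \<in> {a..b}"
    hence u: "u > 0" using a by auto
    have d: "((\<lambda>u. complex_of_real (ln u)) has_vector_derivative of_real (1 / u)) (at u within {a..b})"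
      using u by (intro has_vector_derivative_of_real) (auto intro!: derivative_eq_intros simp: has_real_derivative_iff_has_vector_derivative[symmetric])
    have "((\<lambda>z. - exp (- s * z) / s) has_field_derivative exp (- s * of_real (ln u))) (at (of_real (ln u)))"
      using s by (auto intro!: derivative_eq_intros)
    from field_vector_diff_chain_within[OF d has_field_derivative_at_within[OF this]]
    have "((\<lambda>z. - exp (- s * z) / s) \<circ> (\<lambda>u. of_real (ln u)) has_vector_derivative of_real (1 / u) * exp (- s * of_real (ln u))) (at u within {a..b})" .
    moreover have "of_real (1 / u) * exp (- s * of_real (ln u)) = mellin_kernel s u"
    proof -
      have "complex_of_real (1 / u) = exp (- of_real (ln u))"
        using u by (simp add: exp_minus exp_of_real inverse_eq_divide)
      hence "of_real (1 / u) * exp (- s * of_real (ln u)) = exp (- of_real (ln u) + - s * of_real (ln u))"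
        by (simp only: exp_add)
      also have "- of_real (ln u) + - s * of_real (ln u) = - (s + 1) * complex_of_real (ln u)" by (simp add: algebra_simps)
      finally show ?thesis by (simp only: mellin_kernel_def)
    qed
    ultimately show "((\<lambda>u. - exp (- s * of_real (ln u)) / s) has_vector_derivative mellin_kernel s u) (at u within {a..b})"
      by (simp add: o_def)
  qed (use a in auto)
  hence "integral {a..b} (mellin_kernel s) = (- exp (- s * of_real (ln b)) / s) - (- exp (- s * of_real (ln a)) / s)"
    by (rule integral_unique)
  thus ?thesis by (simp add: diff_divide_distrib)
qed

definition mellin_block :: "(real \<Rightarrow> complex) \<Rightarrow> nat \<Rightarrow> complex \<Rightarrow> complex" where
  "mellin_block f n s = integral {real (Suc n)..real (Suc n) + 1} (\<lambda>u. f u * mellin_kernel s u)"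

lemma mellin_block_holomorphic:
  assumes "continuous_on {real (Suc n)..real (Suc n) + 1} f"
  shows "mellin_block f n holomorphic_on S"
proof -
  have "continuous_on {real (Suc n)..real (Suc n) + 1} (\<lambda>u. f u * exp (- of_real (ln u)))"
    by (intro continuous_intros assms) auto
  moreover have "continuous_on {real (Suc n)..real (Suc n) + 1} ln" by (intro continuous_intros) auto
  ultimately have "((\<lambda>z. integral {real (Suc n)..real (Suc n) + 1} (\<lambda>u. f u * exp (- of_real (ln u)) * exp (- z * of_real (ln u))))
     has_field_derivative - integral {real (Suc n)..real (Suc n) + 1} (\<lambda>t. of_real (ln t) * (f t * exp (- of_real (ln t))) * exp (- z * of_real (ln t)))) (at z)" for z
    by (rule integral_exp_deriv)
  hence "(\<lambda>z. integral {real (Suc n)..real (Suc n) + 1} (\<lambda>u. f u * exp (- of_real (ln u)) * exp (- z * of_real (ln u)))) holomorphic_on S"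
    unfolding holomorphic_on_def field_differentiable_def by (blast intro: has_field_derivative_at_within)
  moreover have "(\<lambda>u. f u * exp (- of_real (ln u)) * exp (- z * of_real (ln u))) = (\<lambda>u. f u * mellin_kernel z u)" for z
    by (auto simp: mellin_kernel_def fun_eq_iff ring_distribs exp_add exp_diff exp_minus field_simps)
  ultimately show ?thesis unfolding mellin_block_def[abs_def] by simp
qed

lemma mellin_block_bound:
  assumes f: "continuous_on {real (Suc n)..real (Suc n) + 1} f"
    and B: "\<And>u. u \<in> {real (Suc n)..real (Suc n) + 1} \<Longrightarrow> cmod (f u) \<le> B"
    and s: "Re s \<ge> \<sigma>" "\<sigma> \<ge> 0"
  shows "cmod (mellin_block f n s) \<le> B * real (Suc n) powr (- \<sigma> - 1)"
proof -
  have "cmod (mellin_block f n s) \<le> (B * real (Suc n) powr (- \<sigma> - 1)) * (real (Suc n) + 1 - real (Suc n))"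
    unfolding mellin_block_def
  proof (rule integral_bound)
    show "continuous_on {real (Suc n)..real (Suc n) + 1} (\<lambda>u. f u * mellin_kernel s u)"
      by (intro continuous_intros f continuous_on_mellin_kernel) auto
    fix u assume u: "u \<in> {real (Suc n)..real (Suc n) + 1}"
    have u1: "u \<ge> 1" using u by auto
    have "cmod (mellin_kernel s u) = u powr (- Re s - 1)"
      using u1 by (simp add: mellin_kernel_def powr_def algebra_simps)
    also have "\<dots> \<le> u powr (- \<sigma> - 1)" using u1 s by (intro powr_mono) auto
    also have "\<dots> \<le> real (Suc n) powr (- \<sigma> - 1)" using u s by (intro powr_mono2') auto
    finally show "cmod (f u * mellin_kernel s u) \<le> B * real (Suc n) powr (- \<sigma> - 1)"
      unfolding norm_mult using B[OF u] order.trans[OF norm_ge_zero B[OF u]] by (intro mult_mono) auto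
  qed auto
  thus ?thesis by simp
qed

text \<open>
Substitution u = q^t on the intervals from q^j to q^(j + 1).  Partial sums up to powers of q suffice, as the series is
known to converge when this is applied.
\<close>
lemma mellin_block_q_powers:
  assumes q: "q \<ge> 2" and g: "continuous_on {1..} g"
  shows "(\<Sum>n<q ^ L - 1. mellin_block g n s) =
    of_real (ln q) * (\<Sum>j<L. integral {real j..real j + 1} (\<lambda>t. g (q powr t) * exp (- s * of_real (t * ln q))))"
proof -
  define h where "h u = g u * mellin_kernel s u" for u
  have hc: "continuous_on S h" if "S \<subseteq> {1..}" for S
    unfolding h_def by (intro continuous_intros continuous_on_mellin_kernel continuous_on_subset[OF g that]) (use that in force)
  have hi: "h integrable_on {a..b}" if "a \<ge> 1" for a b
    using that by (intro integrable_continuous_real hc) auto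
  have 1: "(\<Sum>n<N. mellin_block g n s) = integral {1..real N + 1} h" for N
  proof (induction N)
    case (Suc N)
    have "integral {1..real N + 1} h + integral {real N + 1..real (Suc N) + 1} h = integral {1..real (Suc N) + 1} h"
      by (intro Henstock_Kurzweil_Integration.integral_combine hi) auto
    thus ?case using Suc by (simp add: mellin_block_def h_def[abs_def] add_ac)
  qed simp
  define k where "k t = g (q powr t) * exp (- s * of_real (t * ln q))" for t
  have kc: "continuous_on S k" if "S \<subseteq> {0..}" for S
  proof -
    have "continuous_on S (\<lambda>t. g (q powr t))"
      by (rule continuous_on_compose2[OF g]) (use q that in \<open>auto intro!: continuous_intros ge_one_powr_ge_zero\<close>)
    thus ?thesis unfolding k_def by (intro continuous_intros)
  qed
  have 2: "integral {q ^ j..q ^ Suc j} h = of_real (ln q) * integral {real j..real j + 1} k" for j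
  proof -
    have "((\<lambda>t. (q powr t * ln q) *\<^sub>R h (q powr t)) has_integral integral {q powr real j..q powr (real j + 1)} h) {real j..real j + 1}"
    proof (rule has_integral_substitution[where c = "q ^ j" and d = "q ^ Suc j"])
      show "continuous_on {real (q ^ j)..real (q ^ Suc j)} h" using q by (intro hc) auto
      show "(\<lambda>t. q powr t) ` {real j..real j + 1} \<subseteq> {real (q ^ j)..real (q ^ Suc j)}"
      proof clarsimp
        fix t assume t: "real j \<le> t" "t \<le> real j + 1"
        have "q powr real j \<le> q powr t" "q powr t \<le> q powr (real (Suc j))" using t q by auto
        thus "real q ^ j \<le> q powr t \<and> q powr t \<le> q * real q ^ j"
          using q by (simp only: powr_realpow) auto
      qed
      show "((\<lambda>t. q powr t) has_field_derivative q powr t * ln q) (at t within {real j..real j + 1})" for t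
      proof -
        have "(\<lambda>t. q powr t) = (\<lambda>t. exp (t * ln q))" using q by (auto simp: powr_def)
        thus ?thesis by (auto intro!: derivative_eq_intros)
      qed
    qed (use q in auto)
    moreover have "(q powr t * ln q) *\<^sub>R h (q powr t) = of_real (ln q) * k t" for t
    proof -
      have "mellin_kernel s (q powr t) = exp (- s * of_real (t * ln q) + - of_real (t * ln q))"
        using q by (simp add: mellin_kernel_def ln_powr ring_distribs)
      also have "\<dots> = exp (- s * of_real (t * ln q)) * exp (- of_real (t * ln q))" by (rule exp_add)
      also have "exp (- complex_of_real (t * ln q)) = of_real (1 / q powr t)"
        using q by (simp add: exp_minus powr_def inverse_eq_divide flip: exp_of_real)
      finally show ?thesis using q by (simp add: h_def k_def scaleR_conv_of_real)
    qed
    ultimately have "((\<lambda>t. of_real (ln q) * k t) has_integral integral {q powr real j..q powr (real j + 1)} h) {real j..real j + 1}"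
      by simp
    moreover have "q powr real j = real (q ^ j)" "q powr (real j + 1) = real (q ^ Suc j)"
      using q by (simp_all add: powr_add powr_realpow)
    ultimately show ?thesis by (simp add: has_integral_iff)
  qed
  have 3: "integral {1..real (q ^ L)} h = (\<Sum>j<L. of_real (ln q) * integral {real j..real j + 1} k)"
  proof (induction L)
    case (Suc L)
    have "integral {1..real (q ^ L)} h + integral {real (q ^ L)..real (q ^ Suc L)} h = integral {1..real (q ^ Suc L)} h"
      using q by (intro Henstock_Kurzweil_Integration.integral_combine hi) auto
    thus ?case using Suc 2[of L] by simp
  qed simp
  have "real (q ^ L - 1) + 1 = real (q ^ L)" using q by (simp add: of_nat_diff)
  thus ?thesis using 1[of "q ^ L - 1"] 3 by (simp add: k_def[abs_def] sum_distrib_left)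
qed

section \<open>Fourier coefficients as residues\<close>

lemma periodic_continuous_bounded:
  fixes f :: "real \<Rightarrow> complex"
  assumes "continuous_on UNIV f" "\<And>t. f (t + 1) = f t"
  shows "\<exists>M. \<forall>t. cmod (f t) \<le> M"
proof -
  have "compact (f ` {0..1})"
    by (intro compact_continuous_image continuous_on_subset[OF assms(1)]) auto
  from compact_imp_bounded[OF this] have "\<exists>M. \<forall>t\<in>{0..1}. cmod (f t) \<le> M"
    by (simp add: bounded_iff)
  then obtain M where M: "\<And>t. t \<in> {0..1} \<Longrightarrow> cmod (f t) \<le> M" by blast
  show ?thesis
  proof (intro exI allI)
    fix t
    show "cmod (f t) \<le> M"
      using M[of "frac t"] periodic_add_int[of f t "- \<lfloor>t\<rfloor>", OF assms(2)] frac_ge_0[of t] frac_lt_1[of t]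
      by (simp add: frac_def less_imp_le)
  qed
qed

lemma of_nat_powr_eq_exp: "of_nat (Suc n) powr (- s) = exp (- s * complex_of_real (ln (real (Suc n))))"
  by (simp add: powr_def Ln_of_nat mult_ac del: of_nat_Suc)

text \<open>
What the comparison of the Dirichlet series with the asymptotic expansion uses: the summatory function up to N and the main term at any real u between N and
N + 1 differ by O(N^(\<rho> + \<epsilon>)).
\<close>
locale asymptotic_expansion =
  fixes q :: nat and \<rho> :: real and x :: "nat \<Rightarrow> complex"
    and Lam :: "complex set" and m :: "complex \<Rightarrow> nat" and \<Phi> :: "complex \<Rightarrow> nat \<Rightarrow> real \<Rightarrow> complex"
  assumes q: "q \<ge> 2" and rho: "\<rho> \<ge> 0" and x: "polynomially_bounded \<rho> x" and fin: "finite Lam"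
    and cont: "\<And>l k. l \<in> Lam \<Longrightarrow> k < m l \<Longrightarrow> continuous_on UNIV (\<Phi> l k)"
    and per: "\<And>l k t. l \<in> Lam \<Longrightarrow> k < m l \<Longrightarrow> \<Phi> l k (t + 1) = \<Phi> l k t"
    and large: "\<And>l. l \<in> Lam \<Longrightarrow> cmod l > real q powr \<rho>"
    and approx: "\<And>\<epsilon>. \<epsilon> > 0 \<Longrightarrow> \<exists>K. \<forall>N\<ge>1. \<forall>u\<in>{real N..real N + 1}.
       cmod ((\<Sum>n<Suc N. x n) - (\<Sum>l\<in>Lam. periodic_sum l (m l) (\<Phi> l) (log q u))) \<le> K * real N powr (\<rho> + \<epsilon>)"
begin

text \<open>
The Mellin transform of the main term, up to the factor log q.
\<close>
definition main_transform :: "complex \<Rightarrow> complex" where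
  "main_transform s = (\<Sum>l\<in>Lam. \<Sum>k<m l. (-1) ^ k * (deriv ^^ k) (laplace_period (\<Phi> l k)) (s * of_real (ln q) - Ln l))"

text \<open>
E is the Mellin transform of the difference between the step function and the main term.  It is a normally convergent series on
Re s > \<rho> since the difference is O(u^(\<rho> + \<epsilon>)) for every \<epsilon> > 0.
\<close>
lemma mellin_expansion:
  "\<exists>E \<sigma>0. E holomorphic_on {s. Re s > \<rho>} \<and>
     (\<forall>s. Re s > \<sigma>0 \<longrightarrow> (x 0 + dirichlet_series x s) / s = E s + of_real (ln q) * main_transform s)"
proof -
  define X where "X N = (\<Sum>n<N. x n)" for N
  define g where "g u = (\<Sum>l\<in>Lam. periodic_sum l (m l) (\<Phi> l) (log q u))" for u :: real
  have ps_cont: "continuous_on UNIV (periodic_sum l (m l) (\<Phi> l))" if "l \<in> Lam" for l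
    unfolding periodic_sum_def by (intro continuous_intros cont that) auto
  have gc: "continuous_on S g" if "S \<subseteq> {1..}" for S
    unfolding g_def
  proof (intro continuous_on_sum)
    fix l assume "l \<in> Lam"
    show "continuous_on S (\<lambda>u. periodic_sum l (m l) (\<Phi> l) (log q u))"
      by (rule continuous_on_compose2[OF ps_cont[OF \<open>l \<in> Lam\<close>]])
         (use q that in \<open>auto intro!: continuous_intros\<close>)
  qed
  define e where "e n = mellin_block (\<lambda>u. X (Suc (Suc n)) - g u) n" for n
  have ec: "continuous_on {real (Suc n)..real (Suc n) + 1} (\<lambda>u. X (Suc (Suc n)) - g u)" for n
    by (intro continuous_intros gc) auto
  have norm: "converges_normally_on e {s. Re s > \<rho>}"
    unfolding converges_normally_on_def
  proof (intro allI impI; elim conjE)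
    fix K assume K: "compact K" "K \<subseteq> {s. Re s > \<rho>}"
    obtain \<sigma> where \<sigma>: "\<sigma> > \<rho>" "\<And>s. s \<in> K \<Longrightarrow> Re s \<ge> \<sigma>" using compact_Re_lower[OF K] by blast
    \<comment> \<open>With this choice the n-th summand is O(n^(-1-\<epsilon>)).\<close>
    define \<epsilon> where "\<epsilon> = (\<sigma> - \<rho>) / 2"
    have \<epsilon>: "\<epsilon> > 0" using \<sigma> by (simp add: \<epsilon>_def)
    obtain C where C: "\<And>N u. N \<ge> 1 \<Longrightarrow> u \<in> {real N..real N + 1} \<Longrightarrow> cmod (X (Suc N) - g u) \<le> C * real N powr (\<rho> + \<epsilon>)"
      using approx[OF \<epsilon>] unfolding X_def g_def by blast
    show "\<exists>M. summable M \<and> (\<forall>n. \<forall>s\<in>K. cmod (e n s) \<le> M n)"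
    proof (intro exI[of _ "\<lambda>n. C * real (Suc n) powr (- 1 - \<epsilon>)"] conjI allI ballI)
      show "summable (\<lambda>n. C * real (Suc n) powr (- 1 - \<epsilon>))"
        using \<epsilon> by (intro summable_mult summable_Suc_powr) auto
      fix n s assume s: "s \<in> K"
      have "cmod (e n s) \<le> (C * real (Suc n) powr (\<rho> + \<epsilon>)) * real (Suc n) powr (- \<sigma> - 1)"
        unfolding e_def using C[of "Suc n"] \<sigma> s rho by (intro mellin_block_bound ec) auto
      also have "\<dots> = C * real (Suc n) powr ((\<rho> + \<epsilon>) + (- \<sigma> - 1))"
        unfolding powr_add by (simp only: mult.assoc)
      also have "(\<rho> + \<epsilon>) + (- \<sigma> - 1) = - 1 - \<epsilon>" by (simp add: \<epsilon>_def field_simps)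
      finally show "cmod (e n s) \<le> C * real (Suc n) powr (- 1 - \<epsilon>)" .
    qed
  qed
  define E where "E s = (\<Sum>n. e n s)" for s
  have Eh: "E holomorphic_on {s. Re s > \<rho>}"
    unfolding E_def[abs_def]
    by (rule converges_normally_holomorphic[OF norm open_Re_gt]) (auto simp: e_def intro!: mellin_block_holomorphic ec)
  \<comment> \<open>To the right of this abscissa the Laplace transforms of all summands of the main term converge.\<close>
  define \<sigma>0 where "\<sigma>0 = Max (insert (\<rho> + 1) ((\<lambda>l. Re (Ln l) / ln q) ` Lam))"
  have "(x 0 + dirichlet_series x s) / s = E s + of_real (ln q) * main_transform s" if "Re s > \<sigma>0" for s
  proof -
    have "\<rho> + 1 \<le> \<sigma>0" unfolding \<sigma>0_def using fin by (intro Max_ge) auto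
    hence s: "Re s > \<rho> + 1" using that by simp
    have s0: "s \<noteq> 0" using s rho by auto
    have lnq: "ln q > 0" using q by simp
    have sl: "Re (s * of_real (ln q) - Ln l) > 0" if "l \<in> Lam" for l
    proof -
      have "Re (Ln l) / ln q \<le> \<sigma>0" unfolding \<sigma>0_def using fin that by (intro Max_ge) auto
      hence "Re (Ln l) / ln q < Re s" using \<open>Re s > \<sigma>0\<close> by simp
      thus ?thesis using lnq by (simp add: field_simps)
    qed
    have es: "(\<lambda>n. e n s) sums E s"
    proof -
      have "s \<in> {s. Re s > \<rho>}" using s by auto
      from converges_normallyD(1)[OF norm this] have "summable (\<lambda>n. e n s)" by (rule summable_norm_cancel)
      thus ?thesis unfolding E_def by (rule summable_sums)
    qed
    have blk: "mellin_block g n s = X (Suc (Suc n)) * (of_nat (Suc n) powr (- s) - of_nat (Suc (Suc n)) powr (- s)) / s - e n s" for n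
    proof -
      define I where "I = {real (Suc n)..real (Suc n) + 1}"
      have kc: "continuous_on I (mellin_kernel s)" unfolding I_def by (intro continuous_on_mellin_kernel) auto
      have gI: "continuous_on I g" unfolding I_def by (intro gc) auto
      have "e n s = integral I (\<lambda>u. X (Suc (Suc n)) * mellin_kernel s u - g u * mellin_kernel s u)"
        by (simp add: e_def mellin_block_def I_def left_diff_distrib)
      also have "\<dots> = integral I (\<lambda>u. X (Suc (Suc n)) * mellin_kernel s u) - integral I (\<lambda>u. g u * mellin_kernel s u)"
        using kc gI unfolding I_def by (intro integral_diff integrable_continuous_real continuous_intros)
      also have "integral I (\<lambda>u. X (Suc (Suc n)) * mellin_kernel s u) = X (Suc (Suc n)) * integral I (mellin_kernel s)" by simp
      also have "integral I (mellin_kernel s) = (of_nat (Suc n) powr (- s) - of_nat (Suc (Suc n)) powr (- s)) / s"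
        unfolding I_def of_nat_powr_eq_exp using s0 by (subst integral_mellin_kernel) (auto simp: add_ac)
      finally show ?thesis by (simp add: mellin_block_def I_def)
    qed
    have "(\<lambda>n. mellin_block g n s) sums ((x 0 + dirichlet_series x s) / s - E s)"
      unfolding blk X_def by (intro sums_diff es sums_divide abel_summation_dirichlet[OF x rho s])
    hence lim1: "(\<lambda>N. \<Sum>n<N. mellin_block g n s) \<longlonglongrightarrow> (x 0 + dirichlet_series x s) / s - E s"
      unfolding sums_def .
    \<comment> \<open>The series converges, so it may be evaluated along partial sums that end at powers of q.\<close>
    have "filterlim (\<lambda>L. q ^ L - 1) at_top sequentially"
    proof (rule filterlim_at_top_mono[OF filterlim_ident always_eventually], rule allI)
      fix L
      have "L < 2 ^ L" by (rule less_exp)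
      also have "\<dots> \<le> q ^ L" using q by (rule power_mono) auto
      finally show "L \<le> q ^ L - 1" by simp
    qed
    from filterlim_compose[OF lim1 this]
    have lim2: "(\<lambda>L. \<Sum>n<q ^ L - 1. mellin_block g n s) \<longlonglongrightarrow> (x 0 + dirichlet_series x s) / s - E s" .
    have int: "integral {real j..real j + 1} (\<lambda>t. g (q powr t) * exp (- s * of_real (t * ln q))) =
        (\<Sum>l\<in>Lam. \<Sum>k<m l. laplace_block (\<Phi> l k) k j (s * of_real (ln q) - Ln l))" for j
    proof -
      have eq: "(\<lambda>t. g (q powr t) * exp (- s * of_real (t * ln q))) =
            (\<lambda>t. \<Sum>l\<in>Lam. \<Sum>k<m l. of_real t ^ k * \<Phi> l k t * exp (- (s * of_real (ln q) - Ln l) * of_real t))"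
      proof
        fix t
        have ex: "exp (Ln l * of_real t) * exp (- s * of_real (t * ln q)) = exp (- (s * of_real (ln q) - Ln l) * of_real t)" for l
          unfolding exp_add[symmetric] by (simp add: algebra_simps)
        have "g (q powr t) * exp (- s * of_real (t * ln q)) =
           (\<Sum>l\<in>Lam. (exp (Ln l * of_real t) * exp (- s * of_real (t * ln q))) * (\<Sum>k<m l. of_real t ^ k * \<Phi> l k t))"
          using q by (simp add: g_def periodic_sum_def sum_distrib_right sum_distrib_left mult_ac)
        also have "\<dots> = (\<Sum>l\<in>Lam. \<Sum>k<m l. of_real t ^ k * \<Phi> l k t * exp (- (s * of_real (ln q) - Ln l) * of_real t))"
          unfolding ex sum_distrib_left by (intro sum.cong refl) (simp only: mult_ac)
        finally show "g (q powr t) * exp (- s * of_real (t * ln q)) =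
           (\<Sum>l\<in>Lam. \<Sum>k<m l. of_real t ^ k * \<Phi> l k t * exp (- (s * of_real (ln q) - Ln l) * of_real t))" .
      qed
      have ci: "(\<lambda>t. of_real t ^ k * \<Phi> l k t * exp (- z * of_real t)) integrable_on {real j..real j + 1}"
        if "l \<in> Lam" "k < m l" for l k z
        by (intro integrable_continuous_real continuous_intros continuous_on_subset[OF cont[OF that]]) auto
      define F where "F l k t = of_real t ^ k * \<Phi> l k t * exp (- (s * of_real (ln q) - Ln l) * of_real t)" for l k t
      have Fi: "F l k integrable_on {real j..real j + 1}" if "l \<in> Lam" "k \<in> {..<m l}" for l k
        unfolding F_def using that by (intro ci) simp_all
      have "integral {real j..real j + 1} (\<lambda>t. \<Sum>l\<in>Lam. \<Sum>k<m l. F l k t) =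
            (\<Sum>l\<in>Lam. integral {real j..real j + 1} (\<lambda>t. \<Sum>k<m l. F l k t))"
        by (intro integral_sum fin integrable_sum finite_lessThan Fi)
      also have "\<dots> = (\<Sum>l\<in>Lam. \<Sum>k<m l. integral {real j..real j + 1} (F l k))"
        by (intro sum.cong refl integral_sum finite_lessThan Fi)
      finally show ?thesis
        unfolding eq unfolding laplace_block_def F_def .
    qed
    have "(\<lambda>j. \<Sum>l\<in>Lam. \<Sum>k<m l. laplace_block (\<Phi> l k) k j (s * of_real (ln q) - Ln l)) sums main_transform s"
      unfolding main_transform_def
    proof (intro sums_sum)
      fix l k assume l: "l \<in> Lam" and k: "k \<in> {..<m l}"
      hence k: "k < m l" by simp
      obtain M where M: "\<And>t. cmod (\<Phi> l k t) \<le> M"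
        using periodic_continuous_bounded[OF cont[OF l k] per[OF l k]] by blast
      from sums_mult[OF laplace_block_sums[OF cont[OF l k] per[OF l k] M sl[OF l], of k], of "(-1) ^ k"]
      show "(\<lambda>j. laplace_block (\<Phi> l k) k j (s * of_real (ln q) - Ln l)) sums
         ((-1) ^ k * (deriv ^^ k) (laplace_period (\<Phi> l k)) (s * of_real (ln q) - Ln l))"
        by (simp flip: mult.assoc power_mult_distrib)
    qed
    from sums_mult[OF this, of "of_real (ln q)"]
    have "(\<lambda>L. \<Sum>n<q ^ L - 1. mellin_block g n s) \<longlonglongrightarrow> of_real (ln q) * main_transform s"
      unfolding sums_def mellin_block_q_powers[OF q gc[OF order.refl]] int by (simp add: sum_distrib_left)
    with lim2 have "(x 0 + dirichlet_series x s) / s - E s = of_real (ln q) * main_transform s"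
      by (rule LIMSEQ_unique)
    thus ?thesis by (simp add: algebra_simps)
  qed
  with Eh show ?thesis by blast
qed

lemma main_transform_meromorphic: "main_transform meromorphic_on A"
proof -
  have "main_transform meromorphic_on UNIV"
    unfolding main_transform_def[abs_def]
  proof (intro meromorphic_intros)
    fix l k assume "l \<in> Lam" "k \<in> {..<m l}"
    show "(\<lambda>s. (deriv ^^ k) (laplace_period (\<Phi> l k)) (s * of_real (ln q) - Ln l)) meromorphic_on UNIV"
      by (rule meromorphic_on_compose[of _ UNIV])
         (use \<open>l \<in> Lam\<close> \<open>k \<in> {..<m l}\<close> in \<open>auto intro!: meromorphic_intros laplace_period_meromorphic cont analytic_intros\<close>)
  qed
  thus ?thesis by (rule meromorphic_on_subset) auto
qed

text \<open>
Both sides are meromorphic on the half plane and agree far to the right.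
\<close>
lemma dirichlet_continuation_eq:
  assumes Xf: "Xf meromorphic_on {s. Re s > \<rho>}" and eq: "\<And>s. Re s > \<rho> + 1 \<Longrightarrow> Xf s = dirichlet_series x s"
    and s0: "Re s0 > \<rho>"
  shows "\<exists>E. E analytic_on {s0} \<and> eventually (\<lambda>s. (x 0 + Xf s) / s = E s + of_real (ln q) * main_transform s) (at s0)"
proof -
  obtain E \<sigma>0 where E: "E holomorphic_on {s. Re s > \<rho>}"
    and eqE: "\<And>s. Re s > \<sigma>0 \<Longrightarrow> (x 0 + dirichlet_series x s) / s = E s + of_real (ln q) * main_transform s"
    using mellin_expansion by blast
  define H where "H = {s. Re s > \<rho>}"
  have H: "open H" "connected H"
    unfolding H_def using open_Re_gt convex_halfspace_Re_gt[of \<rho>] convex_connected by auto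
  define D where "D s = (x 0 + Xf s) / s - (E s + of_real (ln q) * main_transform s)" for s
  have Ea: "E analytic_on H" using E H(1) by (simp add: H_def analytic_on_open)
  have mero: "D meromorphic_on H"
    unfolding D_def[abs_def]
    by (intro meromorphic_intros main_transform_meromorphic analytic_on_imp_meromorphic_on[OF Ea])
       (use Xf in \<open>auto simp: H_def\<close>)
  define \<sigma> where "\<sigma> = max \<sigma>0 (\<rho> + 1)"
  have "eventually (\<lambda>z. D z = 0) (cosparse H)"
  proof (rule disjE[OF meromorphic_imp_constant_or_avoid[OF mero H, of 0]])
    assume av: "eventually (\<lambda>z. D z \<noteq> 0) (cosparse H)"
    define z where "z = complex_of_real (\<sigma> + 1)"
    have zH: "z \<in> H" by (simp add: z_def H_def \<sigma>_def)
    have "eventually (\<lambda>s. D s \<noteq> 0) (at z)" using av zH H(1) by (simp add: eventually_cosparse_open_eq)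
    moreover have "eventually (\<lambda>s. s \<in> {s. Re s > \<sigma>} - {z}) (at z)"
      by (intro eventually_at_in_open open_Re_gt) (simp add: z_def)
    hence "eventually (\<lambda>s. D s = 0) (at z)"
      by eventually_elim (auto simp: D_def \<sigma>_def eq eqE)
    ultimately have "eventually (\<lambda>s. False) (at z)" by eventually_elim auto
    thus ?thesis by simp
  qed
  moreover have s0H: "s0 \<in> H" using s0 by (simp add: H_def)
  ultimately have "eventually (\<lambda>s. D s = 0) (at s0)" using H(1) by (simp add: eventually_cosparse_open_eq)
  hence "eventually (\<lambda>s. (x 0 + Xf s) / s = E s + of_real (ln q) * main_transform s) (at s0)"
    by eventually_elim (simp add: D_def)
  moreover have "E analytic_on {s0}" using Ea s0H by (auto intro: analytic_on_subset)
  ultimately show ?thesis by blast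
qed

text \<open>
In the variable z = s log q - Ln l the point s0 is 2 \<pi> i j, so the summands for l have the principal parts of
\<open>laplace_period_polar_part\<close>.  The summands for other l' are analytic at s0: a pole would require q^s0 = l', but
q^s0 = l.
\<close>
theorem fourier_coeff_eq_integral:
  assumes Xf: "Xf meromorphic_on {s. Re s > \<rho>}" and eq: "\<And>s. Re s > \<rho> + 1 \<Longrightarrow> Xf s = dirichlet_series x s"
    and l: "l \<in> Lam" and k: "k < m l"
  shows "fourier_coeff q (x 0) Xf l k j = integral {0..1} (\<lambda>t. \<Phi> l k t * exp (\<i> * of_real (- 2 * pi * of_int j * t)))"
proof -
  define s0 where "s0 = clog q l + 2 * of_int j * of_real pi * \<i> / of_real (ln (real q))"
  define z0 where "z0 = \<i> * of_real (2 * pi * of_int j)"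
  have lnq: "ln q > 0" using q by simp
  have l0: "l \<noteq> 0" using large[OF l] by auto
  have s0z: "s0 * of_real (ln q) - Ln l = z0"
    using lnq by (simp add: s0_def clog_def z0_def field_simps)
  have Re: "Re s0 > \<rho>"
  proof -
    have "Re s0 = ln (cmod l) / ln q" using l0 by (simp add: s0_def clog_def Re_divide_of_real)
    moreover have "ln (real q powr \<rho>) < ln (cmod l)" using large[OF l] q l0 by (subst ln_less_cancel_iff) auto
    hence "\<rho> * ln q < ln (cmod l)" using q by (simp add: ln_powr)
    ultimately have "\<rho> * ln q < Re s0 * ln q" using lnq by simp
    thus ?thesis using lnq by (simp only: mult_less_cancel_right_pos)
  qed
  obtain E where E: "E analytic_on {s0}"
    and ev: "eventually (\<lambda>s. (x 0 + Xf s) / s = E s + of_real (ln q) * main_transform s) (at s0)"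
    using dirichlet_continuation_eq[OF Xf eq Re] by blast
  have ez0: "exp z0 = 1" unfolding z0_def exp_eq_1 by (auto intro!: exI[of _ j])
  define C where "C i = integral {0..1} (\<lambda>t. \<Phi> l i t * exp (- z0 * of_real t))" for i
  define P where "P i u \<longleftrightarrow> u holomorphic_on ball z0 1 \<and> (\<forall>z\<in>ball z0 1 - {z0}. (deriv ^^ i) (laplace_period (\<Phi> l i)) z =
       (-1) ^ i * fact i * C i / (z - z0) ^ Suc i + (deriv ^^ i) u z)" for i u
  have "\<exists>u. P i u" if "i < m l" for i
  proof (rule laplace_period_polar_part[OF cont[OF l that] ez0])
    fix u assume "u holomorphic_on ball z0 1"
      "\<And>z j. z \<in> ball z0 1 - {z0} \<Longrightarrow> (deriv ^^ j) (laplace_period (\<Phi> l i)) z = (-1) ^ j * fact j *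
          integral {0..1} (\<lambda>t. \<Phi> l i t * exp (- z0 * of_real t)) / (z - z0) ^ Suc j + (deriv ^^ j) u z"
    hence "P i u" unfolding P_def C_def by blast
    thus ?thesis by (rule exI[of "P i" u])
  qed
  hence "\<forall>i. \<exists>u. i < m l \<longrightarrow> P i u" by blast
  from choice[OF this] obtain u where "\<forall>i. i < m l \<longrightarrow> P i (u i)" ..
  hence u: "\<And>i. i < m l \<Longrightarrow> u i holomorphic_on ball z0 1"
    "\<And>i z. i < m l \<Longrightarrow> z \<in> ball z0 1 - {z0} \<Longrightarrow> (deriv ^^ i) (laplace_period (\<Phi> l i)) z =
       (-1) ^ i * fact i * C i / (z - z0) ^ Suc i + (deriv ^^ i) (u i) z" by (simp_all add: P_def)
  define z where "z s = s * of_real (ln q) - Ln l" for s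
  have zs0: "z s0 = z0" using s0z by (simp add: z_def)
  have zd: "z s - z0 = of_real (ln q) * (s - s0)" for s
    using s0z by (simp add: z_def algebra_simps)
  define b where "b i = fact i * C i / of_real (ln q) ^ i" for i
  define U where "U s = E s + of_real (ln q) * ((\<Sum>i<m l. (-1) ^ i * (deriv ^^ i) (u i) (z s)) +
      (\<Sum>l'\<in>Lam - {l}. \<Sum>i<m l'. (-1) ^ i * (deriv ^^ i) (laplace_period (\<Phi> l' i)) (s * of_real (ln q) - Ln l')))" for s
  have za: "z analytic_on {s0}" unfolding z_def by (intro analytic_intros)
  have U: "U analytic_on {s0}"
    unfolding U_def
  proof (intro analytic_intros E analytic_on_sum)
    fix i assume "i \<in> {..<m l}"
    hence "(deriv ^^ i) (u i) analytic_on ball z0 1"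
      using u(1) by (simp add: analytic_on_open holomorphic_higher_deriv)
    hence "(deriv ^^ i) (u i) analytic_on z ` {s0}" by (rule analytic_on_subset) (simp add: zs0)
    from analytic_on_compose[OF za this] show "(\<lambda>s. (deriv ^^ i) (u i) (z s)) analytic_on {s0}" by (simp add: o_def)
  next
    fix l' i assume l': "l' \<in> Lam - {l}" "i \<in> {..<m l'}"
    have l'0: "l' \<noteq> 0" using large[of l'] l' by auto
    define z' where "z' s = s * of_real (ln q) - Ln l'" for s
    have "exp (z' s0) = l / l'"
    proof -
      have "z' s0 = z0 + Ln l - Ln l'" using s0z by (simp add: z'_def algebra_simps)
      thus ?thesis using l0 l'0 ez0 by (simp add: exp_add exp_diff)
    qed
    hence "exp (z' s0) \<noteq> 1" using l' l'0 by auto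
    moreover have "(deriv ^^ i) (laplace_period (\<Phi> l' i)) analytic_on {z. exp z \<noteq> 1}"
      using higher_deriv_laplace_holomorphic[OF cont[of l' i], of i] l' open_exp_neq_1 by (simp add: analytic_on_open)
    ultimately have "(deriv ^^ i) (laplace_period (\<Phi> l' i)) analytic_on z' ` {s0}"
      by (auto elim: analytic_on_subset)
    moreover have "z' analytic_on {s0}" unfolding z'_def by (intro analytic_intros)
    ultimately show "(\<lambda>s. (deriv ^^ i) (laplace_period (\<Phi> l' i)) (s * of_real (ln q) - Ln l')) analytic_on {s0}"
      using analytic_on_compose[of z' "{s0}"] by (simp add: o_def z'_def)
  qed
  have "isCont z s0" using za analytic_at_imp_isCont by blast
  hence "eventually (\<lambda>s. z s \<in> ball z0 1) (at s0)"
    unfolding isCont_def zs0 by (rule topological_tendstoD) auto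
  hence ev2: "eventually (\<lambda>s. (x 0 + Xf s) / s = (\<Sum>i<m l. b i / (s - s0) ^ Suc i) + U s) (at s0)"
    using ev eventually_neq_at_within[of s0]
  proof eventually_elim
    case (elim s)
    have zne: "z s \<noteq> z0" using zd[of s] elim lnq by auto
    have polar: "of_real (ln q) * ((-1) ^ i * ((-1) ^ i * fact i * C i / (z s - z0) ^ Suc i)) = b i / (s - s0) ^ Suc i" for i
    proof -
      have "(-1) ^ i * (-1 :: complex) ^ i = 1" by (simp flip: power_mult_distrib)
      hence "of_real (ln q) * ((-1) ^ i * ((-1) ^ i * fact i * C i / (z s - z0) ^ Suc i)) = of_real (ln q) * (fact i * C i / (z s - z0) ^ Suc i)"
        by (simp flip: mult.assoc)
      also have "\<dots> = b i / (s - s0) ^ Suc i"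
        unfolding zd b_def using lnq by (simp add: power_mult_distrib)
      finally show ?thesis .
    qed
    have "of_real (ln q) * main_transform s = of_real (ln q) * ((\<Sum>i<m l. (-1) ^ i * (deriv ^^ i) (laplace_period (\<Phi> l i)) (z s)) +
       (\<Sum>l'\<in>Lam - {l}. \<Sum>i<m l'. (-1) ^ i * (deriv ^^ i) (laplace_period (\<Phi> l' i)) (s * of_real (ln q) - Ln l')))"
      unfolding main_transform_def z_def by (subst sum.remove[OF fin l]) simp
    also have "(\<Sum>i<m l. (-1) ^ i * (deriv ^^ i) (laplace_period (\<Phi> l i)) (z s)) =
       (\<Sum>i<m l. (-1) ^ i * ((-1) ^ i * fact i * C i / (z s - z0) ^ Suc i) + (-1) ^ i * (deriv ^^ i) (u i) (z s))"
      using u(2) elim zne by (intro sum.cong refl) (simp add: distrib_left)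
    also have "of_real (ln q) * (\<dots> + (\<Sum>l'\<in>Lam - {l}. \<Sum>i<m l'. (-1) ^ i * (deriv ^^ i) (laplace_period (\<Phi> l' i)) (s * of_real (ln q) - Ln l'))) =
       (\<Sum>i<m l. b i / (s - s0) ^ Suc i) + (U s - E s)"
      unfolding polar[symmetric] U_def sum.distrib by (simp add: distrib_left sum_distrib_left)
    finally show ?case using elim by simp
  qed
  have "residue (\<lambda>s. (x 0 + Xf s) / s * (s - s0) ^ k) s0 = b k"
    by (rule residue_polar_sum[OF k U ev2])
  hence "fourier_coeff q (x 0) Xf l k j = of_real (ln q) ^ k / fact k * b k"
    unfolding fourier_coeff_def Let_def s0_def[symmetric] by simp
  also have "\<dots> = C k" using lnq by (simp add: b_def)
  also have "\<dots> = integral {0..1} (\<lambda>t. \<Phi> l k t * exp (\<i> * of_real (- 2 * pi * of_int j * t)))"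
    by (simp add: C_def z0_def mult_ac)
  finally show ?thesis .
qed

end

section \<open>Matrix norms and generalised eigenvectors\<close>

lemma norm_le_coordinates:
  assumes nrm: "is_vector_norm d nrm" and x: "x \<in> carrier_vec d"
  shows "nrm x \<le> (\<Sum>i<d. cmod (x $ i) * nrm (unit_vec d i))"
proof -
  have N0: "nrm (0\<^sub>v d) = 0"
    and Nc: "\<And>c x. x \<in> carrier_vec d \<Longrightarrow> nrm (c \<cdot>\<^sub>v x) = cmod c * nrm x"
    and Nt: "\<And>x y. x \<in> carrier_vec d \<Longrightarrow> y \<in> carrier_vec d \<Longrightarrow> nrm (x + y) \<le> nrm x + nrm y"
    using nrm unfolding is_vector_norm_def by auto
  define t where "t k = vec d (\<lambda>i. if i < k then x $ i else 0)" for k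
  have "nrm (t k) \<le> (\<Sum>i<k. cmod (x $ i) * nrm (unit_vec d i))" if "k \<le> d" for k
    using that
  proof (induction k)
    case 0
    have "t 0 = 0\<^sub>v d" by (auto simp: t_def)
    thus ?case using N0 by simp
  next
    case (Suc k)
    have "t (Suc k) = t k + x $ k \<cdot>\<^sub>v unit_vec d k"
      using Suc.prems by (intro eq_vecI) (auto simp: t_def unit_vec_def less_Suc_eq)
    hence "nrm (t (Suc k)) \<le> nrm (t k) + nrm (x $ k \<cdot>\<^sub>v unit_vec d k)"
      using Nt[of "t k" "x $ k \<cdot>\<^sub>v unit_vec d k"] by (simp add: t_def)
    also have "nrm (x $ k \<cdot>\<^sub>v unit_vec d k) = cmod (x $ k) * nrm (unit_vec d k)" by (rule Nc) simp
    finally show ?case using Suc by simp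
  qed
  from this[of d] have "nrm (t d) \<le> (\<Sum>i<d. cmod (x $ i) * nrm (unit_vec d i))" by simp
  moreover have "t d = x" using x by (auto simp: t_def)
  ultimately show ?thesis by simp
qed

lemma compact_coordinate_box:
  "compact {f :: nat \<Rightarrow> complex. (\<forall>i. f i \<in> (if i < d then cball 0 1 else {0}))}"
proof -
  have "compactin (product_topology (\<lambda>_. euclidean) UNIV) (PiE UNIV (\<lambda>i. if i < d then cball (0::complex) 1 else {0}))"
    by (subst compactin_PiE) (auto simp: compactin_euclidean_iff)
  moreover have "PiE UNIV (\<lambda>i. if i < d then cball (0::complex) 1 else {0}) =
      {f. (\<forall>i. f i \<in> (if i < d then cball 0 1 else {0}))}"
    by (auto simp: PiE_def Pi_def)
  ultimately show ?thesis by (simp add: euclidean_product_topology compactin_euclidean_iff)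
qed

text \<open>
The norm is continuous, so it attains a positive minimum on the compact set of vectors whose largest coordinate has
modulus 1.  The vectors are represented by functions on the natural numbers in order to use the compactness of products.
\<close>
lemma coordinates_le_norm:
  assumes nrm: "is_vector_norm d nrm" and d: "d \<ge> 1"
  shows "\<exists>c>0. \<forall>x\<in>carrier_vec d. \<forall>i<d. cmod (x $ i) \<le> c * nrm x"
proof -
  have Npos: "\<And>x. x \<in> carrier_vec d \<Longrightarrow> nrm x \<ge> 0" "\<And>x. x \<in> carrier_vec d \<Longrightarrow> nrm x = 0 \<longleftrightarrow> x = 0\<^sub>v d"
    and Nc: "\<And>c x. x \<in> carrier_vec d \<Longrightarrow> nrm (c \<cdot>\<^sub>v x) = cmod c * nrm x"
    and Nt: "\<And>x y. x \<in> carrier_vec d \<Longrightarrow> y \<in> carrier_vec d \<Longrightarrow> nrm (x + y) \<le> nrm x + nrm y"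
    using nrm unfolding is_vector_norm_def by auto
  define S where "S = {f :: nat \<Rightarrow> complex. (\<forall>i. f i \<in> (if i < d then cball 0 1 else {0}))} \<inter> (\<Union>i<d. {f. cmod (f i) = 1})"
  have S: "compact S"
    unfolding S_def
    by (intro compact_Int_closed compact_coordinate_box closed_UN finite_lessThan ballI closed_Collect_eq
        continuous_on_norm continuous_on_product_coordinates continuous_on_const)
  define N where "N f = nrm (vec d f)" for f
  have diff: "\<bar>N f - N g\<bar> \<le> (\<Sum>i<d. cmod (f i - g i) * nrm (unit_vec d i))" for f g
  proof -
    have *: "N f - N g \<le> (\<Sum>i<d. cmod (f i - g i) * nrm (unit_vec d i))" for f g
    proof -
      have "vec d f = vec d g + vec d (\<lambda>i. f i - g i)" by auto
      hence "N f \<le> N g + nrm (vec d (\<lambda>i. f i - g i))"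
        unfolding N_def using Nt[of "vec d g" "vec d (\<lambda>i. f i - g i)"] by simp
      also have "nrm (vec d (\<lambda>i. f i - g i)) \<le> (\<Sum>i<d. cmod (f i - g i) * nrm (unit_vec d i))"
        using norm_le_coordinates[OF nrm, of "vec d (\<lambda>i. f i - g i)"] by simp
      finally show ?thesis by simp
    qed
    show ?thesis using *[of f g] *[of g f] by (simp add: norm_minus_commute abs_le_iff)
  qed
  have Ncont: "continuous_on S N"
    unfolding continuous_on_def
  proof
    fix f assume "f \<in> S"
    have coord: "((\<lambda>g. g i) \<longlongrightarrow> f i) (at f within S)" for i
    proof -
      have "continuous_on S (\<lambda>g. g i)" by (rule continuous_on_subset[OF continuous_on_product_coordinates]) auto
      thus ?thesis using \<open>f \<in> S\<close> unfolding continuous_on_def by (rule bspec)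
    qed
    define F where "F = at f within S"
    define D where "D i g = cmod (g i - f i) * nrm (unit_vec d i)" for i and g :: "nat \<Rightarrow> complex"
    have D: "(D i \<longlongrightarrow> D i f) F" for i
    proof -
      have "((\<lambda>g. g i - f i) \<longlongrightarrow> f i - f i) F" unfolding F_def by (rule tendsto_diff[OF coord tendsto_const])
      from tendsto_mult[OF tendsto_norm[OF this] tendsto_const, of "nrm (unit_vec d i)"]
      show ?thesis unfolding D_def .
    qed
    have "((\<lambda>g. \<Sum>i<d. D i g) \<longlongrightarrow> (\<Sum>i<d. D i f)) F"
      by (rule tendsto_sum[of "{..<d}" D "\<lambda>i. D i f" F, OF D])
    hence lim: "((\<lambda>g. \<Sum>i<d. D i g) \<longlongrightarrow> 0) F" by (simp add: D_def)
    have "((\<lambda>g. N g - N f) \<longlongrightarrow> 0) F"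
    proof (rule Lim_null_comparison[OF always_eventually lim], rule allI)
      fix g show "norm (N g - N f) \<le> (\<Sum>i<d. D i g)" using diff[of g f] by (simp add: D_def)
    qed
    thus "(N \<longlongrightarrow> N f) (at f within S)" unfolding F_def by (rule LIM_zero_cancel)
  qed
  have "(\<lambda>i. if i = 0 then 1 else 0) \<in> S" using d by (auto simp: S_def)
  hence "S \<noteq> {}" by blast
  from continuous_attains_inf[OF S this Ncont]
  obtain f0 where f0: "f0 \<in> S" "\<And>f. f \<in> S \<Longrightarrow> N f0 \<le> N f" by blast
  have "N f0 > 0"
  proof -
    obtain i where i: "i < d" "cmod (f0 i) = 1" using f0(1) by (auto simp: S_def)
    have "vec d f0 \<noteq> 0\<^sub>v d"
    proof
      assume "vec d f0 = 0\<^sub>v d"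
      hence "vec d f0 $ i = 0\<^sub>v d $ i" by simp
      thus False using i by auto
    qed
    thus ?thesis using Npos[of "vec d f0"] by (simp add: N_def order_less_le)
  qed
  show ?thesis
  proof (intro exI[of _ "1 / N f0"] conjI ballI allI impI)
    show "1 / N f0 > 0" using \<open>N f0 > 0\<close> by simp
    fix x :: "complex Matrix.vec" and i assume x: "x \<in> carrier_vec d" and i: "i < d"
    define M where "M = Max ((\<lambda>i. cmod (x $ i)) ` {..<d})"
    have Mi: "cmod (x $ i) \<le> M" if "i < d" for i unfolding M_def using that by (intro Max_ge) auto
    have "M \<in> (\<lambda>i. cmod (x $ i)) ` {..<d}" unfolding M_def using d by (intro Max_in) (auto simp: lessThan_empty_iff)
    then obtain i0 where i0: "i0 < d" "cmod (x $ i0) = M" by auto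
    have "N f0 * M \<le> nrm x"
    proof (cases "M = 0")
      case True
      thus ?thesis using Npos(1)[OF x] by simp
    next
      case False
      hence M: "M > 0" using order.trans[OF norm_ge_zero Mi[OF i]] by simp
      define f where "f i = (if i < d then x $ i / of_real M else 0)" for i
      have "f \<in> S" using M Mi i0 by (auto simp: S_def f_def norm_divide intro!: bexI[of _ i0])
      hence "N f0 \<le> N f" by (rule f0)
      also have "vec d f = (1 / of_real M) \<cdot>\<^sub>v x" using x by (intro eq_vecI) (auto simp: f_def)
      hence "N f = nrm x / M" using Nc[OF x, of "1 / of_real M"] M by (simp add: N_def norm_divide)
      finally show ?thesis using M by (simp add: field_simps)
    qed
    hence "N f0 * cmod (x $ i) \<le> nrm x" using Mi[OF i] \<open>N f0 > 0\<close> by (meson less_imp_le mult_left_mono order.trans)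
    thus "cmod (x $ i) \<le> 1 / N f0 * nrm x" using \<open>N f0 > 0\<close> by (simp add: field_simps)
  qed
qed

text \<open>
The supremum that defines the induced norm is over a bounded set by the equivalence of norms.
\<close>
lemma norm_mult_vec_le_induced:
  assumes nrm: "is_vector_norm d nrm" and d: "d \<ge> 1" and M: "M \<in> carrier_mat d d" and x: "x \<in> carrier_vec d"
  shows "nrm (M *\<^sub>v x) \<le> induced_norm d nrm M * nrm x"
proof -
  have Npos: "\<And>x. x \<in> carrier_vec d \<Longrightarrow> nrm x \<ge> 0" "\<And>x. x \<in> carrier_vec d \<Longrightarrow> nrm x = 0 \<longleftrightarrow> x = 0\<^sub>v d"
    and Nc: "\<And>c x. x \<in> carrier_vec d \<Longrightarrow> nrm (c \<cdot>\<^sub>v x) = cmod c * nrm x"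
    using nrm unfolding is_vector_norm_def by auto
  obtain c where c: "c > 0" "\<And>x i. x \<in> carrier_vec d \<Longrightarrow> i < d \<Longrightarrow> cmod (x $ i) \<le> c * nrm x"
    using coordinates_le_norm[OF nrm d] by blast
  have bdd: "bdd_above ((\<lambda>x. nrm (M *\<^sub>v x)) ` {x \<in> carrier_vec d. nrm x = 1})"
  proof (rule bdd_aboveI2)
    fix x :: "complex Matrix.vec" assume "x \<in> {x \<in> carrier_vec d. nrm x = 1}"
    hence x: "x \<in> carrier_vec d" "nrm x = 1" by auto
    have Mx: "M *\<^sub>v x \<in> carrier_vec d" using M x by simp
    have "nrm (M *\<^sub>v x) \<le> (\<Sum>i<d. cmod ((M *\<^sub>v x) $ i) * nrm (unit_vec d i))"
      by (rule norm_le_coordinates[OF nrm Mx])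
    also have "\<dots> \<le> (\<Sum>i<d. (\<Sum>j<d. cmod (M $$ (i, j)) * c) * nrm (unit_vec d i))"
    proof (intro sum_mono mult_right_mono Npos(1))
      fix i assume i: "i \<in> {..<d}"
      have "(M *\<^sub>v x) $ i = (\<Sum>j<d. M $$ (i, j) * x $ j)"
        using M x i by (simp add: scalar_prod_def atLeast0LessThan)
      also have "cmod \<dots> \<le> (\<Sum>j<d. cmod (M $$ (i, j)) * c)"
        using c(2)[OF x(1)] x(2) by (intro sum_norm_le) (auto simp: norm_mult intro!: mult_left_mono)
      finally show "cmod ((M *\<^sub>v x) $ i) \<le> (\<Sum>j<d. cmod (M $$ (i, j)) * c)" .
    qed simp
    finally show "nrm (M *\<^sub>v x) \<le> (\<Sum>i<d. (\<Sum>j<d. cmod (M $$ (i, j)) * c) * nrm (unit_vec d i))" .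
  qed
  show ?thesis
  proof (cases "nrm x = 0")
    case True
    hence "x = 0\<^sub>v d" using Npos(2)[OF x] by simp
    hence "M *\<^sub>v x = 0\<^sub>v d" using M by auto
    thus ?thesis using True Npos(2)[of "0\<^sub>v d"] by simp
  next
    case False
    hence n: "nrm x > 0" using Npos(1)[OF x] by simp
    define e where "e = (1 / of_real (nrm x)) \<cdot>\<^sub>v x"
    have e: "e \<in> carrier_vec d" using x by (simp add: e_def)
    have "nrm e = 1" using Nc[OF x, of "1 / of_real (nrm x)"] n by (simp add: e_def norm_divide)
    hence "nrm (M *\<^sub>v e) \<le> induced_norm d nrm M"
      unfolding induced_norm_def using e by (intro cSUP_upper[OF _ bdd]) auto
    moreover have "M *\<^sub>v e = (1 / of_real (nrm x)) \<cdot>\<^sub>v (M *\<^sub>v x)"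
      unfolding e_def by (rule mult_mat_vec[OF M x])
    hence "nrm (M *\<^sub>v e) = nrm (M *\<^sub>v x) / nrm x"
      using Nc[of "M *\<^sub>v x" "1 / of_real (nrm x)"] M x n by (simp add: norm_divide)
    ultimately show ?thesis using n by (simp add: field_simps)
  qed
qed

lemma mat_product_carrier:
  assumes "\<And>r. r < q \<Longrightarrow> A r \<in> carrier_mat d d" "set rs \<subseteq> {..<q}"
  shows "mat_product d A rs \<in> carrier_mat d d"
  using assms(2) by (induction rs) (auto simp: mat_product_def intro!: mult_carrier_mat assms(1))

lemma product_orbit_bound:
  assumes nrm: "is_vector_norm d nrm" and d: "d \<ge> 1" and A: "\<And>r. r < q \<Longrightarrow> A r \<in> carrier_mat d d"
    and growth: "\<exists>K. \<forall>rs. set rs \<subseteq> {..<q} \<longrightarrow> induced_norm d nrm (mat_product d A rs) \<le> K * R ^ length rs"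
    and x: "x \<in> carrier_vec d"
  shows "\<exists>K. \<forall>rs. set rs \<subseteq> {..<q} \<longrightarrow> (\<forall>i<d. cmod ((mat_product d A rs *\<^sub>v x) $ i) \<le> K * R ^ length rs)"
proof -
  obtain c where c: "c > 0" "\<And>x i. x \<in> carrier_vec d \<Longrightarrow> i < d \<Longrightarrow> cmod (x $ i) \<le> c * nrm x"
    using coordinates_le_norm[OF nrm d] by blast
  obtain K where K: "\<And>rs. set rs \<subseteq> {..<q} \<Longrightarrow> induced_norm d nrm (mat_product d A rs) \<le> K * R ^ length rs"
    using growth by blast
  have x0: "nrm x \<ge> 0" using nrm x unfolding is_vector_norm_def by auto
  show ?thesis
  proof (intro exI allI impI)
    fix rs i assume rs: "set rs \<subseteq> {..<q}" and i: "i < d"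
    note M = mat_product_carrier[of q A, OF A rs]
    have "cmod ((mat_product d A rs *\<^sub>v x) $ i) \<le> c * nrm (mat_product d A rs *\<^sub>v x)"
      using M x i by (intro c) auto
    also have "\<dots> \<le> c * (induced_norm d nrm (mat_product d A rs) * nrm x)"
      using c by (intro mult_left_mono norm_mult_vec_le_induced[OF nrm d M x]) auto
    also have "\<dots> \<le> c * ((K * R ^ length rs) * nrm x)"
      using c x0 K[OF rs] by (intro mult_left_mono mult_right_mono) auto
    finally show "cmod ((mat_product d A rs *\<^sub>v x) $ i) \<le> (c * K * nrm x) * R ^ length rs" by (simp add: mult_ac)
  qed
qed

locale regular_sequence =
  fixes q d :: nat and A :: "nat \<Rightarrow> complex Matrix.mat" and v :: "nat \<Rightarrow> complex Matrix.vec"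
  assumes q: "q \<ge> 2" and d: "d \<ge> 1"
    and A: "\<And>r. r < q \<Longrightarrow> A r \<in> carrier_mat d d"
    and v: "\<And>n. v n \<in> carrier_vec d"
    and rec: "\<And>n r. r < q \<Longrightarrow> v (q * n + r) = A r *\<^sub>v v n"
begin

text \<open>
The digits of n are used with the least significant one first; the inequality bounds their number.
\<close>
lemma digit_expansion:
  "\<exists>rs. set rs \<subseteq> {..<q} \<and> v n = mat_product d A rs *\<^sub>v v 0 \<and> (n \<ge> 1 \<longrightarrow> rs \<noteq> [] \<and> q ^ (length rs - 1) \<le> n)"
proof (induction n rule: less_induct)
  case (less n)
  show ?case
  proof (cases "n = 0")
    case True
    thus ?thesis using v by (intro exI[of _ "[]"]) (simp add: mat_product_def)
  next
    case False
    define n' r where "n' = n div q" and "r = n mod q"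
    have n: "n = q * n' + r" "r < q" using q by (auto simp: n'_def r_def)
    have "n' < n" using False q by (simp add: n'_def)
    from less.IH[OF this] obtain rs where rs: "set rs \<subseteq> {..<q}" "v n' = mat_product d A rs *\<^sub>v v 0"
      "n' \<ge> 1 \<longrightarrow> rs \<noteq> [] \<and> q ^ (length rs - 1) \<le> n'" by blast
    show ?thesis
    proof (cases "n' = 0")
      case True
      have "v n = A r *\<^sub>v v 0" using rec[OF n(2), of 0] n True by simp
      also have "\<dots> = mat_product d A [r] *\<^sub>v v 0" using A[OF n(2)] by (simp add: mat_product_def)
      finally show ?thesis using n False by (intro exI[of _ "[r]"]) auto
    next
      case n': False
      have "v n = A r *\<^sub>v (mat_product d A rs *\<^sub>v v 0)" using rec[OF n(2), of n'] n rs by simp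
      also have "\<dots> = mat_product d A (r # rs) *\<^sub>v v 0"
        using assoc_mult_mat_vec[OF A[OF n(2)] mat_product_carrier[of q A, OF A rs(1)] v[of 0]] by (simp add: mat_product_def)
      finally have "v n = mat_product d A (r # rs) *\<^sub>v v 0" .
      moreover have "q ^ (length (r # rs) - 1) \<le> n"
      proof -
        have "rs \<noteq> []" "q ^ (length rs - 1) \<le> n'" using rs(3) n' by auto
        hence "q ^ length rs = q * q ^ (length rs - 1)" by (cases rs) auto
        also have "\<dots> \<le> q * n'" using \<open>q ^ (length rs - 1) \<le> n'\<close> by simp
        also have "\<dots> \<le> n" using n by simp
        finally show ?thesis by simp
      qed
      ultimately show ?thesis using rs n by (intro exI[of _ "r # rs"]) auto
    qed
  qed
qed

text \<open>
As v(0) = A_0 v(0), the vector v(0) is its own image under the powers of A_0, which tend to 0.  Every v(n) is the image of v(0) under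
a product of matrices.
\<close>
lemma vanishing:
  assumes R: "0 < R" "R < 1" and K: "\<forall>rs. set rs \<subseteq> {..<q} \<longrightarrow> (\<forall>i<d. cmod ((mat_product d A rs *\<^sub>v v 0) $ i) \<le> K * R ^ length rs)"
  shows "v n = 0\<^sub>v d"
proof -
  have A0: "A 0 \<in> carrier_mat d d" using A[of 0] q by simp
  have it: "mat_product d A (replicate L 0) *\<^sub>v v 0 = v 0" for L
  proof (induction L)
    case 0
    show ?case using v by (simp add: mat_product_def)
  next
    case (Suc L)
    have "set (replicate L 0) \<subseteq> {..<q}" using q by auto
    from assoc_mult_mat_vec[OF A0 mat_product_carrier[of q A, OF A this] v[of 0]]
    have "mat_product d A (replicate (Suc L) 0) *\<^sub>v v 0 = A 0 *\<^sub>v v 0"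
      using Suc by (simp add: mat_product_def)
    also have "\<dots> = v 0" using rec[of 0 0] q by simp
    finally show ?case .
  qed
  have v0: "v 0 = 0\<^sub>v d"
  proof (rule eq_vecI)
    fix i assume "i < dim_vec (0\<^sub>v d :: complex vec)"
    hence i: "i < d" by simp
    have "cmod (v 0 $ i) \<le> K * R ^ L" for L
    proof -
      have "set (replicate L 0) \<subseteq> {..<q}" using q by auto
      thus ?thesis using K i it[of L] by (metis length_replicate)
    qed
    moreover have "(\<lambda>L. K * R ^ L) \<longlonglongrightarrow> K * 0" using R by (intro tendsto_intros LIMSEQ_power_zero) auto
    ultimately have "cmod (v 0 $ i) \<le> K * 0" by (intro tendsto_lowerbound[of "\<lambda>L. K * R ^ L" _ sequentially]) auto
    thus "v 0 $ i = 0\<^sub>v d $ i" using i by simp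
  qed (use v[of 0] in auto)
  obtain rs where "set rs \<subseteq> {..<q}" "v n = mat_product d A rs *\<^sub>v v 0" using digit_expansion by blast
  moreover from this(1) have M: "mat_product d A rs \<in> carrier_mat d d" by (intro mat_product_carrier[of q A d rs] A)
  have "mat_product d A rs *\<^sub>v 0\<^sub>v d = 0\<^sub>v d" using M by auto
  ultimately show ?thesis using v0 by simp
qed

text \<open>
The number of digits of n is at most 1 + log_q n.
\<close>
lemma coordinate_growth:
  assumes R: "R \<ge> 1" and K: "\<forall>rs. set rs \<subseteq> {..<q} \<longrightarrow> (\<forall>i<d. cmod ((mat_product d A rs *\<^sub>v v 0) $ i) \<le> K * R ^ length rs)"
    and i: "i < d"
  shows "polynomially_bounded (log q R) (\<lambda>n. v n $ i)"
  unfolding polynomially_bounded_def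
proof (intro exI allI impI)
  fix n :: nat assume n: "n \<ge> 1"
  obtain rs where rs: "set rs \<subseteq> {..<q}" "v n = mat_product d A rs *\<^sub>v v 0" "rs \<noteq> []" "q ^ (length rs - 1) \<le> n"
    using digit_expansion[of n] n by blast
  have "K * R ^ length ([] :: nat list) \<ge> 0"
    using order.trans[OF norm_ge_zero K[THEN spec, THEN mp, THEN spec, THEN mp, of "[]" i]] i by simp
  hence K0: "K \<ge> 0" by simp
  define \<rho> where "\<rho> = log q R"
  have rho: "\<rho> \<ge> 0" "real q powr \<rho> = R" using R q by (auto simp: \<rho>_def)
  have "R ^ length rs = R * R ^ (length rs - 1)" using rs(3) by (cases rs) auto
  also have "R ^ (length rs - 1) = (real q ^ (length rs - 1)) powr \<rho>"
  proof -
    define L where "L = length rs - 1"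
    have "(real q ^ L) powr \<rho> = (real q powr real L) powr \<rho>" using q by (simp add: powr_realpow)
    also have "\<dots> = (real q powr \<rho>) powr real L" by (simp add: powr_powr mult.commute)
    also have "\<dots> = R ^ L" using R unfolding rho(2) by (simp add: powr_realpow)
    finally show ?thesis by (simp add: L_def)
  qed
  also have "\<dots> \<le> real n powr \<rho>"
    using rho rs(4) by (intro powr_mono2) (auto simp flip: of_nat_power)
  finally have le: "R ^ length rs \<le> R * real n powr \<rho>" using R by simp
  have "cmod (v n $ i) \<le> K * R ^ length rs" using K rs i by simp
  also have "\<dots> \<le> K * (R * real n powr \<rho>)" using K0 le by (intro mult_left_mono)
  finally show "cmod (v n $ i) \<le> (K * R) * real n powr log q R" by (simp add: \<rho>_def)
qed

text \<open>
The row vector w applied to the sum of the v(n) with n < N.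
\<close>
definition functional_sum :: "(nat \<Rightarrow> complex) \<Rightarrow> nat \<Rightarrow> complex" where
  "functional_sum w N = (\<Sum>n<N. \<Sum>i<d. w i * v n $ i)"

text \<open>
Every n < qN is q n' + r with n' < N, so the row vector is multiplied by C from the right.
\<close>
lemma functional_sum_scale:
  "functional_sum w (q * N) = functional_sum (\<lambda>j. \<Sum>i<d. w i * mat_sum d A q $$ (i, j)) N"
proof -
  have vr: "v (q * n + r) $ i = (\<Sum>j<d. A r $$ (i, j) * v n $ j)" if "r < q" "i < d" for n r i
    using rec[OF that(1), of n] A[OF that(1)] v[of n] that(2) by (simp add: scalar_prod_def atLeast0LessThan)
  have blk: "(\<Sum>n<q * N. f n) = (\<Sum>n<N. \<Sum>r<q. f (q * n + r))" for f :: "nat \<Rightarrow> complex"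
  proof (induction N)
    case (Suc N)
    have "(\<Sum>n<q * Suc N. f n) = (\<Sum>n<q * N. f n) + (\<Sum>r<q. f (q * N + r))"
      using sum.nat_group[of f q N] sum.nat_group[of f q "Suc N"] sum.shift_bounds_nat_ivl[of f 0 "q * N" q]
      by (simp add: atLeast0LessThan mult.commute add_ac)
    thus ?case using Suc by simp
  qed simp
  have "functional_sum w (q * N) = (\<Sum>n<N. \<Sum>r<q. \<Sum>i<d. w i * (\<Sum>j<d. A r $$ (i, j) * v n $ j))"
    unfolding functional_sum_def blk by (intro sum.cong refl) (simp add: vr)
  also have "\<dots> = (\<Sum>n<N. \<Sum>j<d. (\<Sum>i<d. w i * mat_sum d A q $$ (i, j)) * v n $ j)"
  proof (rule sum.cong[OF refl])
    fix n
    have "(\<Sum>r<q. \<Sum>i<d. w i * (\<Sum>j<d. A r $$ (i, j) * v n $ j)) =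
          (\<Sum>i<d. \<Sum>r<q. \<Sum>j<d. w i * A r $$ (i, j) * v n $ j)"
      by (subst sum.swap) (simp add: sum_distrib_left mult.assoc)
    also have "\<dots> = (\<Sum>i<d. \<Sum>j<d. \<Sum>r<q. w i * A r $$ (i, j) * v n $ j)"
      by (intro sum.cong refl sum.swap)
    also have "\<dots> = (\<Sum>j<d. \<Sum>i<d. \<Sum>r<q. w i * A r $$ (i, j) * v n $ j)"
      by (rule sum.swap)
    also have "\<dots> = (\<Sum>j<d. (\<Sum>i<d. w i * mat_sum d A q $$ (i, j)) * v n $ j)"
      by (intro sum.cong refl) (simp add: mat_sum_def sum_distrib_left sum_distrib_right)
    finally show "(\<Sum>r<q. \<Sum>i<d. w i * (\<Sum>j<d. A r $$ (i, j) * v n $ j)) = (\<Sum>j<d. (\<Sum>i<d. w i * mat_sum d A q $$ (i, j)) * v n $ j)" .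
  qed
  finally show ?thesis by (simp add: functional_sum_def)
qed

lemma functional_sum_combine:
  "functional_sum (\<lambda>j. \<Sum>i\<in>I. c i * w i j) N = (\<Sum>i\<in>I. c i * functional_sum (w i) N)"
proof -
  have "functional_sum (\<lambda>j. \<Sum>i\<in>I. c i * w i j) N = (\<Sum>n<N. \<Sum>j<d. \<Sum>i\<in>I. c i * (w i j * v n $ j))"
    by (simp add: functional_sum_def sum_distrib_left sum_distrib_right mult_ac)
  also have "\<dots> = (\<Sum>n<N. \<Sum>i\<in>I. \<Sum>j<d. c i * (w i j * v n $ j))"
    by (intro sum.cong refl sum.swap)
  also have "\<dots> = (\<Sum>i\<in>I. \<Sum>n<N. \<Sum>j<d. c i * (w i j * v n $ j))" by (rule sum.swap)
  finally show ?thesis by (simp add: functional_sum_def sum_distrib_left)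
qed

end

lemma funpow_qdiff_zero:
  fixes y :: "nat \<Rightarrow> complex"
  assumes "n \<le> m" "\<And>N. (qdiff q l ^^ n) y N = 0"
  shows "(qdiff q l ^^ m) y N = 0"
proof -
  have "(qdiff q l ^^ n) y = (\<lambda>_. 0)" using assms(2) by auto
  moreover have "(qdiff q l ^^ k) (\<lambda>_::nat. 0) = (\<lambda>_. 0)" for k
    by (induction k) (auto simp: qdiff_def fun_eq_iff)
  moreover have "(qdiff q l ^^ m) y = (qdiff q l ^^ (m - n)) ((qdiff q l ^^ n) y)"
    using assms(1) by (simp flip: funpow_add[THEN fun_cong, unfolded o_apply])
  ultimately show ?thesis by simp
qed

lemma funpow_qdiff_sum:
  assumes "finite I"
  shows "(qdiff q l ^^ n) (\<lambda>N. \<Sum>i\<in>I. c i * y i N) = (\<lambda>N. \<Sum>i\<in>I. c i * (qdiff q l ^^ n) (y i) N)"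
proof (induction n)
  case (Suc n)
  show ?case unfolding funpow.simps comp_def Suc
    by (auto simp: qdiff_def fun_eq_iff sum_subtractf sum_distrib_left algebra_simps)
qed auto

text \<open>
Within a Jordan block of size n, T maps each sequence to the next one and the last one to 0.
\<close>
lemma jordan_chain:
  fixes y :: "nat \<Rightarrow> nat \<Rightarrow> complex"
  assumes "\<And>i N. i < sum_list (map fst n_as) \<Longrightarrow>
     y i (q * N) = (\<Sum>j<sum_list (map fst n_as). jordan_matrix n_as $$ (i, j) * y j N)"
    and "i < sum_list (map fst n_as)"
  shows "\<exists>n l. (n, l) \<in> set n_as \<and> (\<forall>N. (qdiff q l ^^ n) (y i) N = 0)"
  using assms
proof (induction n_as arbitrary: y i)
  case Nil
  thus ?case by simp
next
  case (Cons na n_as)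
  obtain n a where na: "na = (n, a)" by force
  define M where "M = sum_list (map fst n_as)"
  define J where "J = jordan_matrix n_as"
  have Jdim: "dim_row J = M" "dim_col J = M" by (simp_all add: J_def M_def)
  have tot: "sum_list (map fst (na # n_as)) = n + M" by (simp add: na M_def)
  have ent: "jordan_matrix (na # n_as) $$ (i, j) =
     (if i < n then (if j < n then jordan_block n a $$ (i, j) else 0) else if j < n then 0 else J $$ (i - n, j - n))"
    if "i < n + M" "j < n + M" for i j
    using that unfolding na jordan_matrix_Cons M_def[symmetric] J_def[symmetric]
    by (subst index_mat_four_block) (auto simp: Jdim)
  have split: "(\<Sum>j<n + M. f j) = (\<Sum>j<n. f j) + (\<Sum>j<M. f (n + j))" for f :: "nat \<Rightarrow> complex"
    using sum.nat_group[of f] sum.atLeastLessThan_concat[of 0 n "n + M" f] sum.shift_bounds_nat_ivl[of f 0 n M]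
    by (simp add: atLeast0LessThan add.commute)
  have rel: "y i (q * N) = (\<Sum>j<n + M. jordan_matrix (na # n_as) $$ (i, j) * y j N)" if "i < n + M" for i N
    using Cons.prems(1)[of i N] that unfolding tot by blast
  have first: "y i (q * N) = a * y i N + (if Suc i < n then y (Suc i) N else 0)" if "i < n" for i N
  proof -
    have "y i (q * N) = (\<Sum>j<n. jordan_block n a $$ (i, j) * y j N)"
      using that by (simp add: rel split ent)
    also have "\<dots> = (\<Sum>j<n. (if j = i then a * y j N else 0) + (if j = Suc i then y j N else 0))"
      using that by (intro sum.cong refl) auto
    also have "\<dots> = a * y i N + (if Suc i < n then y (Suc i) N else 0)"
      using that by (simp add: sum.distrib)
    finally show ?thesis .
  qed
  show ?case
  proof (cases "i < n")
    case True
    have "(qdiff q a ^^ k) (y i) N = 0" if "i < n" "n - i \<le> k" for i k N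
      using that
    proof (induction k arbitrary: i)
      case (Suc k)
      have "qdiff q a (y i) = (if Suc i < n then y (Suc i) else (\<lambda>_. 0))"
        using first[OF Suc.prems(1)] by (auto simp: qdiff_def fun_eq_iff)
      moreover have "(qdiff q a ^^ k) (\<lambda>_. 0 :: complex) N = 0"
        by (rule funpow_qdiff_zero[of 0]) auto
      moreover have "Suc i < n \<Longrightarrow> (qdiff q a ^^ k) (y (Suc i)) N = 0"
        using Suc.prems by (intro Suc.IH) auto
      ultimately show ?case by (simp add: funpow_Suc_right del: funpow.simps)
    qed auto
    from this[OF True, of n] show ?thesis unfolding na by (intro exI[of _ n] exI[of _ a]) auto
  next
    case False
    have second: "y (n + i) (q * N) = (\<Sum>j<M. J $$ (i, j) * y (n + j) N)" if "i < M" for i N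
      using that by (simp add: rel split ent)
    have "i - n < M" using False Cons.prems(2) by (simp add: na M_def)
    from Cons.IH[of "\<lambda>i. y (n + i)" "i - n"] second this False
    show ?thesis by (auto simp: M_def J_def)
  qed
qed

text \<open>
Block sizes are bounded by the multiplicity of the eigenvalue.  Hence the maximum that defines \<open>max_jordan_block\<close> is
over a finite set and bounds the blocks of every Jordan normal form.
\<close>
lemma jordan_nf_block_le:
  assumes C: "C \<in> carrier_mat d d" and jnf: "jordan_nf C n_as" and mem: "(n, l) \<in> set n_as"
  shows "n \<le> max_jordan_block C l" "l \<in> spectrum C"
proof -
  have char0: "char_poly C \<noteq> 0" using degree_monic_char_poly[OF C] by auto
  have "finite {n. \<exists>n_as. jordan_nf C n_as \<and> (n, l) \<in> set n_as}"
    by (rule finite_subset[of _ "{..order l (char_poly C)}"]) (auto dest: jordan_nf_block_size_order_bound)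
  thus "n \<le> max_jordan_block C l" unfolding max_jordan_block_def using jnf mem by (intro Max_ge) auto
  have "n \<noteq> 0" using jnf mem unfolding jordan_nf_def by force
  hence "order l (char_poly C) \<noteq> 0" using jordan_nf_block_size_order_bound[OF jnf mem] by simp
  hence "poly (char_poly C) l = 0" using char0 by (simp add: order_root)
  thus "l \<in> spectrum C" by (simp add: spectrum_root_char_poly[OF C])
qed

lemma max_jordan_block_le:
  assumes C: "C \<in> carrier_mat d d"
  shows "max_jordan_block C l \<le> d"
proof -
  have n: "n \<le> d" if "jordan_nf C n_as" "(n, l) \<in> set n_as" for n n_as
  proof -
    have "n \<le> order l (char_poly C)" by (rule jordan_nf_block_size_order_bound[OF that])
    also have "\<dots> \<le> degree (char_poly C)" using degree_monic_char_poly[OF C] by (intro order_degree) auto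
    finally show ?thesis using degree_monic_char_poly[OF C] by simp
  qed
  have "finite {n. \<exists>n_as. jordan_nf C n_as \<and> (n, l) \<in> set n_as}"
    by (rule finite_subset[of _ "{..d}"]) (auto dest: n)
  thus ?thesis unfolding max_jordan_block_def by (subst Max_le_iff) (auto dest: n)
qed

context regular_sequence
begin

text \<open>
For a Jordan normal form C = P J Q with P Q = I, the rows of Q form Jordan chains for the multiplication by C from
the right, and the first row of P gives the coefficients of the first unit vector in terms of them.
\<close>
theorem spectral_decomposition:
  defines "C \<equiv> mat_sum d A q"
  shows "\<exists>w. \<forall>N. (\<Sum>n<N. v n $ 0) = (\<Sum>l\<in>spectrum C. functional_sum (w l) N) \<and>
     (\<forall>l. (qdiff q l ^^ max_jordan_block C l) (functional_sum (w l)) N = 0)"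
proof -
  have C: "C \<in> carrier_mat d d" by (simp add: C_def mat_sum_def)
  obtain as where "char_poly C = (\<Prod>a\<leftarrow>as. [:- a, 1:])" using char_poly_factorized[OF C] by blast
  from jordan_nf_exists[OF C this] obtain n_as where jnf: "jordan_nf C n_as" by blast
  define J where "J = jordan_matrix n_as"
  from jnf obtain P Q where wit: "similar_mat_wit C J P Q"
    unfolding jordan_nf_def similar_mat_def J_def by blast
  have dimC: "dim_row C = d" using C by simp
  from wit have car: "J \<in> carrier_mat d d" "P \<in> carrier_mat d d" "Q \<in> carrier_mat d d"
    and PQ: "P * Q = 1\<^sub>m d" "Q * P = 1\<^sub>m d" and CPJQ: "C = P * J * Q"
    unfolding similar_mat_wit_def Let_def dimC by auto
  have dimJ: "sum_list (map fst n_as) = d" using carrier_matD(1)[OF car(1)] by (simp add: J_def)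
  have ent: "(X * Y) $$ (i, j) = (\<Sum>k<d. X $$ (i, k) * Y $$ (k, j))"
    if "X \<in> carrier_mat d d" "Y \<in> carrier_mat d d" "i < d" "j < d" for X Y :: "complex mat" and i j
    using that by (simp add: scalar_prod_def atLeast0LessThan)
  have "Q * C = Q * (P * (J * Q))" using car unfolding CPJQ by (subst assoc_mult_mat[of P d d J d Q d]) auto
  also have "\<dots> = (Q * P) * (J * Q)" using car by (subst assoc_mult_mat[of Q d d P d "J * Q" d]) auto
  also have "\<dots> = J * Q" using car unfolding PQ by simp
  finally have QC: "Q * C = J * Q" .
  define p where "p i j = Q $$ (i, j)" for i j
  have cong: "functional_sum w N = functional_sum w' N" if "\<And>j. j < d \<Longrightarrow> w j = w' j" for w w' N
    unfolding functional_sum_def using that by (intro sum.cong refl) auto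
  have rel: "functional_sum (p i) (q * N) = (\<Sum>j<d. J $$ (i, j) * functional_sum (p j) N)" if i: "i < d" for i N
  proof -
    have "functional_sum (p i) (q * N) = functional_sum (\<lambda>j. \<Sum>k<d. p i k * C $$ (k, j)) N"
      by (simp add: functional_sum_scale C_def)
    also have "\<dots> = functional_sum (\<lambda>j. \<Sum>k<d. J $$ (i, k) * p k j) N"
    proof (rule cong)
      fix j assume j: "j < d"
      have "(Q * C) $$ (i, j) = (J * Q) $$ (i, j)" by (simp add: QC)
      thus "(\<Sum>k<d. p i k * C $$ (k, j)) = (\<Sum>k<d. J $$ (i, k) * p k j)"
        unfolding ent[OF car(3) C i j] ent[OF car(1,3) i j] p_def .
    qed
    finally show ?thesis by (simp add: functional_sum_combine)
  qed
  have "\<exists>nl. i < d \<longrightarrow> nl \<in> set n_as \<and> (\<forall>N. (qdiff q (snd nl) ^^ fst nl) (functional_sum (p i)) N = 0)" for i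
    using jordan_chain[of n_as "\<lambda>i. functional_sum (p i)" q i] rel unfolding dimJ J_def[symmetric]
    by (cases "i < d") auto
  then obtain nl where nl: "\<And>i. i < d \<Longrightarrow> nl i \<in> set n_as"
     "\<And>i N. i < d \<Longrightarrow> (qdiff q (snd (nl i)) ^^ fst (nl i)) (functional_sum (p i)) N = 0"
    using choice[of "\<lambda>i nl. i < d \<longrightarrow> nl \<in> set n_as \<and> (\<forall>N. (qdiff q (snd nl) ^^ fst nl) (functional_sum (p i)) N = 0)"] by blast
  define I where "I l = {i. i < d \<and> snd (nl i) = l}" for l
  define w where "w l j = (\<Sum>i\<in>I l. P $$ (0, i) * p i j)" for l j
  have fin: "finite (I l)" for l by (simp add: I_def)
  have w: "functional_sum (w l) = (\<lambda>N. \<Sum>i\<in>I l. P $$ (0, i) * functional_sum (p i) N)" for l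
    by (rule ext) (simp add: w_def[abs_def] functional_sum_combine)
  have spec: "snd (nl i) \<in> spectrum C" "fst (nl i) \<le> max_jordan_block C (snd (nl i))" if "i < d" for i
    using jordan_nf_block_le[OF C jnf, of "fst (nl i)" "snd (nl i)"] nl(1)[OF that] by auto
  show ?thesis
  proof (intro exI[of _ w] allI conjI)
    fix N
    have "(\<Sum>n<N. v n $ 0) = functional_sum (\<lambda>j. if j = 0 then 1 else 0) N"
      unfolding functional_sum_def using d by (intro sum.cong refl) (simp add: if_distrib[of "\<lambda>x. x * _"] cong: if_cong)
    also have "\<dots> = functional_sum (\<lambda>j. \<Sum>i<d. P $$ (0, i) * p i j) N"
    proof (rule cong)
      fix j assume j: "j < d"
      have "(P * Q) $$ (0, j) = (\<Sum>i<d. P $$ (0, i) * p i j)"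
        unfolding p_def using d by (intro ent[OF car(2,3) _ j]) auto
      thus "(if j = 0 then 1 else 0) = (\<Sum>i<d. P $$ (0, i) * p i j)" unfolding PQ using d j by auto
    qed
    also have "\<dots> = (\<Sum>i<d. P $$ (0, i) * functional_sum (p i) N)" by (rule functional_sum_combine)
    also have "\<dots> = (\<Sum>l\<in>spectrum C. \<Sum>i\<in>{i \<in> {..<d}. snd (nl i) = l}. P $$ (0, i) * functional_sum (p i) N)"
      using spec(1) card_finite_spectrum(1)[OF C] by (intro sum.group[symmetric]) auto
    also have "\<dots> = (\<Sum>l\<in>spectrum C. functional_sum (w l) N)" by (simp add: w I_def)
    finally show "(\<Sum>n<N. v n $ 0) = (\<Sum>l\<in>spectrum C. functional_sum (w l) N)" .
    fix l
    have "(qdiff q l ^^ max_jordan_block C l) (functional_sum (p i)) N = 0" if "i \<in> I l" for i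
    proof -
      have i: "i < d" "snd (nl i) = l" using that by (simp_all add: I_def)
      show ?thesis by (rule funpow_qdiff_zero[OF spec(2)[OF i(1), unfolded i(2)] nl(2)[OF i(1), unfolded i(2)]])
    qed
    thus "(qdiff q l ^^ max_jordan_block C l) (functional_sum (w l)) N = 0"
      unfolding w funpow_qdiff_sum[OF fin] by simp
  qed
qed

lemma functional_sum_slow:
  assumes rho: "\<rho> \<ge> 0" and bd: "\<And>i. i < d \<Longrightarrow> polynomially_bounded \<rho> (\<lambda>n. v n $ i)"
  shows "\<exists>K. \<forall>N. cmod (functional_sum w (Suc N) - functional_sum w N) \<le> K * (1 + real N) powr \<rho>"
proof -
  have "\<exists>K. \<forall>n. cmod (v n $ i) \<le> K * (1 + real n) powr \<rho>" if i: "i < d" for i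
  proof -
    obtain K where K: "\<And>n. n \<ge> 1 \<Longrightarrow> cmod (v n $ i) \<le> K * real n powr \<rho>"
      using bd[OF i] unfolding polynomially_bounded_def by blast
    have K0: "K \<ge> 0" using order.trans[OF norm_ge_zero K[of 1]] by simp
    show ?thesis
    proof (intro exI allI)
      fix n
      have one: "1 \<le> (1 + real n) powr \<rho>" using rho by (intro ge_one_powr_ge_zero) auto
      show "cmod (v n $ i) \<le> (K + cmod (v 0 $ i)) * (1 + real n) powr \<rho>"
      proof (cases "n = 0")
        case True
        thus ?thesis using K0 by simp
      next
        case False
        hence "cmod (v n $ i) \<le> K * real n powr \<rho>" by (intro K) auto
        also have "\<dots> \<le> (K + cmod (v 0 $ i)) * (1 + real n) powr \<rho>"
          using K0 rho by (intro mult_mono powr_mono2) auto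
        finally show ?thesis .
      qed
    qed
  qed
  hence "\<forall>i. \<exists>K. i < d \<longrightarrow> (\<forall>n. cmod (v n $ i) \<le> K * (1 + real n) powr \<rho>)" by blast
  from choice[OF this] obtain K where K: "\<And>i n. i < d \<Longrightarrow> cmod (v n $ i) \<le> K i * (1 + real n) powr \<rho>" by blast
  show ?thesis
  proof (intro exI allI)
    fix N
    have "functional_sum w (Suc N) - functional_sum w N = (\<Sum>i<d. w i * v N $ i)" by (simp add: functional_sum_def)
    also have "cmod \<dots> \<le> (\<Sum>i<d. cmod (w i) * (K i * (1 + real N) powr \<rho>))"
      using K by (intro sum_norm_le) (auto simp: norm_mult intro!: mult_left_mono)
    also have "\<dots> = (\<Sum>i<d. cmod (w i) * K i) * (1 + real N) powr \<rho>" by (simp add: sum_distrib_right mult.assoc)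
    finally show "cmod (functional_sum w (Suc N) - functional_sum w N) \<le> (\<Sum>i<d. cmod (w i) * K i) * (1 + real N) powr \<rho>" .
  qed
qed

end

section \<open>Meromorphic continuation\<close>

lemma det_holomorphic:
  fixes B :: "complex \<Rightarrow> complex mat"
  assumes "\<And>s. B s \<in> carrier_mat n n" "\<And>i j. i < n \<Longrightarrow> j < n \<Longrightarrow> (\<lambda>s. B s $$ (i, j)) holomorphic_on S"
  shows "(\<lambda>s. det (B s)) holomorphic_on S"
proof -
  have "(\<lambda>s. \<Sum>p\<in>{p. p permutes {0..<n}}. signof p * (\<Prod>i=0..<n. B s $$ (i, p i))) holomorphic_on S"
  proof (intro holomorphic_intros)
    fix p i assume p: "p \<in> {p. p permutes {0..<n}}" and i: "i \<in> {0..<n}"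
    hence "p i \<in> {0..<n}" using permutes_in_image[of p "{0..<n}" i] by simp
    thus "(\<lambda>s. B s $$ (i, p i)) holomorphic_on S" using i by (intro assms) auto
  qed
  thus ?thesis by (simp only: det_def'[OF assms(1)])
qed

lemma adj_mat_holomorphic:
  fixes B :: "complex \<Rightarrow> complex mat"
  assumes B: "\<And>s. B s \<in> carrier_mat n n" and hol: "\<And>i j. i < n \<Longrightarrow> j < n \<Longrightarrow> (\<lambda>s. B s $$ (i, j)) holomorphic_on S"
    and ij: "i < n" "j < n"
  shows "(\<lambda>s. adj_mat (B s) $$ (i, j)) holomorphic_on S"
proof -
  have "(\<lambda>s. det (mat_delete (B s) j i)) holomorphic_on S"
  proof (rule det_holomorphic)
    show "mat_delete (B s) j i \<in> carrier_mat (n - 1) (n - 1)" for s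
      using B[of s] by (rule mat_delete_carrier)
    fix i' j' assume i'j': "i' < n - 1" "j' < n - 1"
    have "(\<lambda>s. mat_delete (B s) j i $$ (i', j')) = (\<lambda>s. B s $$ (insert_index j i', insert_index i j'))"
      using i'j' carrier_matD[OF B] by (auto simp: mat_delete_def insert_index_def fun_eq_iff)
    moreover have "insert_index j i' < n" "insert_index i j' < n"
      using i'j' by (auto simp: insert_index_def)
    ultimately show "(\<lambda>s. mat_delete (B s) j i $$ (i', j')) holomorphic_on S" using hol by simp
  qed
  moreover have "adj_mat (B s) $$ (i, j) = (-1) ^ (j + i) * det (mat_delete (B s) j i)" for s
    using B[of s] ij by (simp add: adj_mat_def cofactor_def)
  ultimately show ?thesis by (auto intro!: holomorphic_intros)
qed

lemma polynomially_bounded_combine: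
  assumes "finite J" "\<And>j. j \<in> J \<Longrightarrow> polynomially_bounded \<rho> (a j)"
  shows "polynomially_bounded \<rho> (\<lambda>n. \<Sum>j\<in>J. c j * a j n)"
proof -
  have "\<forall>j. \<exists>K. j \<in> J \<longrightarrow> (\<forall>n\<ge>1. cmod (a j n) \<le> K * real n powr \<rho>)"
    using assms(2) unfolding polynomially_bounded_def by blast
  from choice[OF this] obtain K where K: "\<And>j n. j \<in> J \<Longrightarrow> n \<ge> 1 \<Longrightarrow> cmod (a j n) \<le> K j * real n powr \<rho>" by blast
  show ?thesis unfolding polynomially_bounded_def
  proof (intro exI allI impI)
    fix n :: nat assume "n \<ge> 1"
    hence "cmod (\<Sum>j\<in>J. c j * a j n) \<le> (\<Sum>j\<in>J. cmod (c j) * (K j * real n powr \<rho>))"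
      using K by (intro sum_norm_le) (auto simp: norm_mult intro!: mult_left_mono)
    thus "cmod (\<Sum>j\<in>J. c j * a j n) \<le> (\<Sum>j\<in>J. cmod (c j) * K j) * real n powr \<rho>"
      by (simp add: sum_distrib_right mult.assoc)
  qed
qed

lemma dirichlet_summable:
  assumes "polynomially_bounded \<rho> a" "Re s > \<rho> + 1"
  shows "summable (\<lambda>n. dirichlet_summand a n s)"
  by (rule summable_norm_cancel, rule converges_normallyD(1)[OF dirichlet_normally[OF assms(1)]]) (use assms(2) in simp)

lemma dirichlet_series_combine:
  assumes "\<And>j. j \<in> J \<Longrightarrow> polynomially_bounded \<rho> (a j)" "Re s > \<rho> + 1"
  shows "dirichlet_series (\<lambda>n. \<Sum>j\<in>J. c j * a j n) s = (\<Sum>j\<in>J. c j * dirichlet_series (a j) s)"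
proof -
  have "dirichlet_series (\<lambda>n. \<Sum>j\<in>J. c j * a j n) s = (\<Sum>n. \<Sum>j\<in>J. c j * dirichlet_summand (a j) n s)"
    by (simp add: dirichlet_series_def dirichlet_summand_def sum_distrib_left mult_ac)
  also have "\<dots> = (\<Sum>j\<in>J. \<Sum>n. c j * dirichlet_summand (a j) n s)"
    by (intro suminf_sum summable_mult dirichlet_summable[OF assms(1) assms(2)])
  also have "\<dots> = (\<Sum>j\<in>J. c j * dirichlet_series (a j) s)"
    unfolding dirichlet_series_def
    by (intro sum.cong refl suminf_mult dirichlet_summable[OF assms(1) assms(2)])
  finally show ?thesis .
qed

text \<open>
The growth bound on products of matrices enters the continuation only through this bound on v.
\<close>
locale bounded_regular_sequence = regular_sequence +
  fixes \<rho> :: real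
  assumes bd: "\<And>i. i < d \<Longrightarrow> polynomially_bounded \<rho> (\<lambda>n. v n $ i)"
begin

definition C where "C = mat_sum d A q"

definition coord_series :: "nat \<Rightarrow> complex \<Rightarrow> complex" where "coord_series i = dirichlet_series (\<lambda>n. v n $ i)"

text \<open>
The coordinates of the right-hand side of the functional equation, formed with the series itself and hence defined for Re s > \<rho>.
\<close>
definition rhs :: "nat \<Rightarrow> complex \<Rightarrow> complex" where
  "rhs i s = (\<Sum>n=1..<q. of_nat n powr (- s) * v n $ i) +
     of_nat q powr (- s) * (\<Sum>r<q. \<Sum>j<d. A r $$ (i, j) * (\<Sum>k. binomial_shift (coord_series j) (real r / real q) k s))"

definition resolvent :: "complex \<Rightarrow> complex mat" where
  "resolvent s = 1\<^sub>m d - (of_nat q powr (- s)) \<cdot>\<^sub>m C"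

text \<open>
Cramer's rule.  At zeros of the determinant this has an arbitrary value, which \<open>V\<close> corrects.
\<close>
definition cramer :: "nat \<Rightarrow> complex \<Rightarrow> complex" where
  "cramer i s = (\<Sum>j<d. adj_mat (resolvent s) $$ (i, j) * rhs j s) / det (resolvent s)"

lemma C_carrier: "C \<in> carrier_mat d d" by (simp add: C_def mat_sum_def)

lemma resolvent_carrier: "resolvent s \<in> carrier_mat d d"
  unfolding resolvent_def by (intro minus_carrier_mat smult_carrier_mat C_carrier)

lemma resolvent_index:
  "i < d \<Longrightarrow> j < d \<Longrightarrow> resolvent s $$ (i, j) = (if i = j then 1 else 0) - of_nat q powr (- s) * C $$ (i, j)"
  using C_carrier by (simp add: resolvent_def)

lemma digit_fraction: "r < q \<Longrightarrow> 0 \<le> real r / real q \<and> real r / real q < 1"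
  using q by simp

lemma shift_normally:
  assumes "j < d" "r < q"
  shows "converges_normally_on (binomial_shift (coord_series j) (real r / real q)) {s. Re s > \<rho>}"
  unfolding coord_series_def using digit_fraction[OF assms(2)]
  by (intro binomial_shift_normally dirichlet_series_bounded[OF bd[OF assms(1)]]) auto

lemma shift_summable:
  assumes "j < d" "r < q" "Re s > \<rho>"
  shows "summable (\<lambda>k. binomial_shift (coord_series j) (real r / real q) k s)"
  by (rule summable_norm_cancel, rule converges_normallyD(1)[OF shift_normally[OF assms(1,2)]]) (use assms(3) in simp)

lemma coord_series_holomorphic: "j < d \<Longrightarrow> coord_series j holomorphic_on {s. Re s > \<rho> + 1}"
  unfolding coord_series_def by (intro dirichlet_series_holomorphic bd)

lemma rhs_holomorphic:
  assumes i: "i < d"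
  shows "rhs i holomorphic_on {s. Re s > \<rho>}"
proof -
  have "(\<lambda>s. \<Sum>k. binomial_shift (coord_series j) (real r / real q) k s) holomorphic_on {s. Re s > \<rho>}"
    if "j < d" "r < q" for j r
  proof (rule converges_normally_holomorphic[OF shift_normally[OF that] open_Re_gt])
    fix k
    have "(coord_series j \<circ> (\<lambda>s. s + of_nat (Suc k))) holomorphic_on {s. Re s > \<rho>}"
      by (rule holomorphic_on_compose_gen[OF _ coord_series_holomorphic[OF that(1)]]) (auto intro!: holomorphic_intros)
    hence "(\<lambda>s. coord_series j (s + of_nat (Suc k))) holomorphic_on {s. Re s > \<rho>}" by (simp only: o_def)
    thus "binomial_shift (coord_series j) (real r / real q) k holomorphic_on {s. Re s > \<rho>}"
      unfolding binomial_shift_def[abs_def] gbinomial_prod_rev by (intro holomorphic_intros) auto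
  qed
  thus ?thesis unfolding rhs_def[abs_def] using q by (intro holomorphic_intros) auto
qed

lemma resolvent_mult_coord_series:
  assumes i: "i < d" and s: "Re s > \<rho> + 1"
  shows "(\<Sum>j<d. resolvent s $$ (i, j) * coord_series j s) = rhs i s"
proof -
  define b where "b r n = (\<Sum>j<d. A r $$ (i, j) * v n $ j)" for r n
  have b: "polynomially_bounded \<rho> (b r)" for r
    unfolding b_def[abs_def] by (intro polynomially_bounded_combine bd) auto
  have rec': "v (q * n + r) $ i = b r n" if "r < q" for n r
    using rec[OF that, of n] A[OF that] v[of n] i by (simp add: scalar_prod_def atLeast0LessThan b_def)
  have db: "dirichlet_series (b r) z = (\<Sum>j<d. A r $$ (i, j) * coord_series j z)" if "Re z > \<rho> + 1" for r z
    unfolding b_def[abs_def] coord_series_def by (rule dirichlet_series_combine[OF bd that]) auto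
  have sb: "(\<Sum>k. binomial_shift (dirichlet_series (b r)) (real r / real q) k s) =
        (\<Sum>j<d. A r $$ (i, j) * (\<Sum>k. binomial_shift (coord_series j) (real r / real q) k s))" if r: "r < q" for r
  proof -
    have "(\<Sum>k. binomial_shift (dirichlet_series (b r)) (real r / real q) k s) =
          (\<Sum>k. \<Sum>j<d. A r $$ (i, j) * binomial_shift (coord_series j) (real r / real q) k s)"
      using s by (intro suminf_cong) (simp add: binomial_shift_def db sum_distrib_left mult_ac)
    also have "\<dots> = (\<Sum>j<d. \<Sum>k. A r $$ (i, j) * binomial_shift (coord_series j) (real r / real q) k s)"
      using s r by (intro suminf_sum summable_mult shift_summable) auto
    also have "\<dots> = (\<Sum>j<d. A r $$ (i, j) * (\<Sum>k. binomial_shift (coord_series j) (real r / real q) k s))"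
      using s r by (intro sum.cong refl suminf_mult shift_summable) auto
    finally show ?thesis .
  qed
  have "coord_series i s = (\<Sum>n=1..<q. of_nat n powr (- s) * v n $ i) +
     of_nat q powr (- s) * (\<Sum>r<q. dirichlet_series (b r) s + (\<Sum>k. binomial_shift (dirichlet_series (b r)) (real r / real q) k s))"
    unfolding coord_series_def using q by (intro dirichlet_functional_equation[OF bd[OF i] b rec' _ s]) auto
  also have "\<dots> = rhs i s + of_nat q powr (- s) * (\<Sum>r<q. \<Sum>j<d. A r $$ (i, j) * coord_series j s)"
    unfolding rhs_def sum.distrib distrib_left using s by (simp add: db sb)
  also have "(\<Sum>r<q. \<Sum>j<d. A r $$ (i, j) * coord_series j s) = (\<Sum>j<d. C $$ (i, j) * coord_series j s)"
    using i by (subst sum.swap) (simp add: C_def mat_sum_def sum_distrib_right)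
  finally have "coord_series i s - of_nat q powr (- s) * (\<Sum>j<d. C $$ (i, j) * coord_series j s) = rhs i s" by simp
  moreover have "(\<Sum>j<d. resolvent s $$ (i, j) * coord_series j s) =
     (\<Sum>j<d. (if i = j then coord_series j s else 0) - of_nat q powr (- s) * (C $$ (i, j) * coord_series j s))"
    using i by (intro sum.cong refl) (simp add: resolvent_index left_diff_distrib)
  hence "(\<Sum>j<d. resolvent s $$ (i, j) * coord_series j s) = coord_series i s - of_nat q powr (- s) * (\<Sum>j<d. C $$ (i, j) * coord_series j s)"
    using i by (simp add: sum_subtractf sum_distrib_left)
  ultimately show ?thesis by simp
qed

text \<open>
Multiplying the matrix by -q^s gives C - q^s I.
\<close>
lemma resolvent_singular:
  assumes "det (resolvent s) = 0"
  shows "of_nat q powr s \<in> spectrum C"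
proof -
  define z where "z = (of_nat q powr s :: complex)"
  have z: "z \<noteq> 0" "of_nat q powr (- s) = 1 / z" using q by (simp_all add: z_def powr_minus inverse_eq_divide)
  have "char_matrix C z = (- z) \<cdot>\<^sub>m resolvent s"
    using C_carrier z by (intro eq_matI) (auto simp: char_matrix_def resolvent_def field_simps)
  hence "det (char_matrix C z) = 0" using assms by simp
  thus ?thesis unfolding z_def[symmetric] by (simp add: spectrum_def eigenvalue_det[OF C_carrier])
qed

lemma resolvent_entry_holomorphic:
  "i < d \<Longrightarrow> j < d \<Longrightarrow> (\<lambda>s. resolvent s $$ (i, j)) holomorphic_on S"
  using q by (auto simp: resolvent_index intro!: holomorphic_intros)

lemma det_resolvent_holomorphic: "(\<lambda>s. det (resolvent s)) holomorphic_on S"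
  by (rule det_holomorphic[OF resolvent_carrier resolvent_entry_holomorphic])

text \<open>
The determinant is entire and nonzero where |q^s| exceeds all eigenvalues, so its zeros are isolated.
\<close>
lemma eventually_det_nonzero: "eventually (\<lambda>z. det (resolvent z) \<noteq> 0) (at s)"
proof -
  define B where "B = Max (insert 1 (cmod ` spectrum C))"
  have fin: "finite (spectrum C)" by (rule card_finite_spectrum(1)[OF C_carrier])
  have B: "B \<ge> 1" unfolding B_def using fin by (intro Max_ge) auto
  \<comment> \<open>Here q^t = B + 1 exceeds the modulus of every eigenvalue.\<close>
  define t where "t = complex_of_real (log q (B + 1))"
  have "of_nat q powr t = complex_of_real (B + 1)"
  proof -
    have "of_nat q powr t = of_real (real q powr log q (B + 1))"
      unfolding t_def using q by (simp flip: powr_of_real)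
    thus ?thesis using q B by simp
  qed
  hence n: "cmod (of_nat q powr t) = B + 1" using B by (simp only: norm_of_real)
  have "of_nat q powr t \<notin> spectrum C"
  proof
    assume "of_nat q powr t \<in> spectrum C"
    hence "cmod (of_nat q powr t) \<le> B" unfolding B_def using fin by (intro Max_ge) auto
    thus False using n by simp
  qed
  hence "det (resolvent t) \<noteq> 0" using resolvent_singular by blast
  from non_zero_neighbour_alt[OF det_resolvent_holomorphic[of UNIV] _ _ _ _ this, of s]
  show ?thesis by (auto elim: eventually_mono)
qed

lemma cramer_numerator_holomorphic:
  assumes "i < d"
  shows "(\<lambda>s. \<Sum>j<d. adj_mat (resolvent s) $$ (i, j) * rhs j s) holomorphic_on {s. Re s > \<rho>}"
  using assms by (intro holomorphic_intros rhs_holomorphic adj_mat_holomorphic[OF resolvent_carrier resolvent_entry_holomorphic]) auto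

lemma cramer_meromorphic:
  assumes "i < d"
  shows "cramer i meromorphic_on {s. Re s > \<rho>}"
proof -
  have "(\<lambda>s. \<Sum>j<d. adj_mat (resolvent s) $$ (i, j) * rhs j s) analytic_on {s. Re s > \<rho>}"
    using cramer_numerator_holomorphic[OF assms] open_Re_gt by (simp add: analytic_on_open)
  moreover have "(\<lambda>s. det (resolvent s)) analytic_on {s. Re s > \<rho>}"
    using det_resolvent_holomorphic open_Re_gt by (simp add: analytic_on_open)
  ultimately show ?thesis unfolding cramer_def[abs_def]
    by (intro meromorphic_on_divide analytic_on_imp_meromorphic_on)
qed

lemma cramer_analytic_at:
  assumes "i < d" "Re s > \<rho>" "det (resolvent s) \<noteq> 0"
  shows "cramer i analytic_on {s}"
proof -
  have "(\<lambda>s. \<Sum>j<d. adj_mat (resolvent s) $$ (i, j) * rhs j s) analytic_on {s}"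
    using holomorphic_on_imp_analytic_at[OF cramer_numerator_holomorphic[OF assms(1)] open_Re_gt] assms(2) by simp
  moreover have "(\<lambda>s. det (resolvent s)) analytic_on {s}"
    using holomorphic_on_imp_analytic_at[OF det_resolvent_holomorphic[of UNIV]] by simp
  ultimately show ?thesis unfolding cramer_def[abs_def] using assms(3) by (intro analytic_on_divide) auto
qed

lemma sum_mat_mult:
  fixes X Y :: "complex mat"
  assumes "X \<in> carrier_mat d d" "Y \<in> carrier_mat d d" "i < d" "j < d"
  shows "(\<Sum>k<d. X $$ (i, k) * Y $$ (k, j)) = (X * Y) $$ (i, j)"
  using assms by (simp add: scalar_prod_def atLeast0LessThan)

lemma coord_series_eq_cramer:
  assumes i: "i < d" and s: "Re s > \<rho> + 1" and det: "det (resolvent s) \<noteq> 0"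
  shows "coord_series i s = cramer i s"
proof -
  note adj = adj_mat[OF resolvent_carrier[of s]]
  have "(\<Sum>j<d. adj_mat (resolvent s) $$ (i, j) * rhs j s) =
        (\<Sum>j<d. \<Sum>k<d. adj_mat (resolvent s) $$ (i, j) * resolvent s $$ (j, k) * coord_series k s)"
    using s by (intro sum.cong refl) (simp add: sum_distrib_left mult.assoc flip: resolvent_mult_coord_series)
  also have "\<dots> = (\<Sum>k<d. (\<Sum>j<d. adj_mat (resolvent s) $$ (i, j) * resolvent s $$ (j, k)) * coord_series k s)"
    by (subst sum.swap) (simp add: sum_distrib_right)
  also have "\<dots> = (\<Sum>k<d. if k = i then det (resolvent s) * coord_series k s else 0)"
  proof (rule sum.cong[OF refl])
    fix k assume "k \<in> {..<d}"
    hence k: "k < d" by simp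
    have "(\<Sum>j<d. adj_mat (resolvent s) $$ (i, j) * resolvent s $$ (j, k)) = (det (resolvent s) \<cdot>\<^sub>m 1\<^sub>m d) $$ (i, k)"
      unfolding sum_mat_mult[OF adj(1) resolvent_carrier i k] adj(3) ..
    also have "\<dots> = (if k = i then det (resolvent s) else 0)" using i k by auto
    finally show "(\<Sum>j<d. adj_mat (resolvent s) $$ (i, j) * resolvent s $$ (j, k)) * coord_series k s =
       (if k = i then det (resolvent s) * coord_series k s else 0)" by simp
  qed
  also have "\<dots> = det (resolvent s) * coord_series i s" using i by simp
  finally show ?thesis using det by (simp add: cramer_def)
qed

lemma resolvent_mult_cramer:
  assumes i: "i < d" and det: "det (resolvent s) \<noteq> 0"
  shows "(\<Sum>j<d. resolvent s $$ (i, j) * cramer j s) = rhs i s"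
proof -
  note adj = adj_mat[OF resolvent_carrier[of s]]
  have "(\<Sum>j<d. resolvent s $$ (i, j) * cramer j s) =
     (\<Sum>j<d. \<Sum>k<d. resolvent s $$ (i, j) * adj_mat (resolvent s) $$ (j, k) * rhs k s) / det (resolvent s)"
    by (simp add: cramer_def sum_distrib_left sum_divide_distrib mult.assoc)
  also have "(\<Sum>j<d. \<Sum>k<d. resolvent s $$ (i, j) * adj_mat (resolvent s) $$ (j, k) * rhs k s) =
     (\<Sum>k<d. (\<Sum>j<d. resolvent s $$ (i, j) * adj_mat (resolvent s) $$ (j, k)) * rhs k s)"
    by (subst sum.swap) (simp add: sum_distrib_right)
  also have "\<dots> = (\<Sum>k<d. if k = i then det (resolvent s) * rhs k s else 0)"
  proof (rule sum.cong[OF refl])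
    fix k assume "k \<in> {..<d}"
    hence k: "k < d" by simp
    have "(\<Sum>j<d. resolvent s $$ (i, j) * adj_mat (resolvent s) $$ (j, k)) = (det (resolvent s) \<cdot>\<^sub>m 1\<^sub>m d) $$ (i, k)"
      unfolding sum_mat_mult[OF resolvent_carrier adj(1) i k] adj(2) ..
    also have "\<dots> = (if k = i then det (resolvent s) else 0)" using i k by auto
    finally show "(\<Sum>j<d. resolvent s $$ (i, j) * adj_mat (resolvent s) $$ (j, k)) * rhs k s =
       (if k = i then det (resolvent s) * rhs k s else 0)" by simp
  qed
  also have "\<dots> = det (resolvent s) * rhs i s" using i by simp
  finally show ?thesis using det by simp
qed

definition V :: "complex \<Rightarrow> complex Matrix.vec" where
  "V s = vec d (\<lambda>i. remove_sings (cramer i) s)"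

lemma V_carrier: "V s \<in> carrier_vec d" by (simp add: V_def)

lemma V_index: "i < d \<Longrightarrow> V s $ i = remove_sings (cramer i) s" by (simp add: V_def)

lemma V_index': "i < d \<Longrightarrow> (\<lambda>s. V s $ i) = remove_sings (cramer i)" by (auto simp: V_def)

lemma V_nicely_meromorphic:
  "i < d \<Longrightarrow> (\<lambda>s. V s $ i) nicely_meromorphic_on {s. Re s > \<rho>}"
  unfolding V_index' by (intro remove_sings_nicely_meromorphic cramer_meromorphic)

lemma V_eq_coord_series:
  assumes i: "i < d" and s: "Re s > \<rho> + 1"
  shows "V s $ i = coord_series i s"
proof -
  have "eventually (\<lambda>z. z \<in> {z. Re z > \<rho> + 1} - {s}) (at s)"
    by (intro eventually_at_in_open open_Re_gt) (use s in auto)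
  hence "eventually (\<lambda>z. coord_series i z = cramer i z) (at s)"
    using eventually_det_nonzero[of s] by eventually_elim (use coord_series_eq_cramer[OF i] in auto)
  moreover have "isCont (coord_series i) s"
    using holomorphic_on_imp_analytic_at[OF coord_series_holomorphic[OF i] open_Re_gt] s by (auto intro: analytic_at_imp_isCont)
  hence "(coord_series i \<longlongrightarrow> coord_series i s) (at s)" by (simp add: isCont_def)
  ultimately have "(cramer i \<longlongrightarrow> coord_series i s) (at s)" by (rule Lim_transform_eventually[rotated])
  thus ?thesis unfolding V_index[OF i] by (rule remove_sings_eqI)
qed

text \<open>
Where the determinant is nonzero this is Cramer's rule; the remaining points are isolated, and both sides are continuous there.
\<close>
lemma V_functional_equation:
  assumes i: "i < d" and s: "Re s > \<rho>" and np: "\<And>j. j < d \<Longrightarrow> \<not> is_pole (\<lambda>s. V s $ j) s"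
  shows "(\<Sum>j<d. resolvent s $$ (i, j) * V s $ j) = rhs i s"
proof -
  have lim: "(cramer j \<longlongrightarrow> V s $ j) (at s)" if j: "j < d" for j
  proof -
    have "(\<lambda>s. V s $ j) analytic_on {s}"
      by (rule nicely_meromorphic_on_imp_analytic_at[OF V_nicely_meromorphic[OF j] _ np[OF j]]) (use s in simp)
    hence "isCont (remove_sings (cramer j)) s" unfolding V_index'[OF j] by (rule analytic_at_imp_isCont)
    hence "(remove_sings (cramer j) \<longlongrightarrow> V s $ j) (at s)" by (simp add: isCont_def V_index[OF j])
    moreover have "isolated_singularity_at (cramer j) s"
      by (rule meromorphic_on_isolated_singularity, rule meromorphic_on_subset[OF cramer_meromorphic[OF j]]) (use s in simp)
    hence "eventually (\<lambda>w. remove_sings (cramer j) w = cramer j w) (at s)" by (rule eventually_remove_sings_eq_at)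
    ultimately show ?thesis by (rule Lim_transform_eventually)
  qed
  have res: "((\<lambda>z. resolvent z $$ (i, j)) \<longlongrightarrow> resolvent s $$ (i, j)) (at s)" if "j < d" for j
  proof -
    have "isCont (\<lambda>z. resolvent z $$ (i, j)) s"
      using holomorphic_on_imp_analytic_at[OF resolvent_entry_holomorphic[OF i that, of UNIV]] by (auto intro: analytic_at_imp_isCont)
    thus ?thesis by (simp add: isCont_def)
  qed
  have "((\<lambda>z. \<Sum>j<d. resolvent z $$ (i, j) * cramer j z) \<longlongrightarrow> (\<Sum>j<d. resolvent s $$ (i, j) * V s $ j)) (at s)"
    by (intro tendsto_sum tendsto_mult res lim) auto
  moreover have "eventually (\<lambda>z. (\<Sum>j<d. resolvent z $$ (i, j) * cramer j z) = rhs i z) (at s)"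
    using eventually_det_nonzero[of s] by eventually_elim (rule resolvent_mult_cramer[OF i])
  ultimately have "(rhs i \<longlongrightarrow> (\<Sum>j<d. resolvent s $$ (i, j) * V s $ j)) (at s)"
    by (rule Lim_transform_eventually)
  moreover have "isCont (rhs i) s"
    using holomorphic_on_imp_analytic_at[OF rhs_holomorphic[OF i] open_Re_gt] s by (auto intro: analytic_at_imp_isCont)
  hence "(rhs i \<longlongrightarrow> rhs i s) (at s)" by (simp add: isCont_def)
  ultimately show ?thesis by (rule LIM_unique)
qed

lemma V_pole:
  assumes i: "i < d" and s: "Re s > \<rho>" and pole: "is_pole (\<lambda>s. V s $ i) s"
  shows "of_nat q powr s \<in> spectrum C"
proof (rule resolvent_singular, rule ccontr)
  assume "det (resolvent s) \<noteq> 0"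
  hence "cramer i analytic_on {s}" by (rule cramer_analytic_at[OF i s])
  hence "isolated_singularity_at (cramer i) s" "(cramer i \<longlongrightarrow> cramer i s) (at s)"
    using isolated_singularity_at_analytic analytic_at_imp_isCont isContD by blast+
  hence "remove_sings (cramer i) analytic_on {s}" by (rule remove_sings_analytic_at)
  thus False using pole unfolding V_index'[OF i] using analytic_at_imp_no_pole by blast
qed

lemma shift_term_index:
  assumes i: "i < d" and s: "Re s > \<rho>"
  shows "shift_term q V r k s $ i = binomial_shift (coord_series i) (real r / real q) k s"
  using i V_eq_coord_series[OF i, of "s + of_nat (Suc k)"] s V_carrier[of "s + of_nat (Suc k)"]
  by (simp add: shift_term_def binomial_shift_def)

lemma uniformly_convergent_normally:
  assumes "converges_normally_on f S" "compact K" "K \<subseteq> S"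
  shows "uniformly_convergent_on K (\<lambda>M s. \<Sum>n<M. f n s)"
  using converges_normallyD(2)[OF assms] by (rule uniformly_convergentI)

lemma shift_term_converges:
  assumes r: "r < q"
  shows "converges_abs_unif_compacts d (shift_term q V r) {s. Re s > \<rho>}"
  unfolding converges_abs_unif_compacts_def
proof (intro allI impI conjI ballI; (elim conjE)?)
  fix i s assume i: "i < d" and s: "s \<in> {s. Re s > \<rho>}"
  show "summable (\<lambda>k. cmod (shift_term q V r k s $ i))"
    using converges_normallyD(1)[OF shift_normally[OF i r] s] s by (simp add: shift_term_index[OF i])
next
  fix i K assume i: "i < d" and K: "compact K" "K \<subseteq> {s. Re s > \<rho>}"
  have "uniformly_convergent_on K (\<lambda>M s. \<Sum>k<M. binomial_shift (coord_series i) (real r / real q) k s)"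
    by (rule uniformly_convergent_normally[OF shift_normally[OF i r] K])
  also have "?this \<longleftrightarrow> uniformly_convergent_on K (\<lambda>M s. \<Sum>k<M. shift_term q V r k s $ i)"
    by (intro uniformly_convergent_cong always_eventually allI ballI sum.cong refl)
       (use K in \<open>auto simp: shift_term_index[OF i]\<close>)
  finally show "uniformly_convergent_on K (\<lambda>M s. \<Sum>k<M. shift_term q V r k s $ i)" .
qed

lemma dirichlet_term_index: "i < d \<Longrightarrow> dirichlet_term v n s $ i = dirichlet_summand (\<lambda>n. v n $ i) n s"
  using v[of "Suc n"] by (simp add: dirichlet_term_def dirichlet_summand_def)

lemma dirichlet_term_converges: "converges_abs_unif_compacts d (dirichlet_term v) {s. Re s > \<rho> + 1}"
  unfolding converges_abs_unif_compacts_def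
  using converges_normallyD(1)[OF dirichlet_normally[OF bd]] uniformly_convergent_normally[OF dirichlet_normally[OF bd]]
  by (auto simp: dirichlet_term_index)

lemma V_eq_series:
  assumes "Re s > \<rho> + 1"
  shows "V s = vec_suminf d (\<lambda>n. dirichlet_term v n s)"
  using V_eq_coord_series[OF _ assms] V_carrier[of s]
  by (intro eq_vecI) (auto simp: vec_suminf_def dirichlet_term_index coord_series_def dirichlet_series_def)

lemma V_vector_equation:
  assumes s: "Re s > \<rho>" and np: "\<forall>i<d. \<not> is_pole (\<lambda>s. V s $ i) s"
  shows "(1\<^sub>m d - (of_nat q powr (- s)) \<cdot>\<^sub>m C) *\<^sub>v V s =
         finsum_vec TYPE(complex) d (\<lambda>n. (of_nat n powr (- s)) \<cdot>\<^sub>v v n) {1..<q} +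
         (of_nat q powr (- s)) \<cdot>\<^sub>v
           finsum_vec TYPE(complex) d (\<lambda>r. A r *\<^sub>v vec_suminf d (\<lambda>k. shift_term q V r k s)) {..<q}"
    (is "?l = ?S1 + ?c \<cdot>\<^sub>v ?S2")
proof (rule eq_vecI)
  have S: "?S1 \<in> carrier_vec d" "?S2 \<in> carrier_vec d"
    using v by (auto intro!: finsum_vec_closed mult_mat_vec_carrier[OF A] simp: vec_suminf_def)
  show "dim_vec ?l = dim_vec (?S1 + ?c \<cdot>\<^sub>v ?S2)" using S C_carrier by simp
  fix i assume "i < dim_vec (?S1 + ?c \<cdot>\<^sub>v ?S2)"
  hence i: "i < d" using S by simp
  have "?l $ i = (\<Sum>j<d. resolvent s $$ (i, j) * V s $ j)"
    using i resolvent_carrier[of s] V_carrier[of s] by (simp add: scalar_prod_def atLeast0LessThan flip: resolvent_def)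
  also have "\<dots> = rhs i s" using np by (intro V_functional_equation[OF i s]) auto
  also have "\<dots> = (?S1 + ?c \<cdot>\<^sub>v ?S2) $ i"
  proof -
    have "?S1 $ i = (\<Sum>n=1..<q. of_nat n powr (- s) * v n $ i)"
      using i v by (subst index_finsum_vec) (auto simp: carrier_vecD[OF v])
    moreover have "?S2 $ i = (\<Sum>r<q. \<Sum>j<d. A r $$ (i, j) * (\<Sum>k. binomial_shift (coord_series j) (real r / real q) k s))"
    proof -
      have "?S2 $ i = (\<Sum>r<q. (A r *\<^sub>v vec_suminf d (\<lambda>k. shift_term q V r k s)) $ i)"
        using i by (subst index_finsum_vec) (auto simp: vec_suminf_def intro!: mult_mat_vec_carrier[OF A])
      also have "\<dots> = (\<Sum>r<q. \<Sum>j<d. A r $$ (i, j) * (\<Sum>k. binomial_shift (coord_series j) (real r / real q) k s))"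
      proof (rule sum.cong[OF refl])
        fix r assume "r \<in> {..<q}"
        hence "A r \<in> carrier_mat d d" by (intro A) simp
        thus "(A r *\<^sub>v vec_suminf d (\<lambda>k. shift_term q V r k s)) $ i =
            (\<Sum>j<d. A r $$ (i, j) * (\<Sum>k. binomial_shift (coord_series j) (real r / real q) k s))"
          using i s by (simp add: scalar_prod_def vec_suminf_def atLeast0LessThan shift_term_index)
      qed
      finally show ?thesis .
    qed
    ultimately show ?thesis using S i by (simp add: rhs_def)
  qed
  finally show "?l $ i = (?S1 + ?c \<cdot>\<^sub>v ?S2) $ i" .
qed

end

section \<open>Asymptotic expansion of the summatory function\<close>

lemma log_power_le_powr:
  fixes \<epsilon> :: real and q M :: nat
  assumes q: "q \<ge> 2" and \<epsilon>: "\<epsilon> > 0"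
  shows "\<exists>K\<ge>0. \<forall>N\<ge>1. (1 + log q (real N)) ^ M \<le> K * real N powr \<epsilon>"
proof -
  have lnq: "ln q > 0" using q by simp
  \<comment> \<open>With this c, exp (c log_q N) = N^\<epsilon>.\<close>
  define c where "c = \<epsilon> * ln q"
  have c: "c > 0" using \<epsilon> lnq by (simp add: c_def)
  show ?thesis
  proof (intro exI[of _ "fact M / c ^ M * exp c"] conjI allI impI)
    fix N :: nat assume N: "N \<ge> 1"
    have "log q (real N) \<ge> 0" using N q by auto
    hence "(1 + log q (real N)) ^ M \<le> fact M / c ^ M * exp (c * (1 + log q (real N)))"
      using c by (intro power_le_fact_exp) auto
    also have "exp (c * (1 + log q (real N))) = exp c * real N powr \<epsilon>"
      using N lnq by (simp add: c_def distrib_left exp_add log_def powr_def)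
    finally show "(1 + log q (real N)) ^ M \<le> fact M / c ^ M * exp c * real N powr \<epsilon>" by simp
  qed (use c in auto)
qed

context bounded_regular_sequence
begin

text \<open>
This covers R < 1, where the sequence vanishes.
\<close>
lemma V_zero:
  assumes "\<And>n. v n = 0\<^sub>v d" "i < d"
  shows "V s $ i = 0"
proof -
  have coord_series: "coord_series j = (\<lambda>_. 0)" if "j < d" for j
    using that by (simp add: coord_series_def dirichlet_series_def[abs_def] dirichlet_summand_def assms(1))
  have "rhs j z = 0" if "j < d" for j z
    using that by (simp add: rhs_def coord_series binomial_shift_def assms(1))
  hence "cramer i = (\<lambda>_. 0)" by (auto simp: cramer_def)
  thus ?thesis using assms(2) by (simp add: V_index)
qed

definition large_eigenvalues where "large_eigenvalues = {l \<in> spectrum C. cmod l > real q powr \<rho>}"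

text \<open>
Each Y_l with |l| > R is expanded by \<open>periodic_expansion\<close>, which is exact at integers, and the others make up the error.
For the Fourier coefficients the expansion is also needed at non-integral u, up to O(N^(\<rho> + \<epsilon>)); the logarithms in the
error are absorbed by N^\<epsilon>.
\<close>
theorem summatory_expansion:
  assumes rho: "\<rho> \<ge> 0"
  shows "\<exists>\<Phi>. (\<forall>l\<in>large_eigenvalues. \<forall>k<max_jordan_block C l.
        (\<forall>t. \<Phi> l k (t + 1) = \<Phi> l k t) \<and> continuous_on UNIV (\<Phi> l k) \<and>
        (\<forall>a. 0 < a \<and> a < log q (cmod l / q powr \<rho>) \<longrightarrow> hoelder_continuous a (\<Phi> l k)) \<and>
        (\<forall>j. fourier_coeff q (v 0 $ 0) (\<lambda>s. V s $ 0) l k j =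
               integral {0..1} (\<lambda>t. \<Phi> l k t * exp (\<i> * of_real (- 2 * pi * of_int j * t))))) \<and>
     (\<exists>K. \<forall>N\<ge>1. cmod ((\<Sum>n<N. v n $ 0) - (\<Sum>l\<in>large_eigenvalues. periodic_sum l (max_jordan_block C l) (\<Phi> l) (log q N)))
         \<le> K * (real N powr \<rho> * (1 + log q N) ^ Max (max_jordan_block C ` {l. cmod l = real q powr \<rho>}))) \<and>
     (large_eigenvalues = spectrum C \<longrightarrow>
        (\<forall>N\<ge>1. (\<Sum>n<N. v n $ 0) = (\<Sum>l\<in>large_eigenvalues. periodic_sum l (max_jordan_block C l) (\<Phi> l) (log q N))))"
proof -
  define m where "m = max_jordan_block C"
  define Lam where "Lam = large_eigenvalues"
  define M where "M = Max (m ` {l. cmod l = real q powr \<rho>})"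
  interpret q_scale q \<rho> using q rho by unfold_locales
  have fin: "finite (spectrum C)" by (rule card_finite_spectrum(1)[OF C_carrier])
  have Lam: "Lam \<subseteq> spectrum C" "finite Lam" "\<And>l. l \<in> Lam \<Longrightarrow> cmod l > R"
    using fin by (auto simp: Lam_def large_eigenvalues_def)
  have mM: "m l \<le> M" if "cmod l = R" for l
  proof -
    have "finite (m ` {l. cmod l = real q powr \<rho>})"
      by (rule finite_subset[of _ "{..d}"]) (use max_jordan_block_le[OF C_carrier] in \<open>auto simp: m_def\<close>)
    thus ?thesis unfolding M_def using that by (intro Max_ge) auto
  qed
  obtain w where w: "\<And>N. (\<Sum>n<N. v n $ 0) = (\<Sum>l\<in>spectrum C. functional_sum (w l) N)"
     "\<And>l N. (qdiff q l ^^ m l) (functional_sum (w l)) N = 0"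
    using spectral_decomposition unfolding C_def m_def by blast
  define Y where "Y l = functional_sum (w l)" for l
  have Y: "(\<Sum>n<N. v n $ 0) = (\<Sum>l\<in>spectrum C. Y l N)" "(qdiff q l ^^ m l) (Y l) N = 0" for l N
    using w by (simp_all add: Y_def)
  have slow: "slow_seq (Y l)" for l
    unfolding slow_seq_def Y_def by (rule functional_sum_slow[OF rho bd])
  define P where "P l \<Phi> \<longleftrightarrow> (\<forall>k<m l. \<forall>t. \<Phi> k (t + 1) = \<Phi> k t) \<and>
    (\<forall>k<m l. \<forall>a. 0 < a \<and> a < log q (cmod l / R) \<longrightarrow> hoelder_continuous a (\<Phi> k)) \<and>
    (\<forall>N\<ge>1. Y l N = periodic_sum l (m l) \<Phi> (log q N)) \<and>
    (\<exists>K. \<forall>u>0. cmod (periodic_sum l (m l) \<Phi> (log q u) - Y l (nat \<lfloor>u\<rfloor>)) \<le> K * (1 + u) powr \<rho>)" for l and \<Phi> :: "nat \<Rightarrow> real \<Rightarrow> complex"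
  have "\<exists>\<Phi>. P l \<Phi>" if "l \<in> Lam" for l
    unfolding P_def by (rule periodic_expansion[OF Lam(3)[OF that] slow Y(2)])
  hence "\<forall>l. \<exists>\<Phi>. l \<in> Lam \<longrightarrow> P l \<Phi>" by blast
  from choice[OF this] obtain \<Phi> where "\<forall>l. l \<in> Lam \<longrightarrow> P l (\<Phi> l)" ..
  hence \<Phi>: "\<And>l. l \<in> Lam \<Longrightarrow> P l (\<Phi> l)" by blast
  have per: "\<Phi> l k (t + 1) = \<Phi> l k t" if "l \<in> Lam" "k < m l" for l k t
    using \<Phi>[OF that(1)] that(2) unfolding P_def by blast
  have hoelder: "hoelder_continuous a (\<Phi> l k)" if "l \<in> Lam" "k < m l" "0 < a" "a < log q (cmod l / R)" for l k a
    using \<Phi>[OF that(1)] that(2-4) unfolding P_def by blast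
  have exact: "Y l N = periodic_sum l (m l) (\<Phi> l) (log q N)" if "l \<in> Lam" "N \<ge> 1" for l N
    using \<Phi>[OF that(1)] that(2) unfolding P_def by blast
  have close: "\<exists>K. \<forall>u>0. cmod (periodic_sum l (m l) (\<Phi> l) (log q u) - Y l (nat \<lfloor>u\<rfloor>)) \<le> K * (1 + u) powr \<rho>" if "l \<in> Lam" for l
    using \<Phi>[OF that(1)] unfolding P_def by blast
  have cont: "continuous_on UNIV (\<Phi> l k)" if "l \<in> Lam" "k < m l" for l k
  proof -
    define a where "a = log q (cmod l / R) / 2"
    have "1 < cmod l / R" using Lam(3)[OF that(1)] R_ge_1 by (subst less_divide_eq_1_pos) linarith+
    moreover have "1 < real q" using q by simp
    ultimately have "0 < log q (cmod l / R)" by (subst zero_less_log_cancel_iff) linarith+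
    hence "0 < a" "a < log q (cmod l / R)" by (simp_all add: a_def)
    thus ?thesis using hoelder_continuous_imp_continuous[OF hoelder[OF that]] by blast
  qed
  \<comment> \<open>Below the critical modulus no logarithm occurs; on it, the exponent m l is at most M.\<close>
  have rest: "\<exists>K\<ge>0. \<forall>N\<ge>1. cmod (Y l N) \<le> K * (real N powr \<rho> * (1 + log q N) ^ M)" if l: "l \<in> spectrum C - Lam" for l
  proof -
    have "\<exists>K e. e \<le> M \<and> (\<forall>N\<ge>1. cmod (Y l N) \<le> K * (real N powr \<rho> * (1 + log q N) ^ e))"
    proof (cases "cmod l = R")
      case True
      thus ?thesis using critical_bound[OF True slow Y(2)] mM by blast
    next
      case False
      hence "cmod l < R" using l by (auto simp: Lam_def large_eigenvalues_def)
      from small_bound[OF this slow Y(2)] show ?thesis by (metis le0 mult.right_neutral power_0)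
    qed
    then obtain K e where e: "e \<le> M" and K: "\<And>N. N \<ge> 1 \<Longrightarrow> cmod (Y l N) \<le> K * (real N powr \<rho> * (1 + log q N) ^ e)" by blast
    show ?thesis
    proof (intro exI[of _ "\<bar>K\<bar>"] conjI allI impI)
      fix N :: nat assume N: "N \<ge> 1"
      have lg: "log q N \<ge> 0" using N q by auto
      have "cmod (Y l N) \<le> K * (real N powr \<rho> * (1 + log q N) ^ e)" by (rule K[OF N])
      also have "\<dots> \<le> \<bar>K\<bar> * (real N powr \<rho> * (1 + log q N) ^ M)"
        using lg e by (intro mult_mono mult_nonneg_nonneg power_increasing zero_le_power) auto
      finally show "cmod (Y l N) \<le> \<bar>K\<bar> * (real N powr \<rho> * (1 + log q N) ^ M)" .
    qed auto
  qed
  have diff: "(\<Sum>n<N. v n $ 0) - (\<Sum>l\<in>Lam. f l) = (\<Sum>l\<in>Lam. Y l N - f l) + (\<Sum>l\<in>spectrum C - Lam. Y l N)" for N f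
    unfolding Y(1) sum_subtractf using sum.subset_diff[OF Lam(1) fin, of "\<lambda>l. Y l N"] by simp
  have exact_diff: "(\<Sum>n<N. v n $ 0) - (\<Sum>l\<in>Lam. periodic_sum l (m l) (\<Phi> l) (log q N)) = (\<Sum>l\<in>spectrum C - Lam. Y l N)" if "N \<ge> 1" for N
    unfolding diff using exact that by simp
  have "\<forall>l. \<exists>K. l \<in> spectrum C - Lam \<longrightarrow> (\<forall>N\<ge>1. cmod (Y l N) \<le> K * (real N powr \<rho> * (1 + log q N) ^ M))"
    using rest by blast
  from choice[OF this] obtain Kr where
    Kr: "\<And>l N. l \<in> spectrum C - Lam \<Longrightarrow> N \<ge> 1 \<Longrightarrow> cmod (Y l N) \<le> Kr l * (real N powr \<rho> * (1 + log q N) ^ M)" by blast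
  have error: "cmod (\<Sum>l\<in>spectrum C - Lam. Y l N) \<le> (\<Sum>l\<in>spectrum C - Lam. Kr l) * (real N powr \<rho> * (1 + log q N) ^ M)"
    if "N \<ge> 1" for N
    unfolding sum_distrib_right using that by (intro sum_norm_le Kr)
  have approx: "\<exists>K. \<forall>N\<ge>1. \<forall>u\<in>{real N..real N + 1}. cmod ((\<Sum>n<Suc N. v n $ 0) -
      (\<Sum>l\<in>Lam. periodic_sum l (m l) (\<Phi> l) (log q u))) \<le> K * real N powr (\<rho> + \<epsilon>)" if \<epsilon>: "\<epsilon> > 0" for \<epsilon>
  proof -
    have "\<exists>K. \<forall>N\<ge>1. \<forall>u\<in>{real N..real N + 1}. cmod (Y l (Suc N) - periodic_sum l (m l) (\<Phi> l) (log q u)) \<le> K * real N powr (\<rho> + \<epsilon>)"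
      if l: "l \<in> Lam" for l
    proof -
      obtain K1 where K1: "\<And>u. u > 0 \<Longrightarrow> cmod (periodic_sum l (m l) (\<Phi> l) (log q u) - Y l (nat \<lfloor>u\<rfloor>)) \<le> K1 * (1 + u) powr \<rho>"
        using close[OF l] by blast
      obtain K2 where K2: "\<And>N. cmod (Y l (Suc N) - Y l N) \<le> K2 * (1 + real N) powr \<rho>"
        using slow_seqD[OF slow[of l]] by blast
      have K10: "K1 \<ge> 0"
      proof -
        have "0 \<le> K1 * (1 + 1) powr \<rho>" using order.trans[OF norm_ge_zero K1[of 1]] by simp
        thus ?thesis by (simp add: zero_le_mult_iff)
      qed
      have K20: "K2 \<ge> 0" using order.trans[OF norm_ge_zero K2[of 0]] by simp
      show ?thesis
      proof (intro exI allI impI ballI)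
        fix N :: nat and u assume N: "N \<ge> 1" and u: "u \<in> {real N..real N + 1}"
        have N3: "(3 * real N) powr \<rho> \<le> 3 powr \<rho> * real N powr (\<rho> + \<epsilon>)"
          unfolding powr_mult using N \<epsilon> by (intro mult_left_mono powr_mono) auto
        have "nat \<lfloor>u\<rfloor> = N \<or> nat \<lfloor>u\<rfloor> = Suc N" using u by (simp add: nat_eq_iff floor_eq_iff) linarith
        hence "cmod (Y l (Suc N) - Y l (nat \<lfloor>u\<rfloor>)) \<le> K2 * (1 + real N) powr \<rho>"
          using K2[of N] K20 by auto
        also have "\<dots> \<le> K2 * (3 * real N) powr \<rho>"
          using N K20 rho by (intro mult_left_mono powr_mono2) auto
        finally have a: "cmod (Y l (Suc N) - Y l (nat \<lfloor>u\<rfloor>)) \<le> K2 * (3 * real N) powr \<rho>" .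
        have "cmod (periodic_sum l (m l) (\<Phi> l) (log q u) - Y l (nat \<lfloor>u\<rfloor>)) \<le> K1 * (1 + u) powr \<rho>"
          using N u by (intro K1) auto
        also have "\<dots> \<le> K1 * (3 * real N) powr \<rho>"
          using N u K10 rho by (intro mult_left_mono powr_mono2) auto
        finally have b: "cmod (periodic_sum l (m l) (\<Phi> l) (log q u) - Y l (nat \<lfloor>u\<rfloor>)) \<le> K1 * (3 * real N) powr \<rho>" .
        have "Y l (Suc N) - periodic_sum l (m l) (\<Phi> l) (log q u) =
           (Y l (Suc N) - Y l (nat \<lfloor>u\<rfloor>)) - (periodic_sum l (m l) (\<Phi> l) (log q u) - Y l (nat \<lfloor>u\<rfloor>))" by simp
        also have "cmod \<dots> \<le> K2 * (3 * real N) powr \<rho> + K1 * (3 * real N) powr \<rho>"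
          using a b by (rule order.trans[OF norm_triangle_ineq4 add_mono])
        also have "\<dots> = (K2 + K1) * (3 * real N) powr \<rho>" by (simp only: distrib_right)
        also have "\<dots> \<le> (K2 + K1) * (3 powr \<rho> * real N powr (\<rho> + \<epsilon>))"
          using K10 K20 by (intro mult_left_mono N3) auto
        finally show "cmod (Y l (Suc N) - periodic_sum l (m l) (\<Phi> l) (log q u)) \<le> ((K2 + K1) * 3 powr \<rho>) * real N powr (\<rho> + \<epsilon>)"
          by (simp only: mult.assoc)
      qed
    qed
    hence "\<forall>l. \<exists>K. l \<in> Lam \<longrightarrow> (\<forall>N\<ge>1. \<forall>u\<in>{real N..real N + 1}. cmod (Y l (Suc N) - periodic_sum l (m l) (\<Phi> l) (log q u)) \<le> K * real N powr (\<rho> + \<epsilon>))"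
      by blast
    from choice[OF this] obtain Kl where Kl: "\<And>l N u. l \<in> Lam \<Longrightarrow> N \<ge> 1 \<Longrightarrow> u \<in> {real N..real N + 1} \<Longrightarrow>
        cmod (Y l (Suc N) - periodic_sum l (m l) (\<Phi> l) (log q u)) \<le> Kl l * real N powr (\<rho> + \<epsilon>)" by blast
    obtain B where B: "B \<ge> 0" "\<And>N. N \<ge> 1 \<Longrightarrow> (1 + log q (real N)) ^ M \<le> B * real N powr \<epsilon>"
      using log_power_le_powr[OF q \<epsilon>] by blast
    define S where "S = \<bar>\<Sum>l\<in>spectrum C - Lam. Kr l\<bar>"
    show ?thesis
    proof (intro exI allI impI ballI)
      fix N :: nat and u assume N: "N \<ge> 1" and u: "u \<in> {real N..real N + 1}"
      have "cmod (\<Sum>l\<in>spectrum C - Lam. Y l (Suc N)) \<le> (\<Sum>l\<in>spectrum C - Lam. Kr l) * (real (Suc N) powr \<rho> * (1 + log q (Suc N)) ^ M)"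
        by (rule error) simp
      also have "\<dots> \<le> S * (real (Suc N) powr \<rho> * (B * real (Suc N) powr \<epsilon>))"
        unfolding S_def using B(2)[of "Suc N"] q
        by (intro mult_mono mult_left_mono mult_nonneg_nonneg zero_le_power) (auto simp del: of_nat_Suc)
      also have "\<dots> = (S * B) * real (Suc N) powr (\<rho> + \<epsilon>)" unfolding powr_add by (simp only: mult_ac)
      also have "\<dots> \<le> (S * B) * (2 * real N) powr (\<rho> + \<epsilon>)"
        using N B rho \<epsilon> by (intro mult_left_mono powr_mono2) (auto simp: S_def)
      also have "\<dots> = (S * B * 2 powr (\<rho> + \<epsilon>)) * real N powr (\<rho> + \<epsilon>)" by (simp add: powr_mult)
      finally have 2: "cmod (\<Sum>l\<in>spectrum C - Lam. Y l (Suc N)) \<le> (S * B * 2 powr (\<rho> + \<epsilon>)) * real N powr (\<rho> + \<epsilon>)" .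
      have 1: "cmod (\<Sum>l\<in>Lam. Y l (Suc N) - periodic_sum l (m l) (\<Phi> l) (log q u)) \<le> (\<Sum>l\<in>Lam. Kl l) * real N powr (\<rho> + \<epsilon>)"
        unfolding sum_distrib_right using N u by (intro sum_norm_le Kl)
      show "cmod ((\<Sum>n<Suc N. v n $ 0) - (\<Sum>l\<in>Lam. periodic_sum l (m l) (\<Phi> l) (log q u)))
          \<le> ((\<Sum>l\<in>Lam. Kl l) + S * B * 2 powr (\<rho> + \<epsilon>)) * real N powr (\<rho> + \<epsilon>)"
        unfolding diff distrib_right by (rule order.trans[OF norm_triangle_ineq add_mono[OF 1 2]])
    qed
  qed
  interpret E: asymptotic_expansion q \<rho> "\<lambda>n. v n $ 0" Lam m \<Phi>
  proof (unfold_locales, goal_cases)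
    case 3 show ?case using bd[of 0] d by simp
  next
    case (5 l k) thus ?case by (rule cont)
  next
    case (6 l k t) thus ?case by (rule per)
  next
    case (8 \<epsilon>) thus ?case by (rule approx)
  qed (use q rho Lam in auto)
  have fourier: "fourier_coeff q (v 0 $ 0) (\<lambda>s. V s $ 0) l k j =
     integral {0..1} (\<lambda>t. \<Phi> l k t * exp (\<i> * of_real (- 2 * pi * of_int j * t)))" if "l \<in> Lam" "k < m l" for l k j
  proof (rule E.fourier_coeff_eq_integral[OF _ _ that])
    show "(\<lambda>s. V s $ 0) meromorphic_on {s. Re s > \<rho>}"
      using V_nicely_meromorphic[of 0] d unfolding nicely_meromorphic_on_def by auto
    show "V s $ 0 = dirichlet_series (\<lambda>n. v n $ 0) s" if "Re s > \<rho> + 1" for s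
      using V_eq_coord_series[of 0 s] d that by (simp add: coord_series_def)
  qed
  show ?thesis
    unfolding m_def[symmetric] Lam_def[symmetric] M_def[symmetric]
  proof (intro exI[of _ \<Phi>] conjI ballI allI impI; (elim conjE)?)
    show "\<exists>K. \<forall>N\<ge>1. cmod ((\<Sum>n<N. v n $ 0) - (\<Sum>l\<in>Lam. periodic_sum l (m l) (\<Phi> l) (log q N)))
         \<le> K * (real N powr \<rho> * (1 + log q N) ^ M)"
      using error exact_diff by (intro exI[of _ "\<Sum>l\<in>spectrum C - Lam. Kr l"]) auto
    show "(\<Sum>n<N. v n $ 0) = (\<Sum>l\<in>Lam. periodic_sum l (m l) (\<Phi> l) (log q N))" if "Lam = spectrum C" "N \<ge> 1" for N
      using exact_diff[OF that(2)] that(1) by simp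
  qed (use per cont hoelder fourier in auto)
qed

end

lemma main_term_eq_periodic_sum:
  assumes q: "q \<ge> 2" and N: "N \<ge> 1" and per: "\<And>k t. k < n \<Longrightarrow> \<Phi> k (t + 1) = \<Phi> k t"
  shows "of_nat N powr clog q l * (\<Sum>k<n. of_real (log q N) ^ k * \<Phi> k (frac (log q N))) =
     periodic_sum l n \<Phi> (log q (real N))"
proof -
  have "of_nat N powr clog q l = exp (Ln l * of_real (log q N))"
    using N by (simp add: powr_def clog_def log_def Ln_of_nat mult_ac)
  moreover have "\<Phi> k (frac t) = \<Phi> k t" if "k < n" for k t
    using periodic_add_int[of "\<Phi> k" t "- \<lfloor>t\<rfloor>", OF per[OF that]] by (simp add: frac_def)
  ultimately show ?thesis by (simp add: periodic_sum_def)
qed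

lemma bigo_log_power:
  fixes q M :: nat and f :: "nat \<Rightarrow> real"
  assumes q: "q \<ge> 2" and f: "\<And>N. N \<ge> 1 \<Longrightarrow> \<bar>f N\<bar> \<le> K * (real N powr \<rho> * (1 + log q N) ^ M)"
  shows "f \<in> O(\<lambda>N. real N powr \<rho> * ln (real N) ^ M)"
proof (rule bigoI)
  have lnq: "ln q > 0" using q by simp
  show "eventually (\<lambda>N. norm (f N) \<le> (\<bar>K\<bar> * (1 + 1 / ln q) ^ M) * norm (real N powr \<rho> * ln (real N) ^ M)) at_top"
    using eventually_ge_at_top[of 3]
  proof eventually_elim
    case (elim N)
    have "(3 :: real) \<le> real N" using elim by simp
    hence "exp 1 \<le> real N" by (rule order.trans[OF exp_le])
    hence ln1: "ln (real N) \<ge> 1" using elim by (subst ln_ge_iff) auto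
    have "1 + log q N \<le> (1 + 1 / ln q) * ln N"
      using ln1 by (simp add: log_def distrib_right)
    hence "(1 + log q N) ^ M \<le> ((1 + 1 / ln q) * ln N) ^ M"
      using elim q by (intro power_mono) auto
    hence *: "(1 + log q N) ^ M \<le> (1 + 1 / ln q) ^ M * ln N ^ M" by (simp add: power_mult_distrib)
    have "norm (f N) \<le> K * (real N powr \<rho> * (1 + log q N) ^ M)" using f[of N] elim by simp
    also have "\<dots> \<le> \<bar>K\<bar> * (real N powr \<rho> * ((1 + 1 / ln q) ^ M * ln N ^ M))"
      using elim q by (intro mult_mono mult_left_mono * mult_nonneg_nonneg zero_le_power) auto
    also have "\<dots> = (\<bar>K\<bar> * (1 + 1 / ln q) ^ M) * norm (real N powr \<rho> * ln (real N) ^ M)"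
      using ln1 by (simp add: abs_mult)
    finally show ?case .
  qed
qed

theorem theorem2:
  fixes q d :: nat
    and A :: "nat \<Rightarrow> complex Matrix.mat"
    and v :: "nat \<Rightarrow> complex Matrix.vec"
    and nrm :: "complex Matrix.vec \<Rightarrow> real"
    and C :: "complex Matrix.mat"
    and R :: real
    and x X :: "nat \<Rightarrow> complex"
    and m :: "complex \<Rightarrow> nat"
    and Lam :: "complex set"
  assumes q: "q \<ge> 2" and d: "d \<ge> 1"
    and A: "\<And>r. r < q \<Longrightarrow> A r \<in> carrier_mat d d"
    and v: "\<And>n. v n \<in> carrier_vec d"
    and rec: "\<And>n r. r < q \<Longrightarrow> v (q * n + r) = A r *\<^sub>v v n"
    and x: "x = (\<lambda>n. v n $ 0)"
    and X: "X = (\<lambda>N. \<Sum>n<N. x n)"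
    and C: "C = mat_sum d A q"
    and nrm: "is_vector_norm d nrm"
    and R: "R > 0"
    and growth: "\<exists>K. \<forall>rs. set rs \<subseteq> {..<q} \<longrightarrow>
                   induced_norm d nrm (mat_product d A rs) \<le> K * R ^ length rs"
    and m: "m = max_jordan_block C"
    and Lam: "Lam = {l \<in> spectrum C. cmod l > R}"
  shows "\<exists>(Phi :: complex \<Rightarrow> nat \<Rightarrow> real \<Rightarrow> complex) (V :: complex \<Rightarrow> complex Matrix.vec).
    (let main = (\<lambda>N. \<Sum>l\<in>Lam. of_nat N powr clog q l *
                  (\<Sum>k<m l. of_real (log q N) ^ k * Phi l k (frac (log q N))));
         H0 = {s. Re s > log q R};
         H1 = {s. Re s > log q R + 1}
     in
      (\<forall>l\<in>Lam. \<forall>k<m l. continuous_on UNIV (Phi l k) \<and> (\<forall>u. Phi l k (u + 1) = Phi l k u)) \<and>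
      (\<lambda>N. cmod (X N - main N)) \<in>
        O(\<lambda>N. real N powr log q R * ln (real N) ^ Max (m ` {l. cmod l = R})) \<and>
      ((\<forall>l\<in>spectrum C. cmod l > R) \<longrightarrow> (\<forall>N\<ge>1. X N = main N)) \<and>
      (\<forall>l\<in>Lam. \<forall>k<m l. \<forall>a. 0 < a \<and> a < log q (cmod l / R) \<longrightarrow>
         hoelder_continuous a (Phi l k)) \<and>
      converges_abs_unif_compacts d (dirichlet_term v) H1 \<and>
      (\<forall>s. V s \<in> carrier_vec d) \<and>
      (\<forall>i<d. (\<lambda>s. V s $ i) nicely_meromorphic_on H0) \<and>
      (\<forall>s\<in>H1. V s = vec_suminf d (\<lambda>n. dirichlet_term v n s)) \<and>
      (\<forall>s\<in>H0. (\<forall>i<d. \<not> is_pole (\<lambda>s. V s $ i) s) \<longrightarrow>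
         (1\<^sub>m d - (of_nat q powr (- s)) \<cdot>\<^sub>m C) *\<^sub>v V s =
         finsum_vec TYPE(complex) d (\<lambda>n. (of_nat n powr (- s)) \<cdot>\<^sub>v v n) {1..<q} +
         (of_nat q powr (- s)) \<cdot>\<^sub>v
           finsum_vec TYPE(complex) d
             (\<lambda>r. A r *\<^sub>v vec_suminf d (\<lambda>k. shift_term q V r k s)) {..<q}) \<and>
      (\<forall>r<q. converges_abs_unif_compacts d (shift_term q V r) H0) \<and>
      (\<forall>s\<in>H0. \<forall>i<d. is_pole (\<lambda>s. V s $ i) s \<longrightarrow> of_nat q powr s \<in> spectrum C) \<and>
      (\<forall>l\<in>Lam. \<forall>k<m l. \<forall>u :: real.
         (\<lambda>L. \<Sum>j = - int L..int L.
            fourier_coeff q (x 0) (\<lambda>s. V s $ 0) l k j * exp (2 * of_int j * of_real pi * \<i> * of_real u))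
         \<longlonglongrightarrow> Phi l k u))"
proof -
  interpret regular_sequence q d A v
    using q d A v rec by unfold_locales
  define \<rho> where "\<rho> = log q R"
  have R\<rho>: "real q powr \<rho> = R" using q R by (simp add: \<rho>_def)
  obtain K where K: "\<forall>rs. set rs \<subseteq> {..<q} \<longrightarrow> (\<forall>i<d. cmod ((mat_product d A rs *\<^sub>v v 0) $ i) \<le> K * R ^ length rs)"
    using product_orbit_bound[OF nrm d A growth v[of 0]] by blast
  \<comment> \<open>For R < 1 the sequence vanishes, so it satisfies every bound.\<close>
  have bd: "polynomially_bounded \<rho> (\<lambda>n. v n $ i)" if "i < d" for i
  proof (cases "R \<ge> 1")
    case True
    show ?thesis unfolding \<rho>_def by (rule coordinate_growth[OF True K that])
  next
    case False
    hence "v n $ i = 0" for n using vanishing[OF R _ K] that by simp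
    thus ?thesis by (auto simp: polynomially_bounded_def intro!: exI[of _ 0])
  qed
  interpret B: bounded_regular_sequence q d A v \<rho>
    using bd by unfold_locales
  have BC: "B.C = C" by (simp add: B.C_def C)
  have large: "B.large_eigenvalues = Lam" by (simp add: B.large_eigenvalues_def BC Lam R\<rho>)
  define main where "main \<Phi> N = (\<Sum>l\<in>Lam. of_nat N powr clog q l *
      (\<Sum>k<m l. of_real (log q N) ^ k * \<Phi> l k (frac (log q N))))"
    for \<Phi> :: "complex \<Rightarrow> nat \<Rightarrow> real \<Rightarrow> complex" and N :: nat
  have "\<exists>\<Phi>. (\<forall>l\<in>Lam. \<forall>k<m l. continuous_on UNIV (\<Phi> l k) \<and> (\<forall>u. \<Phi> l k (u + 1) = \<Phi> l k u)) \<and>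
      (\<lambda>N. cmod (X N - main \<Phi> N)) \<in> O(\<lambda>N. real N powr log q R * ln (real N) ^ Max (m ` {l. cmod l = R})) \<and>
      ((\<forall>l\<in>spectrum C. cmod l > R) \<longrightarrow> (\<forall>N\<ge>1. X N = main \<Phi> N)) \<and>
      (\<forall>l\<in>Lam. \<forall>k<m l. \<forall>a. 0 < a \<and> a < log q (cmod l / R) \<longrightarrow> hoelder_continuous a (\<Phi> l k)) \<and>
      (\<forall>l\<in>Lam. \<forall>k<m l. \<forall>u :: real.
         (\<lambda>L. \<Sum>j = - int L..int L.
            fourier_coeff q (x 0) (\<lambda>s. B.V s $ 0) l k j * exp (2 * of_int j * of_real pi * \<i> * of_real u))
         \<longlonglongrightarrow> \<Phi> l k u)"
  proof (cases "R \<ge> 1")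
    case False
    have v0: "v n = 0\<^sub>v d" for n using vanishing[OF R _ K] False by simp
    have V0: "B.V s $ 0 = 0" for s using B.V_zero[OF v0, of 0] d by simp
    have x0: "x n = 0" for n using d by (simp add: x v0)
    have "fourier_coeff q (x 0) (\<lambda>s. B.V s $ 0) l k j = 0" for l k j
      by (simp add: fourier_coeff_def V0 x0 residue_const)
    thus ?thesis
      by (intro exI[of _ "\<lambda>_ _ _. 0"])
         (auto simp: main_def X x0 hoelder_continuous_def intro!: exI[of _ 0])
  next
    case True
    have rho: "\<rho> \<ge> 0" using True q by (simp add: \<rho>_def)
    obtain \<Phi> K where
        props: "\<And>l k. l \<in> Lam \<Longrightarrow> k < m l \<Longrightarrow> (\<forall>t. \<Phi> l k (t + 1) = \<Phi> l k t) \<and> continuous_on UNIV (\<Phi> l k) \<and>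
          (\<forall>a. 0 < a \<and> a < log q (cmod l / R) \<longrightarrow> hoelder_continuous a (\<Phi> l k)) \<and>
          (\<forall>j. fourier_coeff q (v 0 $ 0) (\<lambda>s. B.V s $ 0) l k j =
             integral {0..1} (\<lambda>t. \<Phi> l k t * exp (\<i> * of_real (- 2 * pi * of_int j * t))))"
      and err: "\<And>N. N \<ge> 1 \<Longrightarrow> cmod (X N - (\<Sum>l\<in>Lam. periodic_sum l (m l) (\<Phi> l) (log q N)))
           \<le> K * (real N powr \<rho> * (1 + log q N) ^ Max (m ` {l. cmod l = R}))"
      and exact: "\<And>N. Lam = spectrum C \<Longrightarrow> N \<ge> 1 \<Longrightarrow> X N = (\<Sum>l\<in>Lam. periodic_sum l (m l) (\<Phi> l) (log q N))"
      using B.summatory_expansion[OF rho] unfolding BC large R\<rho> X x m by blast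
    have main: "main \<Phi> N = (\<Sum>l\<in>Lam. periodic_sum l (m l) (\<Phi> l) (log q N))" if "N \<ge> 1" for N
      unfolding main_def using props by (intro sum.cong refl main_term_eq_periodic_sum[OF q that]) auto
    have "(\<lambda>N. cmod (X N - main \<Phi> N)) \<in> O(\<lambda>N. real N powr \<rho> * ln (real N) ^ Max (m ` {l. cmod l = R}))"
      by (rule bigo_log_power[OF q, where K = K]) (use err main in simp)
    moreover have "X N = main \<Phi> N" if "\<forall>l\<in>spectrum C. cmod l > R" "N \<ge> 1" for N
    proof -
      have "Lam = spectrum C" using that(1) by (auto simp: Lam)
      thus ?thesis using exact[OF _ that(2)] main[OF that(2)] by simp
    qed
    moreover have "(\<lambda>L. \<Sum>j = - int L..int L.
            fourier_coeff q (x 0) (\<lambda>s. B.V s $ 0) l k j * exp (2 * of_int j * of_real pi * \<i> * of_real u))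
         \<longlonglongrightarrow> \<Phi> l k u" if l: "l \<in> Lam" "k < m l" for l k u
    proof -
      define a where "a = log q (cmod l / R) / 2"
      have "1 < cmod l / R" using l R by (simp add: Lam)
      hence "0 < log q (cmod l / R)" using q by simp
      hence a: "0 < a" "a < log q (cmod l / R)" by (simp_all add: a_def)
      have h: "hoelder_continuous a (\<Phi> l k)" and per: "\<Phi> l k (t + 1) = \<Phi> l k t" for t
        using props[OF l] a by auto
      have "exp (\<i> * of_real (2 * pi * of_int j * u)) = exp (2 * of_int j * of_real pi * \<i> * of_real u)" for j
        by (simp add: mult_ac)
      thus ?thesis using fourier_series_converges[OF h a(1) per, of u] props[OF l] by (simp add: x)
    qed
    ultimately show ?thesis using props by (intro exI[of _ \<Phi>]) (simp add: \<rho>_def)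
  qed
  then obtain \<Phi> where \<Phi>:
    "\<forall>l\<in>Lam. \<forall>k<m l. continuous_on UNIV (\<Phi> l k) \<and> (\<forall>u. \<Phi> l k (u + 1) = \<Phi> l k u)"
    "(\<lambda>N. cmod (X N - main \<Phi> N)) \<in> O(\<lambda>N. real N powr log q R * ln (real N) ^ Max (m ` {l. cmod l = R}))"
    "(\<forall>l\<in>spectrum C. cmod l > R) \<longrightarrow> (\<forall>N\<ge>1. X N = main \<Phi> N)"
    "\<forall>l\<in>Lam. \<forall>k<m l. \<forall>a. 0 < a \<and> a < log q (cmod l / R) \<longrightarrow> hoelder_continuous a (\<Phi> l k)"
    "\<forall>l\<in>Lam. \<forall>k<m l. \<forall>u :: real.
         (\<lambda>L. \<Sum>j = - int L..int L.
            fourier_coeff q (x 0) (\<lambda>s. B.V s $ 0) l k j * exp (2 * of_int j * of_real pi * \<i> * of_real u))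
         \<longlonglongrightarrow> \<Phi> l k u"
    by blast
  show ?thesis
    unfolding Let_def main_def[symmetric] \<rho>_def[symmetric]
  proof (rule exI[of _ \<Phi>], rule exI[of _ B.V], intro conjI)
    show "\<forall>s\<in>{s. Re s > \<rho>}. (\<forall>i<d. \<not> is_pole (\<lambda>s. B.V s $ i) s) \<longrightarrow>
         (1\<^sub>m d - (of_nat q powr (- s)) \<cdot>\<^sub>m C) *\<^sub>v B.V s =
         finsum_vec TYPE(complex) d (\<lambda>n. (of_nat n powr (- s)) \<cdot>\<^sub>v v n) {1..<q} +
         (of_nat q powr (- s)) \<cdot>\<^sub>v
           finsum_vec TYPE(complex) d
             (\<lambda>r. A r *\<^sub>v vec_suminf d (\<lambda>k. shift_term q B.V r k s)) {..<q}"
      using B.V_vector_equation unfolding BC by blast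
    show "\<forall>s\<in>{s. Re s > \<rho>}. \<forall>i<d. is_pole (\<lambda>s. B.V s $ i) s \<longrightarrow> of_nat q powr s \<in> spectrum C"
      using B.V_pole unfolding BC by blast
    show "\<forall>i<d. (\<lambda>s. B.V s $ i) nicely_meromorphic_on {s. Re s > \<rho>}"
      using B.V_nicely_meromorphic by blast
    show "\<forall>s\<in>{s. Re s > \<rho> + 1}. B.V s = vec_suminf d (\<lambda>n. dirichlet_term v n s)"
      using B.V_eq_series by blast
    show "\<forall>s. B.V s \<in> carrier_vec d" using B.V_carrier by blast
    show "converges_abs_unif_compacts d (dirichlet_term v) {s. Re s > \<rho> + 1}"
      by (rule B.dirichlet_term_converges)
    show "\<forall>r<q. converges_abs_unif_compacts d (shift_term q B.V r) {s. Re s > \<rho>}"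
      using B.shift_term_converges by blast
  qed (use \<Phi> in \<open>simp_all add: \<rho>_def\<close>)
qed

end
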